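(* Let $\Lambda>0$, $k\in\mathbb{Z}\cap[0,n]$, $0<R\le\frac12$, $t\in(-4,4)$, and $u\in H_\Lambda(P_4,\mathcal{N})$. For any $\varepsilon>0$ there exists $\delta>0$, depending only on $\varepsilon,\Lambda,n$ and $\mathcal{N}$, such that for any $r\in[0,\frac R2)$, $$\Sigma_{\varepsilon;r,R}^k(u,t)\subset\Sigma_{\delta;r,2R}^k(u,t)\subset\Sigma_{\delta;r,R}^k(u,t).$$
   Context: $n\ge2$, $d\ge 2$ are integers; $\mathcal{N}$ is a smooth compact manifold isometrically embedded in $\mathbb{R}^d$, with second fundamental form $A$. $B_r(x)$ is the open ball in $\mathbb{R}^n$, $B_r=B_r(0)$; $P_r(X)=B_r(x)\times(t-r^2,t+r^2)$ for $X=(x,t)$, $P_r=P_r(0)$. Suitable solution: for an open cylinder $U=\Omega\times I$, a map $u:U\to\mathcal{N}$ with $\partial_tu,\nabla u\in L^2(U)$ is a suitable solution of the harmonic map flow $\partial_tu-\Delta u=A(u)(\nabla u,\nabla u)$ if: (i) $\int_U(\partial_tu\,\psi+\nabla u\cdot\nabla\psi-A(u)(\nabla u,\nabla u)\psi)=0$ for all $\psi\in C_0^\infty(U)$; (ii) $\int_U(|\nabla u|^2\partial_t\theta-2|\partial_tu|^2\theta-2\partial_tu\,\nabla u\cdot\nabla\theta)=0$ for all $\theta\in C_0^\infty(U)$; (iii) $\int_U(|\nabla u|^2\operatorname{div}_x\xi-2\sum_{i,j}\partial_i\xi^j\,\partial_iu\cdot\partial_ju-2\partial_tu\,\nabla u\cdot\xi)=0$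 for all $\xi\in C_0^\infty(U,\mathbb{R}^n)$. $H_\Lambda(U,\mathcal{N})$: suitable solutions on $U$ with $\int_U|\nabla u|^2\le\Lambda$. Symmetry: for $X=(x,t)$, $(T_{X,r}u)(y,s)=u(x+ry,t+r^2s)$ and, for a Radon measure $\mu$ on $\mathbb{R}^n\times\mathbb{R}$, $(T_{X,r}\mu)(S)=r^{-n}\mu(\{(x+ry,t+r^2s):(y,s)\in S\})$. $\mu$ is backward self-similar if $T_{0,\lambda}\mu=\mu$ on $\mathbb{R}^n\times(-\infty,0)$ for all $\lambda>0$; it is backward invariant with respect to a subspace $V\subset\mathbb{R}^n$ if its translates by $(v,0)$, $v\in V$, agree with $\mu$ on $\mathbb{R}^n\times(-\infty,0)$. $\mu$ is spatially $k$-symmetric if it is backward self-similar and backward invariant with respect to some subspace of dimension $\ge k$ (so no measure is spatially $(n+1)$-symmetric). Fix a countable dense subset $\{f_i\}$ of $C_0(P_1)$ (sup norm) and set $\mathbb{M}_{0,1}(\mu,\nu)=\sum_{i}2^{-i}\frac{|\int_{P_1} f_i\,d\mu-\int_{P_1} f_i\,d\nu|}{1+|\int_{P_1} f_i\,d\mu-\int_{P_1} f_i\,d\nu|}$. $u$ is spatially $(k,\varepsilon)$-symmetric in $B_r(x)$ at time $t$ if $P_r((x,t))$ lies in the domain of $u$ and there is a spatially $k$-symmetric Radon measure $\mu$ on $\mathbb{R}^n\times\mathbb{R}$ with $\mathbb{M}_{0,1}(\tfrac12|\nabla(T_{(x,t),r}u)|^2dy\,ds,\mu)<\varepsilon$.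 Quantitative strata: for $u$ on $P_4$ and $0<r<R\le1$, $\Sigma_{\varepsilon;r,R}^k(u,t)$ is the set of $x\in B_2$ such that for every $s\in[r,R]$, $u$ is not spatially $(k+1,\varepsilon)$-symmetric in $B_s(x)$ at $t$; and $\Sigma_{\varepsilon;0,R}^k(u,t)=\bigcap_{0<r<R}\Sigma_{\varepsilon;r,R}^k(u,t)$.
   Formalization: For an arbitrary dense subset {f_i} of C_0(P_1) the claim can fail; it is proved for dense {f_i} such that every nonnegative compactly supported continuous function on P_1 is a uniform limit of nonnegative f_i supported in one common compact subset of P_1. *)

theory Defs
  imports "HOL-Analysis.Analysis"
begin

section \<open>Smooth maps and test functions\<close>

text \<open>
  \<open>Ck_on k S f\<close> is meant for open \<open>S\<close>: all iterated directional derivatives of \<open>f\<close> up to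
  order \<open>k\<close>, along basis vectors, exist and are continuous on \<open>S\<close>.
\<close>

primrec Ck_on ::
    "nat \<Rightarrow> 'a::euclidean_space set \<Rightarrow> ('a \<Rightarrow> 'b::real_normed_vector) \<Rightarrow> bool" where
  "Ck_on 0 S f \<longleftrightarrow> continuous_on S f"
| "Ck_on (Suc k) S f \<longleftrightarrow>
     (\<forall>x\<in>S. f differentiable (at x)) \<and>
     (\<forall>b\<in>Basis. Ck_on k S (\<lambda>x. frechet_derivative f (at x) b))"

definition smooth_on ::
    "'a::euclidean_space set \<Rightarrow> ('a \<Rightarrow> 'b::real_normed_vector) \<Rightarrow> bool" where
  "smooth_on S f \<longleftrightarrow> (\<forall>k. Ck_on k S f)"

definition compact_support_in :: "'a::topological_space set \<Rightarrow> ('a \<Rightarrow> 'b::zero) \<Rightarrow> bool" where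
  "compact_support_in U \<phi> \<longleftrightarrow>
     compact (closure {X. \<phi> X \<noteq> 0}) \<and> closure {X. \<phi> X \<noteq> 0} \<subseteq> U"

definition test_functions ::
    "'a::euclidean_space set \<Rightarrow> ('a \<Rightarrow> 'b::real_normed_vector) set" where
  "test_functions U = {\<phi>. smooth_on UNIV \<phi> \<and> compact_support_in U \<phi>}"

section \<open>Weak derivatives\<close>

definition locally_integrable ::
    "'a::euclidean_space set \<Rightarrow> ('a \<Rightarrow> 'b::euclidean_space) \<Rightarrow> bool" where
  "locally_integrable U g \<longleftrightarrow> (\<forall>K. compact K \<and> K \<subseteq> U \<longrightarrow> set_integrable lebesgue K g)"

definition square_integrable ::
    "'a::euclidean_space set \<Rightarrow> ('a \<Rightarrow> 'b::euclidean_space) \<Rightarrow> bool" where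
  "square_integrable U g \<longleftrightarrow>
     set_borel_measurable lebesgue U g \<and> set_integrable lebesgue U (\<lambda>X. (norm (g X))\<^sup>2)"

definition has_weak_deriv ::
    "'a::euclidean_space set \<Rightarrow> ('a \<Rightarrow> 'b::euclidean_space) \<Rightarrow> 'a \<Rightarrow> ('a \<Rightarrow> 'b) \<Rightarrow> bool" where
  "has_weak_deriv U u b g \<longleftrightarrow>
     locally_integrable U u \<and> locally_integrable U g \<and>
     (\<forall>\<phi>::'a \<Rightarrow> real. \<phi> \<in> test_functions U \<longrightarrow>
        (LINT X:U|lebesgue. frechet_derivative \<phi> (at X) b *\<^sub>R u X)
          = - (LINT X:U|lebesgue. \<phi> X *\<^sub>R g X))"

text \<open>
  Weak derivatives are unique up to null sets of \<open>U\<close>, and all uses below are insensitive to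
  null sets.
\<close>

definition weak_deriv ::
    "'a::euclidean_space set \<Rightarrow> ('a \<Rightarrow> 'b::euclidean_space) \<Rightarrow> 'a \<Rightarrow> ('a \<Rightarrow> 'b)" where
  "weak_deriv U u b = (SOME g. has_weak_deriv U u b g)"

section \<open>Embedded submanifolds and their second fundamental form\<close>

text \<open>Boundaryless embedded submanifolds of dimension \<open>m\<close>, by slice charts of the ambient space.\<close>

definition smooth_submanifold :: "nat \<Rightarrow> 'a::euclidean_space set \<Rightarrow> bool" where
  "smooth_submanifold m N \<longleftrightarrow>
     (\<forall>p\<in>N. \<exists>W \<Phi> \<Psi> L. open W \<and> p \<in> W \<and> open (\<Phi> ` W) \<and>
        smooth_on W (\<Phi> :: 'a \<Rightarrow> 'a) \<and> smooth_on (\<Phi> ` W) (\<Psi> :: 'a \<Rightarrow> 'a) \<and>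
        (\<forall>x\<in>W. \<Psi> (\<Phi> x) = x) \<and>
        subspace L \<and> dim L = m \<and> \<Phi> ` (N \<inter> W) = L \<inter> \<Phi> ` W)"

definition tangent_space :: "'a::euclidean_space set \<Rightarrow> 'a \<Rightarrow> 'a set" where
  "tangent_space N p =
     {v. \<exists>(\<gamma> :: real \<Rightarrow> 'a) e. 0 < e \<and> smooth_on {-e<..<e} \<gamma> \<and> \<gamma> ` {-e<..<e} \<subseteq> N \<and>
           \<gamma> 0 = p \<and> (\<gamma> has_vector_derivative v) (at 0)}"

definition normal_part :: "'a::euclidean_space set \<Rightarrow> 'a \<Rightarrow> 'a" where
  "normal_part T v = (THE z. z \<in> orthogonal_comp T \<and> v - z \<in> T)"

text \<open>
  For tangent \<open>v, w\<close> at \<open>p\<close> the normal part of \<open>D_v Y\<close> is the same for every local smooth field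
  \<open>Y\<close> that is tangent along \<open>N\<close> with \<open>Y p = w\<close>. The sign is the one for which
  \<open>\<partial>\<^sub>t u - \<Delta> u = A(u)(\<nabla>u, \<nabla>u)\<close> is the harmonic map flow: \<open>A p v w = (v \<bullet> w) p\<close> on the unit
  sphere, where the flow is \<open>\<partial>\<^sub>t u - \<Delta> u = |\<nabla>u|\<^sup>2 u\<close>. Since weak derivatives of an \<open>N\<close>-valued
  Sobolev map are tangent almost everywhere, the value at other \<open>v, w\<close> is irrelevant.
\<close>

definition second_fundamental_form :: "'a::euclidean_space set \<Rightarrow> 'a \<Rightarrow> 'a \<Rightarrow> 'a \<Rightarrow> 'a" where
  "second_fundamental_form N p v w =
     (THE z. \<exists>W (Y :: 'a \<Rightarrow> 'a). open W \<and> p \<in> W \<and> smooth_on W Y \<and>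
        (\<forall>q\<in>N \<inter> W. Y q \<in> tangent_space N q) \<and> Y p = w \<and>
        z = - normal_part (tangent_space N p) (frechet_derivative Y (at p) v))"

section \<open>Space-time and suitable solutions\<close>

type_synonym 'n spacetime = "(real^'n) \<times> real"

definition par_cyl :: "real \<Rightarrow> ('n::finite) spacetime \<Rightarrow> 'n spacetime set" where
  "par_cyl r X = ball (fst X) r \<times> {snd X - r\<^sup>2 <..< snd X + r\<^sup>2}"

definition dir_t :: "('n::finite) spacetime" where
  "dir_t = (0, 1)"

definition dir_x :: "'n::finite \<Rightarrow> 'n spacetime" where
  "dir_x i = (axis i 1, 0)"

definition weak_dt ::
    "('n::finite) spacetime set \<Rightarrow> ('n spacetime \<Rightarrow> real^'d) \<Rightarrow> 'n spacetime \<Rightarrow> real^'d" where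
  "weak_dt U u = weak_deriv U u dir_t"

definition weak_dx ::
    "('n::finite) spacetime set \<Rightarrow> ('n spacetime \<Rightarrow> real^'d) \<Rightarrow> 'n \<Rightarrow> 'n spacetime \<Rightarrow> real^'d" where
  "weak_dx U u i = weak_deriv U u (dir_x i)"

definition grad_sq ::
    "('n::finite) spacetime set \<Rightarrow> ('n spacetime \<Rightarrow> real^'d) \<Rightarrow> 'n spacetime \<Rightarrow> real" where
  "grad_sq U u X = (\<Sum>i\<in>UNIV. (norm (weak_dx U u i X))\<^sup>2)"

definition classical_dt ::
    "(('n::finite) spacetime \<Rightarrow> 'b::real_normed_vector) \<Rightarrow> 'n spacetime \<Rightarrow> 'b" where
  "classical_dt \<phi> X = frechet_derivative \<phi> (at X) dir_t"

definition classical_dx ::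
    "'n::finite \<Rightarrow> ('n spacetime \<Rightarrow> 'b::real_normed_vector) \<Rightarrow> 'n spacetime \<Rightarrow> 'b" where
  "classical_dx i \<phi> X = frechet_derivative \<phi> (at X) (dir_x i)"

definition open_cylinder :: "('n::finite) spacetime set \<Rightarrow> bool" where
  "open_cylinder U \<longleftrightarrow> (\<exists>\<Omega> I. open \<Omega> \<and> open I \<and> connected I \<and> U = \<Omega> \<times> I)"

definition suitable_solution ::
    "(real^'d) set \<Rightarrow> ('n::finite) spacetime set \<Rightarrow> ('n spacetime \<Rightarrow> real^'d) \<Rightarrow> bool" where
  "suitable_solution N U u \<longleftrightarrow>
     open_cylinder U \<and> u ` U \<subseteq> N \<and> set_borel_measurable lebesgue U u \<and>
     has_weak_deriv U u dir_t (weak_dt U u) \<and> square_integrable U (weak_dt U u) \<and>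
     (\<forall>i. has_weak_deriv U u (dir_x i) (weak_dx U u i) \<and> square_integrable U (weak_dx U u i)) \<and>
     (\<forall>\<psi>::'n spacetime \<Rightarrow> real. \<psi> \<in> test_functions U \<longrightarrow>
        (LINT X:U|lebesgue.
            \<psi> X *\<^sub>R weak_dt U u X
            + (\<Sum>i\<in>UNIV. classical_dx i \<psi> X *\<^sub>R weak_dx U u i X)
            - \<psi> X *\<^sub>R (\<Sum>i\<in>UNIV.
                second_fundamental_form N (u X) (weak_dx U u i X) (weak_dx U u i X))) = 0) \<and>
     (\<forall>\<theta>::'n spacetime \<Rightarrow> real. \<theta> \<in> test_functions U \<longrightarrow>
        (LINT X:U|lebesgue.
            grad_sq U u X * classical_dt \<theta> X
            - 2 * (norm (weak_dt U u X))\<^sup>2 * \<theta> X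
            - 2 * (\<Sum>i\<in>UNIV. (weak_dt U u X \<bullet> weak_dx U u i X) * classical_dx i \<theta> X)) = 0) \<and>
     (\<forall>\<xi>::'n spacetime \<Rightarrow> real^'n. \<xi> \<in> test_functions U \<longrightarrow>
        (LINT X:U|lebesgue.
            grad_sq U u X * (\<Sum>i\<in>UNIV. classical_dx i \<xi> X $ i)
            - 2 * (\<Sum>i\<in>UNIV. \<Sum>j\<in>UNIV.
                classical_dx i \<xi> X $ j * (weak_dx U u i X \<bullet> weak_dx U u j X))
            - 2 * (\<Sum>i\<in>UNIV. (weak_dt U u X \<bullet> weak_dx U u i X) * \<xi> X $ i)) = 0)"

definition H_class ::
    "real \<Rightarrow> ('n::finite) spacetime set \<Rightarrow> (real^'d) set \<Rightarrow> ('n spacetime \<Rightarrow> real^'d) set" where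
  "H_class \<Lambda> U N = {u. suitable_solution N U u \<and> (LINT X:U|lebesgue. grad_sq U u X) \<le> \<Lambda>}"

section \<open>Symmetric measures\<close>

definition radon_measure :: "('n::finite) spacetime measure \<Rightarrow> bool" where
  "radon_measure \<mu> \<longleftrightarrow> sets \<mu> = sets borel \<and> (\<forall>K. compact K \<longrightarrow> emeasure \<mu> K < \<infinity>)"

definition par_map ::
    "('n::finite) spacetime \<Rightarrow> real \<Rightarrow> 'n spacetime \<Rightarrow> 'n spacetime" where
  "par_map X r Y = (fst X + r *\<^sub>R fst Y, snd X + r\<^sup>2 * snd Y)"

definition T_map ::
    "('n::finite) spacetime \<Rightarrow> real \<Rightarrow> ('n spacetime \<Rightarrow> real^'d) \<Rightarrow> 'n spacetime \<Rightarrow> real^'d" where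
  "T_map X r u = (\<lambda>Y. u (par_map X r Y))"

definition T_measure ::
    "('n::finite) spacetime \<Rightarrow> real \<Rightarrow> 'n spacetime measure \<Rightarrow> 'n spacetime set \<Rightarrow> ennreal" where
  "T_measure X r \<mu> S = ennreal (1 / r ^ CARD('n)) * emeasure \<mu> (par_map X r ` S)"

definition past :: "('n::finite) spacetime set" where
  "past = UNIV \<times> {..<0}"

definition backward_self_similar :: "('n::finite) spacetime measure \<Rightarrow> bool" where
  "backward_self_similar \<mu> \<longleftrightarrow>
     (\<forall>l>0. \<forall>S\<in>sets borel. S \<subseteq> past \<longrightarrow> T_measure 0 l \<mu> S = emeasure \<mu> S)"

definition backward_invariant :: "('n::finite) spacetime measure \<Rightarrow> (real^'n) set \<Rightarrow> bool" where
  "backward_invariant \<mu> V \<longleftrightarrow>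
     (\<forall>v\<in>V. \<forall>S\<in>sets borel. S \<subseteq> past \<longrightarrow> emeasure \<mu> ((\<lambda>X. (v, 0) + X) ` S) = emeasure \<mu> S)"

definition spatially_symmetric :: "nat \<Rightarrow> ('n::finite) spacetime measure \<Rightarrow> bool" where
  "spatially_symmetric k \<mu> \<longleftrightarrow>
     backward_self_similar \<mu> \<and> (\<exists>V. subspace V \<and> k \<le> dim V \<and> backward_invariant \<mu> V)"

section \<open>The distance between measures\<close>

text \<open>
  For bounded open \<open>U\<close>, the functions in \<open>C\<^sub>0(U)\<close> are represented by their extensions by zero.
\<close>

definition C0 :: "('n::finite) spacetime set \<Rightarrow> ('n spacetime \<Rightarrow> real) set" where
  "C0 U = {\<phi>. continuous_on UNIV \<phi> \<and> (\<forall>X. X \<notin> U \<longrightarrow> \<phi> X = 0)}"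

definition dense_seq_C0 ::
    "('n::finite) spacetime set \<Rightarrow> (nat \<Rightarrow> 'n spacetime \<Rightarrow> real) \<Rightarrow> bool" where
  "dense_seq_C0 U f \<longleftrightarrow>
     range f \<subseteq> C0 U \<and> (\<forall>\<phi>\<in>C0 U. \<forall>\<eta>>0. \<exists>i. \<forall>X. \<bar>f i X - \<phi> X\<bar> < \<eta>)"

text \<open>
  Density in the sup norm alone does not make \<open>meas_dist\<close> below control vague convergence of
  measures whose mass on \<open>U\<close> is not bounded a priori, as is the case for the symmetric comparison
  measures: if \<open>L\<close> is a locally finite signed measure on \<open>U\<close> of infinite total variation, the
  kernel of \<open>L\<close> in \<open>C\<^sub>c(U)\<close> is still sup-norm dense in \<open>C\<^sub>0(U)\<close>, and a dense sequence from it
  does not see \<open>L\<close>. The following property excludes this. A dense sequence with it is obtained by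
  enumerating all \<open>\<chi>\<^sub>m q\<close> and \<open>\<chi>\<^sub>m max q 0\<close>, with \<open>q\<close> from a countable set of
  continuous functions dense in \<open>C(closure U)\<close> and cutoffs \<open>0 \<le> \<chi>\<^sub>m \<le> 1\<close> of compact support in \<open>U\<close>
  that equal 1 on the m-th set of a compact exhaustion of \<open>U\<close> by sets with nested interiors.
\<close>

definition detects_vague_convergence ::
    "('n::finite) spacetime set \<Rightarrow> (nat \<Rightarrow> 'n spacetime \<Rightarrow> real) \<Rightarrow> bool" where
  "detects_vague_convergence U f \<longleftrightarrow>
     (\<forall>\<phi>\<in>C0 U. compact_support_in U \<phi> \<and> (\<forall>X. 0 \<le> \<phi> X) \<longrightarrow>
        (\<exists>K. compact K \<and> K \<subseteq> U \<and>
           (\<forall>\<eta>>0. \<exists>i. (\<forall>X. X \<notin> K \<longrightarrow> f i X = 0) \<and> (\<forall>X. 0 \<le> f i X) \<and>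
                       (\<forall>X. \<bar>f i X - \<phi> X\<bar> < \<eta>))))"

definition meas_dist ::
    "(nat \<Rightarrow> ('n::finite) spacetime \<Rightarrow> real) \<Rightarrow> 'n spacetime measure \<Rightarrow> 'n spacetime measure \<Rightarrow> real"
  where
  "meas_dist f \<mu> \<nu> =
     (\<Sum>i. (1/2) ^ i *
        (let a = \<bar>(LINT X:par_cyl 1 0|\<mu>. f i X) - (LINT X:par_cyl 1 0|\<nu>. f i X)\<bar>
         in a / (1 + a)))"

definition energy_measure ::
    "('n::finite) spacetime set \<Rightarrow> ('n spacetime \<Rightarrow> real^'d) \<Rightarrow> 'n spacetime measure" where
  "energy_measure W w = density lebesgue (\<lambda>Y. ennreal (indicator W Y * (1/2 * grad_sq W w Y)))"

section \<open>Quantitative symmetry and strata\<close>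

text \<open>
  \<open>U\<close> is the domain of \<open>u\<close>; the domain of \<open>T_map (x, t) r u\<close> is the preimage of \<open>U\<close>.
\<close>

definition spatially_eps_symmetric ::
    "(nat \<Rightarrow> ('n::finite) spacetime \<Rightarrow> real) \<Rightarrow> 'n spacetime set \<Rightarrow> ('n spacetime \<Rightarrow> real^'d) \<Rightarrow>
     nat \<Rightarrow> real \<Rightarrow> real \<Rightarrow> real^'n \<Rightarrow> real \<Rightarrow> bool" where
  "spatially_eps_symmetric f U u k \<epsilon> r x t \<longleftrightarrow>
     par_cyl r (x, t) \<subseteq> U \<and>
     (\<exists>\<mu>. radon_measure \<mu> \<and> spatially_symmetric k \<mu> \<and>
        meas_dist f (energy_measure (par_map (x, t) r -` U) (T_map (x, t) r u)) \<mu> < \<epsilon>)"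

definition strat_pos ::
    "(nat \<Rightarrow> ('n::finite) spacetime \<Rightarrow> real) \<Rightarrow> nat \<Rightarrow> real \<Rightarrow> real \<Rightarrow> real \<Rightarrow>
     ('n spacetime \<Rightarrow> real^'d) \<Rightarrow> real \<Rightarrow> (real^'n) set" where
  "strat_pos f k \<epsilon> r R u t =
     {x \<in> ball 0 2. \<forall>s\<in>{r..R}. \<not> spatially_eps_symmetric f (par_cyl 4 0) u (k + 1) \<epsilon> s x t}"

definition strat ::
    "(nat \<Rightarrow> ('n::finite) spacetime \<Rightarrow> real) \<Rightarrow> nat \<Rightarrow> real \<Rightarrow> real \<Rightarrow> real \<Rightarrow>
     ('n spacetime \<Rightarrow> real^'d) \<Rightarrow> real \<Rightarrow> (real^'n) set" where
  "strat f k \<epsilon> r R u t =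
     (if r = 0 then (\<Inter>\<rho>\<in>{0<..<R}. strat_pos f k \<epsilon> \<rho> R u t) else strat_pos f k \<epsilon> r R u t)"

end

theory Submission
  imports Defs
begin

text \<open>
  Only a \<open>\<delta>\<close>-symmetric scale \<open>s\<close> in \<open>(R, 2R]\<close> has to be excluded, and this is reduced to the
  scale \<open>s/2 \<le> R\<close>. If the rescaled energy \<open>\<nu>\<close> at scale \<open>s\<close> is close to a symmetric \<open>\<mu>\<close>, then the
  rescaled energy \<open>T\<^bsub>0,1/2\<^esub> \<nu>\<close> at scale \<open>s/2\<close> is close to \<open>T\<^bsub>0,1/2\<^esub> \<mu>\<close>, which is again symmetric: testing
  \<open>T\<^bsub>0,1/2\<^esub> \<nu>\<close> with \<open>f\<^sub>i\<close> means testing \<open>\<nu>\<close> with \<open>f\<^sub>i(2y, 4\<sigma>)\<close>, which has compact support in \<open>P\<^sub>1\<close>, and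
  finitely many \<open>f\<^sub>i\<close> suffice. No compactness of the solution space is needed, only a uniform bound on
  \<open>\<nu>(P\<^sub>1) = s\<^sup>-\<^sup>n \<integral>\<^bsub>P\<^sub>s\<^esub> \<bar>\<nabla>u\<bar>\<^sup>2 / 2\<close>. This follows from the local monotonicity formula, obtained by inserting
  \<open>\<theta> = \<tau> w\<close> and \<open>\<xi> = -w y / 2\<close> into the two stationarity identities, where \<open>w\<close> is a cut-off backward heat
  kernel with pole slightly after the cylinder, \<open>\<tau>\<close> the time to the pole and \<open>y\<close> the spatial distance to it.
\<close>

section \<open>Calculus of smooth functions\<close>

text \<open>Symmetry of a comparison measure \<open>\<mu>\<close> concerns negative times only; on
  the rest of the cylinder \<open>\<mu>\<close> is arbitrary. Hence \<open>\<mu>\<close> itself need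
  not be close to the energy at scale \<open>s/2\<close>: it has to be dilated along with it. The
  comparison measures have no common mass bound, so uniform closeness of test functions alone does
  not make their integrals close; the bound on \<open>\<nu>\<close> is transferred to
  \<open>\<mu>\<close> on a compact set by a test function that is at least 1/2 there. The pair
  \<open>(\<xi>, \<theta>)\<close> is \<open>-w/2\<close> times the generator
  \<open>(y, -2 \<tau>)\<close> of parabolic dilations about the pole, which is why the quadratic
  terms form a square of favourable sign. The identities are integrated over space-time, without
  time slices, so the energy of a cylinder is extracted from the time derivative of a cutoff that
  falls across it. As \<open>weak_deriv\<close> is a choice made separately on each domain, the
  energies of a map and of its dilate are compared through uniqueness almost everywhere.\<close>

lemma Ck_on_cong:
  assumes "open S" and "\<And>x. x \<in> S \<Longrightarrow> f x = g x" and "Ck_on k S f"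
  shows "Ck_on k S g"
  using assms(2,3)
proof (induction k arbitrary: f g)
  case 0
  then show ?case by (simp cong: continuous_on_cong)
next
  case (Suc k)
  have fd: "(g has_derivative frechet_derivative f (at x)) (at x)" if "x \<in> S" for x
  proof (rule has_derivative_transform_within_open[OF _ assms(1) that])
    show "(f has_derivative frechet_derivative f (at x)) (at x)"
      using Suc.prems(2) that by (auto simp: frechet_derivative_works[symmetric])
  qed (use Suc.prems(1) in auto)
  have eq: "frechet_derivative f (at x) = frechet_derivative g (at x)" if "x \<in> S" for x
    using frechet_derivative_at[OF fd[OF that]] .
  have "Ck_on k S (\<lambda>x. frechet_derivative g (at x) b)" if "b \<in> Basis" for b
    by (rule Suc.IH[where f = "\<lambda>x. frechet_derivative f (at x) b"])
       (use Suc.prems that eq in auto)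
  then show ?case
    using fd by (auto simp: differentiable_def)
qed

lemma Ck_on_SucD: "Ck_on (Suc k) S f \<Longrightarrow> Ck_on k S f"
proof (induction k arbitrary: f)
  case 0
  then show ?case
    by (auto intro!: continuous_at_imp_continuous_on differentiable_imp_continuous_within)
qed auto

text \<open>\<open>Ck_on\<close> speaks of \<open>frechet_derivative\<close>, a choice term. This
  rule lets the closure proofs exhibit an explicit derivative instead.\<close>

lemma Ck_on_SucI:
  assumes "open S" and d: "\<And>x. x \<in> S \<Longrightarrow> (f has_derivative f' x) (at x)"
    and "\<And>b. b \<in> Basis \<Longrightarrow> Ck_on k S (\<lambda>x. f' x b)"
  shows "Ck_on (Suc k) S f"
proof -
  have eq: "f' x = frechet_derivative f (at x)" if "x \<in> S" for x
    using frechet_derivative_at[OF d[OF that]] .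
  have "Ck_on k S (\<lambda>x. frechet_derivative f (at x) b)" if "b \<in> Basis" for b
    by (rule Ck_on_cong[OF assms(1) _ assms(3)[OF that]]) (simp add: eq)
  then show ?thesis
    using d by (auto simp: differentiable_def)
qed

lemma Ck_on_Suc_has_derivative:
  "Ck_on (Suc k) S f \<Longrightarrow> x \<in> S \<Longrightarrow> (f has_derivative frechet_derivative f (at x)) (at x)"
  by (simp add: frechet_derivative_works[symmetric])

lemma Ck_on_const: "open S \<Longrightarrow> Ck_on k S (\<lambda>x. c)"
proof (induction k arbitrary: c)
  case (Suc k)
  then show ?case
    by (intro Ck_on_SucI[where f' = "\<lambda>x h. 0"] has_derivative_const) auto
qed simp

lemma Ck_on_linear:
  assumes "open S" "bounded_linear f"
  shows "Ck_on k S f"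
proof (cases k)
  case 0
  then show ?thesis using assms by (simp add: linear_continuous_on)
next
  case (Suc j)
  show ?thesis
    unfolding Suc
  proof (rule Ck_on_SucI[OF assms(1)])
    show "(f has_derivative f) (at x)" for x
      by (rule bounded_linear_imp_has_derivative[OF assms(2)])
    show "Ck_on j S (\<lambda>x. f b)" for b
      by (rule Ck_on_const[OF assms(1)])
  qed
qed

lemma Ck_on_add:
  assumes "open S" "Ck_on k S f" "Ck_on k S g"
  shows "Ck_on k S (\<lambda>x. f x + g x)"
  using assms(2,3)
proof (induction k arbitrary: f g)
  case 0
  then show ?case by (auto intro: continuous_intros)
next
  case (Suc k)
  show ?case
  proof (rule Ck_on_SucI[OF assms(1)], rule has_derivative_add)
    fix b :: 'a assume "b \<in> Basis"
    then show "Ck_on k S (\<lambda>x. frechet_derivative f (at x) b + frechet_derivative g (at x) b)"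
      using Suc by auto
  qed (use Suc in \<open>auto simp: frechet_derivative_works[symmetric]\<close>)
qed

text \<open>One product rule serves multiplication, scaling and inner products. The derivative keeps
  one factor undifferentiated, so the induction also uses that order \<open>Suc k\<close> implies
  order \<open>k\<close>.\<close>

lemma (in bounded_bilinear) Ck_on:
  assumes "open S" "Ck_on k S f" "Ck_on k S g"
  shows "Ck_on k S (\<lambda>x. prod (f x) (g x))"
  using assms(2,3)
proof (induction k arbitrary: f g)
  case 0
  then show ?case by (auto intro: continuous_on)
next
  case (Suc k)
  show ?case
  proof (rule Ck_on_SucI[OF assms(1)], rule FDERIV)
    fix b :: 'd assume "b \<in> Basis"
    then show "Ck_on k S (\<lambda>x. prod (f x) (frechet_derivative g (at x) b)
        + prod (frechet_derivative f (at x) b) (g x))"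
      using Suc.prems by (intro Ck_on_add Suc.IH assms(1)) (auto intro: Ck_on_SucD)
  qed (use Suc in \<open>auto simp: frechet_derivative_works[symmetric]\<close>)
qed

lemmas Ck_on_mult = bounded_bilinear.Ck_on[OF bounded_bilinear_mult]
lemmas Ck_on_scaleR = bounded_bilinear.Ck_on[OF bounded_bilinear_scaleR]
lemmas Ck_on_inner = bounded_bilinear.Ck_on[OF bounded_bilinear_inner]

lemma Ck_on_minus:
  fixes f :: "'a::euclidean_space \<Rightarrow> 'b::real_normed_vector"
  assumes "open S" "Ck_on k S f"
  shows "Ck_on k S (\<lambda>x. - f x)"
  using Ck_on_scaleR[OF assms(1) Ck_on_const[OF assms(1), of k "-1"] assms(2)] by simp

lemma Ck_on_diff:
  fixes f g :: "'a::euclidean_space \<Rightarrow> 'b::real_normed_vector"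
  assumes "open S" "Ck_on k S f" "Ck_on k S g"
  shows "Ck_on k S (\<lambda>x. f x - g x)"
  using Ck_on_add[OF assms(1,2) Ck_on_minus[OF assms(1,3)]] by simp

lemma Ck_on_prod:
  fixes f :: "'i \<Rightarrow> 'a::euclidean_space \<Rightarrow> real"
  assumes "open S" "\<And>i. i \<in> I \<Longrightarrow> Ck_on k S (f i)"
  shows "Ck_on k S (\<lambda>x. \<Prod>i\<in>I. f i x)"
  using assms(2)
proof (induction I rule: infinite_finite_induct)
  case (insert i I)
  then have "Ck_on k S (\<lambda>x. f i x * (\<Prod>i\<in>I. f i x))"
    by (intro Ck_on_mult assms(1)) auto
  then show ?case using insert by simp
qed (simp_all add: Ck_on_const assms(1))

text \<open>For a real outer function each basis derivative of the composite is a single product, so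
  the induction only replaces \<open>f\<close> by its derivative and keeps \<open>g\<close>.\<close>

lemma Ck_on_compose_real:
  fixes f :: "real \<Rightarrow> real" and g :: "'a::euclidean_space \<Rightarrow> real"
  assumes "open S" "Ck_on k T f" "Ck_on k S g" "g ` S \<subseteq> T"
  shows "Ck_on k S (\<lambda>x. f (g x))"
  using assms(2,3)
proof (induction k arbitrary: f)
  case 0
  then show ?case using assms(4) by (auto intro: continuous_on_compose2)
next
  case (Suc k)
  let ?f' = "\<lambda>y. frechet_derivative f (at y) 1"
  show ?case
  proof (rule Ck_on_SucI[OF assms(1)])
    fix x assume x: "x \<in> S"
    have "(f has_derivative frechet_derivative f (at (g x))) (at (g x))"
      using Ck_on_Suc_has_derivative[OF Suc.prems(1)] x assms(4) by auto
    then have "(f has_derivative (\<lambda>h. ?f' (g x) * h)) (at (g x))"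
      by (metis (no_types) has_derivative_imp_has_field_derivative has_field_derivative_def
          linear_frechet_derivative differentiable_def
          mult.commute mult.right_neutral real_scaleR_def linear_cmul)
    then show "((\<lambda>x. f (g x)) has_derivative
        (\<lambda>h. ?f' (g x) * frechet_derivative g (at x) h)) (at x)"
      by (rule has_derivative_compose[OF Ck_on_Suc_has_derivative[OF Suc.prems(2) x]])
  next
    fix b :: 'a assume "b \<in> Basis"
    then show "Ck_on k S (\<lambda>x. ?f' (g x) * frechet_derivative g (at x) b)"
      using Suc.prems
      by (intro Ck_on_mult[OF assms(1) Suc.IH]) (auto intro: Ck_on_SucD)
  qed
qed

text \<open>Since the linear part maps every basis vector to a multiple of itself, a basis
  derivative of the composite is a multiple of the same basis derivative of \<open>f\<close>.
  Parabolic dilations are of this kind, with factors \<open>s\<close> in space and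
  \<open>s\<^sup>2\<close> in time.\<close>

lemma Ck_on_compose_diagonal_affine:
  fixes f :: "'a::euclidean_space \<Rightarrow> 'b::real_normed_vector"
  assumes "open S" "open T" "Ck_on k T f" "h ` S \<subseteq> T"
    and L: "\<And>x. (h has_derivative L) (at x)" and c: "\<And>b. b \<in> Basis \<Longrightarrow> L b = c b *\<^sub>R b"
  shows "Ck_on k S (\<lambda>x. f (h x))"
  using assms(3)
proof (induction k arbitrary: f)
  case 0
  have "continuous_on S h"
    by (meson L continuous_at_imp_continuous_on has_derivative_continuous)
  then show ?case using assms(4) 0 by (auto intro: continuous_on_compose2)
next
  case (Suc k)
  show ?case
  proof (rule Ck_on_SucI[OF assms(1)])
    fix x assume x: "x \<in> S"
    then have fd: "(f has_derivative frechet_derivative f (at (h x))) (at (h x))"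
      using Ck_on_Suc_has_derivative[OF Suc.prems(1)] assms(4) by auto
    show "((\<lambda>x. f (h x)) has_derivative (\<lambda>v. frechet_derivative f (at (h x)) (L v))) (at x)"
      using has_derivative_compose[OF L fd] .
  next
    fix b :: 'a assume b: "b \<in> Basis"
    have "Ck_on k S (\<lambda>x. c b *\<^sub>R frechet_derivative f (at (h x)) b)"
      using Suc.prems b by (intro Ck_on_scaleR[OF assms(1) Ck_on_const[OF assms(1)] Suc.IH]) auto
    then show "Ck_on k S (\<lambda>x. frechet_derivative f (at (h x)) (L b))"
    proof (rule Ck_on_cong[OF assms(1), rotated])
      fix x assume "x \<in> S"
      then have "linear (frechet_derivative f (at (h x)))"
        using Ck_on_Suc_has_derivative[OF Suc.prems(1)] assms(4)
        by (auto intro: has_derivative_linear)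
      then show "c b *\<^sub>R frechet_derivative f (at (h x)) b = frechet_derivative f (at (h x)) (L b)"
        using c[OF b] by (simp add: linear_cmul)
    qed
  qed
qed

section \<open>Smooth cutoffs\<close>

text \<open>The family \<open>x\<^sup>-\<^sup>m exp (-1/x)\<close> is closed under differentiation up to linear combinations,
  which gives smoothness at the origin.\<close>

definition bump :: "nat \<Rightarrow> real \<Rightarrow> real" where
  "bump m x = (if 0 < x then (1/x) ^ m * exp (- (1/x)) else 0)"

lemma bump_nonneg: "0 \<le> bump m x"
  by (simp add: bump_def)

lemma bump_le_1: "bump 0 x \<le> 1"
  by (simp add: bump_def)

lemma bump_mono: "x \<le> y \<Longrightarrow> bump 0 x \<le> bump 0 y"
  by (auto simp: bump_def intro: divide_left_mono)

lemma bump_at_right_0: "(bump m \<longlongrightarrow> 0) (at_right 0)"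
proof -
  have "((\<lambda>x::real. inverse x ^ m / exp (inverse x)) \<longlongrightarrow> 0) (at_right 0)"
    by (rule filterlim_compose[OF tendsto_power_div_exp_0 filterlim_inverse_at_top_right])
  then show ?thesis
    by (rule Lim_transform_eventually)
       (auto simp: eventually_at_filter bump_def divide_simps exp_minus)
qed

lemma bump_deriv: "(bump m has_field_derivative bump (m+2) x - m * bump (m+1) x) (at x)"
proof -
  consider "x > 0" | "x < 0" | "x = 0" by linarith
  then show ?thesis
  proof cases
    case 1
    have "((\<lambda>x. (1/x) ^ m * exp (- (1/x))) has_field_derivative bump (m+2) x - m * bump (m+1) x) (at x)"
    proof -
      have inv: "((\<lambda>x. 1/x) has_field_derivative - ((1/x) ^ 2)) (at x)"
        using 1 by (auto intro!: derivative_eq_intros simp: power2_eq_square)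
      have "((\<lambda>x. (1/x) ^ m * exp (- (1/x))) has_field_derivative
          (real m * (1/x) ^ (m - 1) * (- ((1/x) ^ 2)) * exp (- (1/x))
            + (1/x) ^ m * (exp (- (1/x)) * (1/x) ^ 2))) (at x)"
        by (rule derivative_eq_intros inv refl)+ simp
      also have "real m * (1/x) ^ (m - 1) * (- ((1/x) ^ 2)) = - (real m * (1/x) ^ (m + 1))"
        by (cases m) (simp_all add: power2_eq_square)
      finally show ?thesis
        using 1 by (simp add: bump_def power2_eq_square algebra_simps)
    qed
    then show ?thesis
      by (rule has_field_derivative_transform_within_open[where S = "{0<..}"])
         (use 1 in \<open>auto simp: bump_def\<close>)
  next
    case 2
    have "((\<lambda>x. 0) has_field_derivative bump (m+2) x - m * bump (m+1) x) (at x)"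
      using 2 by (simp add: bump_def)
    then show ?thesis
      by (rule has_field_derivative_transform_within_open[where S = "{..<0}"])
         (use 2 in \<open>auto simp: bump_def\<close>)
  next
    \<comment> \<open>At the origin the difference quotient from the right is
      \<open>bump (Suc m)\<close>, which tends to 0; from the left it is 0.\<close>
    case 3
    have "((\<lambda>h. bump m h / h) \<longlongrightarrow> 0) (at_right 0)"
      by (rule Lim_transform_eventually[OF bump_at_right_0[of "Suc m"]])
         (auto simp: eventually_at_filter bump_def field_simps)
    moreover have "((\<lambda>h. bump m h / h) \<longlongrightarrow> 0) (at_left 0)"
      by (rule Lim_transform_eventually[OF tendsto_const])
         (auto simp: eventually_at_filter bump_def)
    ultimately have "((\<lambda>h. bump m h / h) \<longlongrightarrow> 0) (at 0)"
      by (simp add: filterlim_split_at)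
    then show ?thesis
      using 3 by (simp add: DERIV_def bump_def)
  qed
qed

lemma bump_continuous: "continuous_on S (bump m)"
  by (rule continuous_at_imp_continuous_on) (blast intro: DERIV_isCont[OF bump_deriv])

lemma Ck_on_bump: "Ck_on k UNIV (bump m)"
proof (induction k arbitrary: m)
  case (Suc k)
  show ?case
  proof (rule Ck_on_SucI)
    fix x :: real
    show "(bump m has_derivative (*) (bump (m+2) x - m * bump (m+1) x)) (at x)"
      using bump_deriv[of m x] by (simp add: has_field_derivative_def)
  next
    fix b :: real
    show "Ck_on k UNIV (\<lambda>x. (bump (m+2) x - m * bump (m+1) x) * b)"
      by (intro Ck_on_mult Ck_on_diff Ck_on_const Suc open_UNIV)
  qed simp
qed (simp add: bump_continuous)

text \<open>\<open>bump 0 (1 - x)\<close> is at least \<open>exp (-1)\<close> for \<open>x \<le> 0\<close> and vanishes for \<open>x \<ge> 1\<close>, so no quotient is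
  needed to get a step of height \<open>bump 0 (exp (-1))\<close>.\<close>

definition smooth_step :: "real \<Rightarrow> real" where
  "smooth_step x = bump 0 (exp (-1) - bump 0 (1 - x))"

text \<open>The chain rule with \<open>bump 2\<close> as the derivative of \<open>bump 0\<close>.
  The signs from the subtraction and from \<open>1 - x\<close> cancel, so the step is
  monotone.\<close>

definition smooth_step' :: "real \<Rightarrow> real" where
  "smooth_step' x = bump 2 (exp (-1) - bump 0 (1 - x)) * bump 2 (1 - x)"

lemma smooth_step_deriv: "(smooth_step has_field_derivative smooth_step' x) (at x)"
proof -
  have "((\<lambda>x. exp (-1) - bump 0 (1 - x)) has_field_derivative bump 2 (1 - x)) (at x)"
  proof -
    have "((\<lambda>x. 1 - x) has_field_derivative -1) (at x)"
      by (auto intro!: derivative_eq_intros)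
    then have "((\<lambda>x. bump 0 (1 - x)) has_field_derivative
        (bump (0+2) (1 - x) - real 0 * bump (0+1) (1 - x)) * -1) (at x)"
      by (rule DERIV_chain2[OF bump_deriv])
    from DERIV_diff[OF DERIV_const this] show ?thesis by (simp add: numeral_2_eq_2)
  qed
  from DERIV_chain2[OF bump_deriv[of 0 "exp (-1) - bump 0 (1 - x)"] this] show ?thesis
    unfolding smooth_step_def[abs_def] smooth_step'_def by (simp add: numeral_2_eq_2)
qed

lemma Ck_on_smooth_step: "Ck_on k UNIV smooth_step"
proof -
  have "Ck_on k UNIV (\<lambda>x::real. 1 - x)"
    by (intro Ck_on_diff Ck_on_const Ck_on_linear[OF _ bounded_linear_ident] open_UNIV)
  then have "Ck_on k UNIV (\<lambda>x. bump 0 (1 - x))"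
    by (intro Ck_on_compose_real[OF open_UNIV Ck_on_bump]) auto
  then have "Ck_on k UNIV (\<lambda>x. exp (-1) - bump 0 (1 - x))"
    by (intro Ck_on_diff Ck_on_const open_UNIV)
  then show ?thesis
    unfolding smooth_step_def[abs_def]
    by (intro Ck_on_compose_real[OF open_UNIV Ck_on_bump]) auto
qed

lemma smooth_step_nonneg: "0 \<le> smooth_step x"
  and smooth_step_le_1: "smooth_step x \<le> 1"
  by (simp_all add: smooth_step_def bump_nonneg bump_le_1)

lemma smooth_step_eq_0: "x \<le> 0 \<Longrightarrow> smooth_step x = 0"
  using bump_mono[of 1 "1 - x"] by (simp add: smooth_step_def bump_def)

lemma smooth_step_eq_const: "x \<ge> 1 \<Longrightarrow> smooth_step x = bump 0 (exp (-1))"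
  by (simp add: smooth_step_def bump_def)

lemma smooth_step'_eq_0: "x \<le> 0 \<or> x \<ge> 1 \<Longrightarrow> smooth_step' x = 0"
  using bump_mono[of 1 "1 - x"] by (auto simp: smooth_step'_def bump_def)

lemma smooth_step'_nonneg: "0 \<le> smooth_step' x"
  by (simp add: smooth_step'_def bump_nonneg)

lemma smooth_step'_bounded: obtains B where "B > 0" "\<And>x. smooth_step' x \<le> B"
proof -
  have "continuous_on {0..1} smooth_step'"
    unfolding smooth_step'_def[abs_def]
    by (intro continuous_intros continuous_on_compose2[OF bump_continuous[of UNIV]]) auto
  then have "bounded (smooth_step' ` {0..1})"
    by (intro compact_imp_bounded compact_continuous_image) auto
  then obtain B where "B > 0" "\<forall>y\<in>smooth_step' ` {0..1}. norm y \<le> B"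
    unfolding bounded_pos by blast
  then have B: "B > 0" "\<And>x. x \<in> {0..1} \<Longrightarrow> smooth_step' x \<le> B"
    by (auto simp: abs_le_iff)
  show ?thesis
  proof
    fix x show "smooth_step' x \<le> B"
      using B smooth_step'_eq_0[of x] by (cases "x \<in> {0..1}") auto
  qed (rule B)
qed

section \<open>Uniqueness of weak derivatives\<close>

text \<open>As \<open>r\<close> grows, this tends to the indicator of the open box while remaining a
  test function supported in the closed box. It passes from test integrals to integrals over boxes
  without mollification.\<close>

definition box_bump :: "'a::euclidean_space \<Rightarrow> 'a \<Rightarrow> real \<Rightarrow> 'a \<Rightarrow> real" where
  "box_bump a b r x = (\<Prod>i\<in>Basis. bump 0 (r * (x \<bullet> i - a \<bullet> i)) * bump 0 (r * (b \<bullet> i - x \<bullet> i)))"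

lemma Ck_on_box_bump: "Ck_on k UNIV (box_bump a b r)"
proof -
  have ip: "Ck_on k UNIV (\<lambda>x. x \<bullet> i)" for i :: 'a
    by (rule Ck_on_linear[OF open_UNIV bounded_linear_inner_left])
  have 1: "Ck_on k UNIV (\<lambda>x. r * (x \<bullet> i - a \<bullet> i))" "Ck_on k UNIV (\<lambda>x. r * (b \<bullet> i - x \<bullet> i))" for i
    by (intro Ck_on_mult[OF open_UNIV Ck_on_const] Ck_on_diff ip Ck_on_const open_UNIV)+
  show ?thesis
    unfolding box_bump_def[abs_def]
    by (intro Ck_on_prod Ck_on_mult Ck_on_compose_real[OF open_UNIV Ck_on_bump 1(1)]
        Ck_on_compose_real[OF open_UNIV Ck_on_bump 1(2)] open_UNIV subset_UNIV)
qed

lemma box_bump_bounds: "0 \<le> box_bump a b r x" "box_bump a b r x \<le> 1"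
  unfolding box_bump_def
  by (intro prod_nonneg prod_le_1 conjI mult_nonneg_nonneg mult_le_one bump_nonneg bump_le_1 ballI)+

lemma box_bump_eq_0:
  assumes "0 \<le> r" "x \<notin> box a b"
  shows "box_bump a b r x = 0"
proof -
  from assms obtain i where i: "i \<in> Basis" "x \<bullet> i \<le> a \<bullet> i \<or> b \<bullet> i \<le> x \<bullet> i"
    by (auto simp: mem_box not_less)
  then have "r * (x \<bullet> i - a \<bullet> i) \<le> 0 \<or> r * (b \<bullet> i - x \<bullet> i) \<le> 0"
    using assms(1) by (auto simp: mult_le_0_iff)
  then show ?thesis
    unfolding box_bump_def using i(1)
    by (intro prod_zero bexI[OF _ i(1)]) (auto simp: bump_def)
qed

lemma bump_tendsto_1:
  assumes "0 < c"
  shows "(\<lambda>j. bump 0 (real j * c)) \<longlonglongrightarrow> 1"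
proof -
  have "(\<lambda>j. exp (- ((1/c) * (1 / real j)))) \<longlonglongrightarrow> exp (- ((1/c) * 0))"
    by (intro tendsto_intros lim_1_over_n)
  then have "(\<lambda>j. exp (- ((1/c) * (1 / real j)))) \<longlonglongrightarrow> 1" by simp
  then show ?thesis
  proof (rule Lim_transform_eventually)
    show "\<forall>\<^sub>F j in sequentially. exp (- ((1/c) * (1 / real j))) = bump 0 (real j * c)"
      by (rule eventually_mono[OF eventually_gt_at_top[of 0]])
         (use assms in \<open>simp add: bump_def mult.commute\<close>)
  qed
qed

lemma box_bump_tendsto:
  assumes "x \<in> box a b"
  shows "(\<lambda>j. box_bump a b (real j) x) \<longlonglongrightarrow> 1"
proof -
  have "(\<lambda>j. box_bump a b (real j) x) \<longlonglongrightarrow> (\<Prod>i\<in>(Basis::'a set). 1 * 1)"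
    unfolding box_bump_def
    by (intro tendsto_prod tendsto_mult bump_tendsto_1) (use assms in \<open>auto simp: mem_box\<close>)
  then show ?thesis by simp
qed

lemma box_bump_test_function:
  assumes "0 \<le> r" "cbox a b \<subseteq> U"
  shows "box_bump a b r \<in> test_functions U"
proof -
  have "closure {x. box_bump a b r x \<noteq> 0} \<subseteq> cbox a b"
    by (rule closure_minimal) (use box_bump_eq_0[OF assms(1), of _ a b] box_subset_cbox[of a b] in auto)
  moreover from this have "compact (closure {x. box_bump a b r x \<noteq> 0})"
    by (meson bounded_cbox bounded_subset closed_closure compact_eq_bounded_closed)
  ultimately show ?thesis
    using assms(2) by (auto simp: test_functions_def smooth_on_def compact_support_in_def Ck_on_box_bump)
qed

text \<open>The sets on which \<open>h\<close> integrates to zero are closed under complements and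
  countable disjoint unions, and boxes are an intersection-stable generator of the Borel sets. A
  function whose integral over every measurable set is zero vanishes almost everywhere.\<close>

lemma AE_zero_if_box_integrals_zero:
  fixes h :: "'a::euclidean_space \<Rightarrow> 'b::euclidean_space"
  assumes int: "set_integrable lebesgue (box p q) h"
    and zero: "\<And>a b. box a b \<subseteq> box p q \<Longrightarrow> (LINT x:box a b|lebesgue. h x) = 0"
  shows "AE x in lebesgue. x \<in> box p q \<longrightarrow> h x = 0"
proof -
  have int': "set_integrable lebesgue (A \<inter> box p q) h" if "A \<in> sets lebesgue" for A
    by (rule set_integrable_subset[OF int]) (use that in auto)
  have borel: "(LINT x:A \<inter> box p q|lebesgue. h x) = 0" if A: "A \<in> sets borel" for A
  proof -
    have "Int_stable (range (\<lambda>(a, b). box a b :: 'a set))"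
      by (auto simp: Int_stable_def box_Int_box)
    moreover have "(range (\<lambda>(a, b). box a b)) \<subseteq> Pow (UNIV :: 'a set)"
      by auto
    moreover have "A \<in> sigma_sets UNIV (range (\<lambda>(a, b). box a b))"
      using A unfolding borel_eq_box by simp
    ultimately show ?thesis
    proof (induction rule: sigma_sets_induct_disjoint)
      case (basic A)
      then obtain a b where "A = box a b" by auto
      moreover obtain c d where "box a b \<inter> box p q = box c d"
        by (simp add: box_Int_box)
      ultimately show ?case
        using zero[of c d] by (metis inf_le2)
    next
      case (compl A)
      then have [measurable]: "A \<in> sets borel"
        by (simp add: borel_eq_box)
      have "(LINT x:box p q|lebesgue. h x)
          = (LINT x:(UNIV - A) \<inter> box p q|lebesgue. h x) + (LINT x:A \<inter> box p q|lebesgue. h x)"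
      proof (subst set_integral_Un[symmetric])
        have "box p q = (UNIV - A) \<inter> box p q \<union> A \<inter> box p q" by auto
        then show "(LINT x:box p q|lebesgue. h x) = (LINT x:(UNIV - A) \<inter> box p q \<union> A \<inter> box p q|lebesgue. h x)"
          by simp
      qed (auto intro!: int')
      then show ?case
        using compl.IH zero[of p q] by simp
    next
      case (union F)
      then have [measurable]: "\<And>i. F i \<in> sets borel"
        by (simp add: borel_eq_box subset_eq)
      have "(LINT x:(\<Union>i. F i \<inter> box p q)|lebesgue. h x) = (\<Sum>i. LINT x:F i \<inter> box p q|lebesgue. h x)"
      proof (rule lebesgue_integral_countable_add)
        show "set_integrable lebesgue (\<Union>i. F i \<inter> box p q) h"
          by (rule set_integrable_subset[OF int]) auto
      qed (use union in \<open>auto simp: disjoint_family_on_def\<close>)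
      also have "\<dots> = 0"
        using union.IH by simp
      finally show ?case by simp
    qed (simp add: set_lebesgue_integral_def)
  qed
  have "AE x in lebesgue. indicator (box p q) x *\<^sub>R h x = 0"
  proof (rule sigma_finite_measure.density_zero)
    show "sigma_finite_measure (lebesgue :: 'a measure)"
    proof
      obtain A :: "'a set set" where "countable A" "A \<subseteq> sets lborel" "\<Union>A = space lborel"
          "\<forall>a\<in>A. emeasure lborel a \<noteq> \<infinity>"
        using lborel.sigma_finite_countable by blast
      then show "\<exists>A::'a set set. countable A \<and> A \<subseteq> sets lebesgue \<and> \<Union>A = space lebesgue
          \<and> (\<forall>a\<in>A. emeasure lebesgue a \<noteq> \<infinity>)"
        by (intro exI[of _ A]) auto
    qed
    show "integrable lebesgue (\<lambda>x. indicator (box p q) x *\<^sub>R h x)"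
      using int by (simp add: set_integrable_def)
    fix A :: "'a set" assume "A \<in> sets lebesgue"
    \<comment> \<open>The generator argument reaches Borel sets only; a Lebesgue set differs from
      one of them by a null set.\<close>
    then obtain S N N' where A: "A = S \<union> N" "N \<subseteq> N'" "N' \<in> null_sets lborel" "S \<in> sets lborel"
      by (rule sets_completionE)
    have "AE x in lebesgue. x \<notin> N'"
      using A(3) by (intro AE_completion AE_not_in)
    then have "(LINT x|lebesgue. indicator A x *\<^sub>R indicator (box p q) x *\<^sub>R h x)
        = (LINT x|lebesgue. indicator (S \<inter> box p q) x *\<^sub>R h x)"
    proof (intro integral_cong_AE)
      show "(\<lambda>x. indicator A x *\<^sub>R indicat_real (box p q) x *\<^sub>R h x) \<in> borel_measurable lebesgue"
        by (rule borel_measurable_scaleR[OF borel_measurable_indicator])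
           (use int \<open>A \<in> sets lebesgue\<close> in
             \<open>auto simp only: set_integrable_def dest: borel_measurable_integrable\<close>)
      show "(\<lambda>x. indicat_real (S \<inter> box p q) x *\<^sub>R h x) \<in> borel_measurable lebesgue"
        using int'[of S] A(4) by (auto simp: set_integrable_def)
    qed (use A in \<open>auto elim!: eventually_mono split: split_indicator\<close>)
    then show "(LINT x:A|lebesgue. indicator (box p q) x *\<^sub>R h x) = 0"
      using borel[of S] A(4) by (simp add: set_lebesgue_integral_def)
  qed
  then show ?thesis
    by eventually_elim (auto split: split_indicator_asm)
qed

lemma locally_integrable_cbox:
  "locally_integrable U g \<Longrightarrow> cbox a b \<subseteq> U \<Longrightarrow> set_integrable lebesgue (cbox a b) g"
  by (simp add: locally_integrable_def)

text \<open>The integral of \<open>h\<close> over a box is the limit of its vanishing integrals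
  against \<open>box_bump\<close>, by dominated convergence. Countably many closed boxes cover
  \<open>U\<close>, so the exceptional null sets can be united.\<close>

lemma AE_zero_if_test_integrals_zero:
  fixes h :: "'a::euclidean_space \<Rightarrow> 'b::euclidean_space"
  assumes "open U" "locally_integrable U h"
    and zero: "\<And>\<phi>. \<phi> \<in> test_functions U \<Longrightarrow> (LINT x:U|lebesgue. \<phi> x *\<^sub>R h x) = 0"
  shows "AE x in lebesgue. x \<in> U \<longrightarrow> h x = 0"
proof -
  have cb: "AE x in lebesgue. x \<in> cbox p q \<longrightarrow> h x = 0" if pq: "cbox p q \<subseteq> U" for p q
  proof -
    have int: "set_integrable lebesgue (cbox p q) h"
      by (rule locally_integrable_cbox[OF assms(2) pq])
    have "AE x in lebesgue. x \<in> box p q \<longrightarrow> h x = 0"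
    proof (rule AE_zero_if_box_integrals_zero)
      show "set_integrable lebesgue (box p q) h"
        by (rule set_integrable_subset[OF int]) (auto simp: box_subset_cbox)
      fix a b assume sub: "box a b \<subseteq> box p q"
      show "(LINT x:box a b|lebesgue. h x) = 0"
      proof (cases "box a b = {}")
        case False
        then have cab: "cbox a b \<subseteq> cbox p q"
          by (metis sub closure_box closure_mono subset_empty)
        have inth: "integrable lebesgue (\<lambda>x. indicator (cbox p q) x *\<^sub>R h x)"
          using int by (simp add: set_integrable_def)
        have "(\<lambda>j. LINT x|lebesgue. indicator (box a b) x *\<^sub>R (box_bump a b (real j) x *\<^sub>R h x))
            \<longlonglongrightarrow> (LINT x|lebesgue. indicator (box a b) x *\<^sub>R h x)"
        proof (rule integral_dominated_convergence[where w = "\<lambda>x. norm (indicator (cbox p q) x *\<^sub>R h x)"])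
          have m: "(\<lambda>x. indicat_real (box a b) x *\<^sub>R h x) \<in> borel_measurable lebesgue"
            using set_integrable_subset[OF int, of "box a b"] cab box_subset_cbox[of a b]
            by (auto simp: set_integrable_def)
          then show "(\<lambda>x. indicat_real (box a b) x *\<^sub>R h x) \<in> borel_measurable lebesgue" .
          have "continuous_on UNIV (box_bump a b (real j))" for j
            using Ck_on_box_bump[of 0 a b "real j"] by simp
          then have "box_bump a b (real j) \<in> borel_measurable lebesgue" for j
            by (intro measurable_completion) (simp add: borel_measurable_continuous_onI)
          then have "(\<lambda>x. box_bump a b (real j) x *\<^sub>R (indicat_real (box a b) x *\<^sub>R h x))
              \<in> borel_measurable lebesgue" for j
            by (intro borel_measurable_scaleR m)
          then show "(\<lambda>x. indicat_real (box a b) x *\<^sub>R box_bump a b (real j) x *\<^sub>R h x)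
              \<in> borel_measurable lebesgue" for j
            by (simp add: mult.commute)
          show "integrable lebesgue (\<lambda>x. norm (indicator (cbox p q) x *\<^sub>R h x))"
            using inth by (rule integrable_norm)
          show "AE x in lebesgue. (\<lambda>j. indicat_real (box a b) x *\<^sub>R box_bump a b (real j) x *\<^sub>R h x)
              \<longlonglongrightarrow> indicat_real (box a b) x *\<^sub>R h x"
          proof (rule AE_I2)
            fix x
            show "(\<lambda>j. indicat_real (box a b) x *\<^sub>R box_bump a b (real j) x *\<^sub>R h x)
              \<longlonglongrightarrow> indicat_real (box a b) x *\<^sub>R h x"
            proof (cases "x \<in> box a b")
              case True
              then show ?thesis
                using tendsto_scaleR[OF box_bump_tendsto[OF True] tendsto_const[of "h x"]] by simp
            qed simp
          qed
          show "AE x in lebesgue. norm (indicat_real (box a b) x *\<^sub>R box_bump a b (real j) x *\<^sub>R h x)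
              \<le> norm (indicat_real (cbox p q) x *\<^sub>R h x)" for j
            using cab box_subset_cbox[of a b] box_bump_bounds[of a b j]
            by (intro AE_I2) (auto split: split_indicator intro!: mult_left_le_one_le)
        qed
        moreover have "(LINT x|lebesgue. indicator (box a b) x *\<^sub>R (box_bump a b (real j) x *\<^sub>R h x)) = 0" for j
        proof -
          have "(LINT x:U|lebesgue. box_bump a b (real j) x *\<^sub>R h x) = 0"
            using cab pq by (intro zero box_bump_test_function) auto
          moreover have "indicat_real (box a b) x *\<^sub>R box_bump a b (real j) x *\<^sub>R h x
              = indicator U x *\<^sub>R box_bump a b (real j) x *\<^sub>R h x" for x
            using cab pq box_subset_cbox[of a b] box_bump_eq_0[of "real j" x a b]
            by (auto split: split_indicator)
          ultimately show ?thesis by (simp only: set_lebesgue_integral_def)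
        qed
        ultimately show ?thesis
          by (simp add: set_lebesgue_integral_def LIMSEQ_const_iff)
      qed (simp add: set_lebesgue_integral_def)
    qed
    \<comment> \<open>The previous step covers open boxes, whereas the cover of \<open>U\<close>
      consists of closed ones; the boundary between them is negligible.\<close>
    moreover have "AE x in lebesgue. x \<notin> cbox p q - box p q"
      using negligible_frontier_interval[of p q] by (intro AE_not_in) (simp add: negligible_iff_null_sets)
    ultimately show ?thesis
      by eventually_elim auto
  qed
  obtain D where D: "countable D" "D \<subseteq> Pow U" "\<And>X. X \<in> D \<Longrightarrow> \<exists>a b. X = cbox a b" "\<Union>D = U"
    using open_countable_Union_open_cbox[OF assms(1)] by metis
  have "AE x in lebesgue. \<forall>X\<in>D. x \<in> X \<longrightarrow> h x = 0"
    unfolding AE_ball_countable[OF D(1)] using D cb by (metis PowD subsetD)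
  then show ?thesis
    by eventually_elim (use D(4) in auto)
qed

section \<open>Parabolic scaling\<close>

lemma par_map_inverse:
  assumes "s > 0"
  shows "par_map X s (par_map (- fst X /\<^sub>R s, - snd X / s\<^sup>2) (1/s) Y) = Y"
    and "par_map (- fst X /\<^sub>R s, - snd X / s\<^sup>2) (1/s) (par_map X s Y) = Y"
  using assms by (auto simp: par_map_def prod_eq_iff field_simps scaleR_right_distrib)

lemma par_map_has_derivative:
  "(par_map X s has_derivative (\<lambda>Y. (s *\<^sub>R fst Y, s\<^sup>2 * snd Y))) (at Y)"
  unfolding par_map_def[abs_def] by (auto intro!: derivative_eq_intros)

lemma continuous_on_par_map: "continuous_on S (par_map X s)"
  unfolding par_map_def by (intro continuous_intros)

lemma par_cyl_eq_vimage:
  assumes "s > 0"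
  shows "par_map X s -` par_cyl s X = par_cyl 1 0"
proof -
  have "par_map X s Y \<in> par_cyl s X \<longleftrightarrow> Y \<in> par_cyl 1 0" for Y
  proof -
    have "s * norm (fst Y) < s \<longleftrightarrow> norm (fst Y) < 1"
      using assms by simp
    moreover have "- (s\<^sup>2) < s\<^sup>2 * snd Y \<longleftrightarrow> - 1 < snd Y" "s\<^sup>2 * snd Y < s\<^sup>2 \<longleftrightarrow> snd Y < 1"
      using assms mult_less_cancel_left_pos[of "s\<^sup>2" "-1" "snd Y"] by auto
    ultimately show ?thesis
      using assms by (cases Y) (auto simp: par_map_def par_cyl_def dist_norm)
  qed
  then show ?thesis by (simp add: set_eq_iff del: split_paired_All)
qed

lemma par_map_inj: "s > 0 \<Longrightarrow> inj (par_map X s)"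
  by (rule inj_on_inverseI[where g = "par_map (- fst X /\<^sub>R s, - snd X / s\<^sup>2) (1/s)"])
     (rule par_map_inverse)

text \<open>The affine transformation law of Lebesgue measure is stated for maps that scale each
  basis vector. A basis vector of the product is spatial exactly if its second component is
  0.\<close>

lemma par_map_Basis_form:
  fixes X :: "(real^'n) \<times> real"
  shows "par_map X s = (\<lambda>Y. X + (\<Sum>j\<in>Basis. ((if snd j = 0 then s else s\<^sup>2) * (Y \<bullet> j)) *\<^sub>R j))"
proof
  fix Y
  show "par_map X s Y = X + (\<Sum>j\<in>Basis. ((if snd j = 0 then s else s\<^sup>2) * (Y \<bullet> j)) *\<^sub>R j)"
  proof (rule euclidean_eqI)
    fix b :: "(real^'n) \<times> real" assume b: "b \<in> Basis"
    then show "par_map X s Y \<bullet> b = (X + (\<Sum>j\<in>Basis. ((if snd j = 0 then s else s\<^sup>2) * (Y \<bullet> j)) *\<^sub>R j)) \<bullet> b"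
      unfolding inner_add_left inner_sum_left_Basis[OF b]
      by (auto simp: par_map_def Basis_prod_def inner_prod_def inner_add_left)
  qed
qed

lemma prod_par_scale:
  fixes s :: real
  shows "(\<Prod>j\<in>Basis. \<bar>if snd (j :: (real^'n) \<times> real) = 0 then s else s\<^sup>2\<bar>) = \<bar>s\<bar> ^ (CARD('n) + 2)"
proof -
  have "(\<Prod>j\<in>(Basis :: ((real^'n) \<times> real) set). \<bar>if snd j = 0 then s else s\<^sup>2\<bar>)
      = (\<Prod>u\<in>(Basis::(real^'n) set). \<bar>s\<bar>) * \<bar>s\<bar>\<^sup>2"
    unfolding Basis_prod_def
    by (subst prod.union_disjoint) (auto simp: prod.reindex inj_on_def image_iff)
  then show ?thesis by (simp add: power_add power2_eq_square abs_mult)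
qed

lemma par_map_measurable:
  fixes X :: "(real^'n) \<times> real"
  assumes "s > 0"
  shows "par_map X s \<in> lebesgue \<rightarrow>\<^sub>M lebesgue"
  unfolding par_map_Basis_form by (rule lebesgue_affine_measurable) (use assms in auto)

text \<open>The Jacobian collects \<open>s\<close> from each spatial direction and
  \<open>s\<^sup>2\<close> from time. As an identity of measures it transports both integrals and
  integrability.\<close>

lemma lebesgue_par_map:
  fixes X :: "(real^'n) \<times> real"
  assumes "s > 0"
  shows "lebesgue = density (distr lebesgue lebesgue (par_map X s)) (\<lambda>_. ennreal (s ^ (CARD('n) + 2)))"
  using lebesgue_affine_euclidean[of "\<lambda>j :: (real^'n) \<times> real. if snd j = 0 then s else s\<^sup>2" X] assms
  unfolding par_map_Basis_form prod_par_scale by auto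

lemma integral_par_map:
  fixes X :: "(real^'n) \<times> real" and g :: "(real^'n) \<times> real \<Rightarrow> 'b::euclidean_space"
  assumes s: "s > 0" and g: "g \<in> borel_measurable lebesgue"
  shows "integral\<^sup>L lebesgue g = s ^ (CARD('n) + 2) *\<^sub>R (LINT Y|lebesgue. g (par_map X s Y))"
proof -
  have "integral\<^sup>L lebesgue g
      = integral\<^sup>L (density (distr lebesgue lebesgue (par_map X s)) (\<lambda>_. ennreal (s ^ (CARD('n) + 2)))) g"
    using lebesgue_par_map[OF s, of X] by (rule arg_cong)
  also have "\<dots> = integral\<^sup>L (distr lebesgue lebesgue (par_map X s)) (\<lambda>x. s ^ (CARD('n) + 2) *\<^sub>R g x)"
    using s g by (intro integral_density) auto
  also have "\<dots> = s ^ (CARD('n) + 2) *\<^sub>R (LINT Y|lebesgue. g (par_map X s Y))"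
    using g by (simp add: integral_distr[OF par_map_measurable[OF s]])
  finally show ?thesis .
qed

lemma integrable_par_map_iff:
  fixes X :: "(real^'n) \<times> real" and g :: "(real^'n) \<times> real \<Rightarrow> 'b::euclidean_space"
  assumes s: "s > 0" and g: "g \<in> borel_measurable lebesgue"
  shows "integrable lebesgue (\<lambda>Y. g (par_map X s Y)) \<longleftrightarrow> integrable lebesgue g"
proof -
  have "integrable lebesgue g \<longleftrightarrow>
      integrable (density (distr lebesgue lebesgue (par_map X s)) (\<lambda>_. ennreal (s ^ (CARD('n) + 2)))) g"
    using lebesgue_par_map[OF s, of X] by (rule arg_cong)
  also have "\<dots> \<longleftrightarrow> integrable (distr lebesgue lebesgue (par_map X s)) (\<lambda>x. s ^ (CARD('n) + 2) *\<^sub>R g x)"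
    using s g by (intro integrable_density) auto
  also have "\<dots> \<longleftrightarrow> integrable lebesgue (\<lambda>Y. g (par_map X s Y))"
  proof -
    have "integrable lebesgue (\<lambda>Y. g (par_map X s Y))"
      if "integrable lebesgue (\<lambda>Y. c *\<^sub>R g (par_map X s Y))" "c \<noteq> 0" for c
      using integrable_scaleR_right[of "inverse c", OF that(1)] that(2) by simp
    from this[of "s ^ (CARD('n) + 2)"]
    have "integrable lebesgue (\<lambda>Y. g (par_map X s Y))"
      if "integrable lebesgue (\<lambda>Y. s ^ (CARD('n) + 2) *\<^sub>R g (par_map X s Y))"
      using that s by simp
    then show ?thesis
      using g by (subst integrable_distr_eq[OF par_map_measurable[OF s]]) auto
  qed
  finally show ?thesis by simp
qed

lemma locally_integrable_par_map:
  fixes X :: "(real^'n) \<times> real" and g :: "(real^'n) \<times> real \<Rightarrow> 'b::euclidean_space"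
  assumes s: "s > 0" and g: "locally_integrable U g"
  shows "locally_integrable (par_map X s -` U) (\<lambda>Y. g (par_map X s Y))"
  unfolding locally_integrable_def
proof (intro allI impI)
  fix K assume K: "compact K \<and> K \<subseteq> par_map X s -` U"
  have eq: "indicat_real K Y = indicat_real (par_map X s ` K) (par_map X s Y)" for Y
    using inj_image_mem_iff[OF par_map_inj[OF s, of X]]
    by (simp add: indicator_def)
  have "set_integrable lebesgue (par_map X s ` K) g"
    using g K compact_continuous_image[OF continuous_on_par_map, of K X s]
    by (simp add: locally_integrable_def image_subset_iff_subset_vimage)
  then show "set_integrable lebesgue K (\<lambda>Y. g (par_map X s Y))"
    unfolding set_integrable_def eq
    by (subst integrable_par_map_iff[OF s, where g = "\<lambda>Z. indicat_real (par_map X s ` K) Z *\<^sub>R g Z"]) auto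
qed

lemma test_functions_par_map:
  fixes \<phi> :: "(real^'n) \<times> real \<Rightarrow> real"
  assumes s: "s > 0" and \<phi>: "\<phi> \<in> test_functions (par_map X s -` U)"
  shows "(\<lambda>Z. \<phi> (par_map (- fst X /\<^sub>R s, - snd X / s\<^sup>2) (1/s) Z)) \<in> test_functions U"
proof -
  let ?q = "par_map (- fst X /\<^sub>R s, - snd X / s\<^sup>2) (1/s)"
  let ?K = "closure {Y. \<phi> Y \<noteq> 0}"
  have K: "compact ?K" "?K \<subseteq> par_map X s -` U"
    using \<phi> by (auto simp: test_functions_def compact_support_in_def)
  have cK: "compact (par_map X s ` ?K)"
    by (rule compact_continuous_image[OF continuous_on_par_map K(1)])
  have sub: "closure {Z. \<phi> (?q Z) \<noteq> 0} \<subseteq> par_map X s ` ?K"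
  proof (rule closure_minimal)
    show "{Z. \<phi> (?q Z) \<noteq> 0} \<subseteq> par_map X s ` ?K"
    proof
      fix Z assume "Z \<in> {Z. \<phi> (?q Z) \<noteq> 0}"
      then have "?q Z \<in> ?K" using closure_subset[of "{Y. \<phi> Y \<noteq> 0}"] by auto
      then have "par_map X s (?q Z) \<in> par_map X s ` ?K" by (rule imageI)
      then show "Z \<in> par_map X s ` ?K" by (simp only: par_map_inverse(1)[OF s])
    qed
  qed (rule compact_imp_closed[OF cK])
  then have "compact_support_in U (\<lambda>Z. \<phi> (?q Z))"
    using K cK unfolding compact_support_in_def
    by (metis (no_types, lifting) closed_closure compact_Int_closed image_subset_iff_subset_vimage
        inf.absorb_iff2 order_trans)
  moreover have "Ck_on k UNIV (\<lambda>Z. \<phi> (?q Z))" for k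
  proof (rule Ck_on_compose_diagonal_affine[OF open_UNIV open_UNIV])
    show "Ck_on k UNIV \<phi>" using \<phi> by (simp add: test_functions_def smooth_on_def)
    show "((1/s) *\<^sub>R fst b, (1/s)\<^sup>2 * snd b) = (if snd b = 0 then 1/s else (1/s)\<^sup>2) *\<^sub>R b"
      if "b \<in> Basis" for b :: "(real^'n) \<times> real"
      using that by (auto simp: Basis_prod_def)
  qed (auto intro: par_map_has_derivative)
  ultimately show ?thesis
    by (simp add: test_functions_def smooth_on_def)
qed

section \<open>Weak derivatives under parabolic dilations\<close>

lemma locally_integrable_measurable:
  fixes g :: "'a::euclidean_space \<Rightarrow> 'b::euclidean_space"
  assumes "open U" "locally_integrable U g"
  shows "set_borel_measurable lebesgue U g"
proof -
  obtain D where D: "countable D" "D \<subseteq> Pow U" "\<And>X. X \<in> D \<Longrightarrow> \<exists>a b. X = cbox a b" "\<Union>D = U"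
    using open_countable_Union_open_cbox[OF assms(1)] by metis
  show ?thesis
    unfolding set_borel_measurable_def
  \<comment> \<open>Local integrability gives measurability on each closed box of a countable cover
    of \<open>U\<close>; the complement of \<open>U\<close>, where the indicator makes the function
    zero, completes this to a cover of the whole space.\<close>
  proof (rule measurable_piecewise_restrict[where C = "insert (- U) D"])
    fix \<Omega> assume O: "\<Omega> \<in> insert (- U) D"
    then show O': "\<Omega> \<inter> space lebesgue \<in> sets lebesgue"
      using D(3) assms(1) by fastforce
    have "(\<lambda>x. indicat_real \<Omega> x *\<^sub>R indicat_real U x *\<^sub>R g x) \<in> borel_measurable lebesgue"
    proof (cases "\<Omega> = - U")
      case True
      then have "(\<lambda>x. indicat_real \<Omega> x *\<^sub>R indicat_real U x *\<^sub>R g x) = (\<lambda>x. 0)"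
        by (auto split: split_indicator)
      then show ?thesis by simp
    next
      case False
      then have OD: "\<Omega> \<in> D" "\<Omega> \<subseteq> U" using O D(2) by auto
      then obtain a b where "\<Omega> = cbox a b" using D(3) by blast
      then have "set_integrable lebesgue \<Omega> g"
        using locally_integrable_cbox[OF assms(2)] OD by auto
      moreover have "indicat_real \<Omega> x *\<^sub>R indicat_real U x *\<^sub>R g x = indicat_real \<Omega> x *\<^sub>R g x" for x
        using OD(2) by (auto split: split_indicator)
      ultimately show ?thesis
        by (simp only: set_integrable_def borel_measurable_integrable)
    qed
    then show "(\<lambda>x. indicat_real U x *\<^sub>R g x) \<in> borel_measurable (restrict_space lebesgue \<Omega>)"
      using O' by (subst borel_measurable_restrict_space_iff) auto
  qed (use D in auto)
qed

lemma set_integrable_test_mult: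
  fixes g :: "'a::euclidean_space \<Rightarrow> 'b::euclidean_space" and \<phi> :: "'a \<Rightarrow> real"
  assumes "continuous_on UNIV \<phi>" "compact K" "K \<subseteq> U" "\<And>x. x \<notin> K \<Longrightarrow> \<phi> x = 0" "locally_integrable U g"
  shows "set_integrable lebesgue U (\<lambda>x. \<phi> x *\<^sub>R g x)"
proof -
  have int: "integrable lebesgue (\<lambda>x. indicat_real K x *\<^sub>R g x)"
    using assms by (auto simp: locally_integrable_def set_integrable_def)
  have "bounded (\<phi> ` K)"
    using assms by (intro compact_imp_bounded compact_continuous_image) (auto intro: continuous_on_subset)
  then obtain B where B: "\<And>x. x \<in> K \<Longrightarrow> \<bar>\<phi> x\<bar> \<le> B"
    by (auto simp: bounded_iff)
  have "integrable lebesgue (\<lambda>x. \<phi> x *\<^sub>R (indicat_real K x *\<^sub>R g x))"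
  proof (rule Bochner_Integration.integrable_bound)
    show "integrable lebesgue (\<lambda>x. B *\<^sub>R (indicat_real K x *\<^sub>R g x))"
      by (rule integrable_scaleR_right) (use int in simp)
    have "\<phi> \<in> borel_measurable lebesgue"
      using assms(1) by (intro measurable_completion) (simp add: borel_measurable_continuous_onI)
    then show "(\<lambda>x. \<phi> x *\<^sub>R (indicat_real K x *\<^sub>R g x)) \<in> borel_measurable lebesgue"
      by (rule borel_measurable_scaleR) (use int in auto)
    show "AE x in lebesgue. norm (\<phi> x *\<^sub>R indicat_real K x *\<^sub>R g x) \<le> norm (B *\<^sub>R indicat_real K x *\<^sub>R g x)"
      using B by (intro AE_I2) (force split: split_indicator intro!: mult_right_mono)
  qed
  moreover have "\<phi> x *\<^sub>R (indicat_real K x *\<^sub>R g x) = indicat_real U x *\<^sub>R (\<phi> x *\<^sub>R g x)" for x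
    using assms(3,4) by (auto split: split_indicator)
  ultimately show ?thesis
    by (simp only: set_integrable_def)
qed

lemma test_functionsD:
  assumes "\<phi> \<in> test_functions U"
  shows "Ck_on k UNIV \<phi>" "continuous_on UNIV \<phi>" "compact (closure {x. \<phi> x \<noteq> 0})"
    "closure {x. \<phi> x \<noteq> 0} \<subseteq> U" "x \<notin> closure {x. \<phi> x \<noteq> 0} \<Longrightarrow> \<phi> x = 0"
proof -
  have sm: "Ck_on k UNIV \<phi>" for k using assms by (simp add: test_functions_def smooth_on_def)
  then show "Ck_on k UNIV \<phi>" .
  from sm[of 0] show "continuous_on UNIV \<phi>" by simp
  show "compact (closure {x. \<phi> x \<noteq> 0})" "closure {x. \<phi> x \<noteq> 0} \<subseteq> U"
    using assms by (auto simp: test_functions_def compact_support_in_def)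
  show "x \<notin> closure {x. \<phi> x \<noteq> 0} \<Longrightarrow> \<phi> x = 0"
    using closure_subset[of "{x. \<phi> x \<noteq> 0}"] by auto
qed

text \<open>Needed because \<open>weak_deriv\<close> selects some weak derivative: the one selected
  on a dilated domain can be identified with the dilated derivative only up to a null set.\<close>

lemma has_weak_deriv_unique:
  fixes u :: "'a::euclidean_space \<Rightarrow> 'b::euclidean_space"
  assumes "open U" and g: "has_weak_deriv U u b g" and g': "has_weak_deriv U u b g'"
  shows "AE x in lebesgue. x \<in> U \<longrightarrow> g x = g' x"
proof -
  have loc: "locally_integrable U g" "locally_integrable U g'"
    using g g' by (auto simp: has_weak_deriv_def)
  have "AE x in lebesgue. x \<in> U \<longrightarrow> g x - g' x = 0"
  proof (rule AE_zero_if_test_integrals_zero[OF assms(1)])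
    show "locally_integrable U (\<lambda>x. g x - g' x)"
      using loc by (auto simp: locally_integrable_def intro: set_integral_diff)
    fix \<phi> :: "'a \<Rightarrow> real" assume \<phi>: "\<phi> \<in> test_functions U"
    have i: "set_integrable lebesgue U (\<lambda>x. \<phi> x *\<^sub>R g x)" "set_integrable lebesgue U (\<lambda>x. \<phi> x *\<^sub>R g' x)"
      by (rule set_integrable_test_mult[OF test_functionsD(2,3,4,5)[OF \<phi>]]; use loc in simp)+
    have "(LINT x:U|lebesgue. \<phi> x *\<^sub>R g x) = (LINT x:U|lebesgue. \<phi> x *\<^sub>R g' x)"
      using g g' \<phi> by (simp add: has_weak_deriv_def)
    then show "(LINT x:U|lebesgue. \<phi> x *\<^sub>R (g x - g' x)) = 0"
      using set_integral_diff(2)[OF i] by (simp add: scaleR_diff_right)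
  qed
  then show ?thesis by simp
qed

lemma frechet_derivative_eq_0_outside_support:
  assumes "x \<notin> closure {x. \<phi> x \<noteq> 0}"
  shows "frechet_derivative \<phi> (at x) b = 0"
proof -
  have "(\<phi> has_derivative (\<lambda>h. 0)) (at x)"
  proof (rule has_derivative_transform_within_open[OF has_derivative_const])
    show "open (- closure {x. \<phi> x \<noteq> 0})" by (intro open_Compl closed_closure)
    show "0 = \<phi> y" if "y \<in> - closure {x. \<phi> x \<noteq> 0}" for y
      using that closure_subset[of "{x. \<phi> x \<noteq> 0}"] by auto
  qed (use assms in simp)
  then show ?thesis
    using frechet_derivative_at by metis
qed

text \<open>The assumption on \<open>c\<close> makes \<open>b\<close> an eigenvector of the
  dilation, with eigenvalue \<open>s\<close> or \<open>s\<^sup>2\<close>. The test function is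
  carried to \<open>U\<close> by the inverse dilation; the Jacobian then appears on both sides and
  cancels.\<close>

lemma has_weak_deriv_par_map:
  fixes X b :: "(real^'n) \<times> real" and u :: "(real^'n) \<times> real \<Rightarrow> 'b::euclidean_space"
  assumes s: "s > 0" and b: "b \<in> Basis" and c: "(s *\<^sub>R fst b, s\<^sup>2 * snd b) = c *\<^sub>R b"
    and g: "has_weak_deriv U u b g"
  shows "has_weak_deriv (par_map X s -` U) (\<lambda>Y. u (par_map X s Y)) b (\<lambda>Y. c *\<^sub>R g (par_map X s Y))"
  unfolding has_weak_deriv_def
proof (intro conjI allI impI)
  have loc: "locally_integrable U u" "locally_integrable U g"
    using g by (auto simp: has_weak_deriv_def)
  show "locally_integrable (par_map X s -` U) (\<lambda>Y. u (par_map X s Y))"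
    by (rule locally_integrable_par_map[OF s loc(1)])
  have "locally_integrable U (\<lambda>Z. c *\<^sub>R g Z)"
    using loc(2) by (auto simp: locally_integrable_def)
  then show "locally_integrable (par_map X s -` U) (\<lambda>Y. c *\<^sub>R g (par_map X s Y))"
    by (rule locally_integrable_par_map[OF s])
  fix \<phi> :: "(real^'n) \<times> real \<Rightarrow> real" assume \<phi>: "\<phi> \<in> test_functions (par_map X s -` U)"
  define \<phi>' where "\<phi>' = (\<lambda>Z. \<phi> (par_map (- fst X /\<^sub>R s, - snd X / s\<^sup>2) (1/s) Z))"
  have \<phi>': "\<phi>' \<in> test_functions U"
    unfolding \<phi>'_def by (rule test_functions_par_map[OF s \<phi>])
  have eq: "\<phi> Y = \<phi>' (par_map X s Y)" for Y
    by (simp only: \<phi>'_def par_map_inverse(2)[OF s])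
  note T = test_functionsD(2,3,4,5)[OF \<phi>']
  have sub: "(LINT Z:U|lebesgue. \<psi> Z *\<^sub>R v Z)
      = s ^ (CARD('n) + 2) *\<^sub>R (LINT Y:par_map X s -` U|lebesgue. \<psi> (par_map X s Y) *\<^sub>R v (par_map X s Y))"
    if "set_integrable lebesgue U (\<lambda>Z. \<psi> Z *\<^sub>R v Z)"
    for \<psi> :: "(real^'n) \<times> real \<Rightarrow> real" and v :: "(real^'n) \<times> real \<Rightarrow> 'b"
    using integral_par_map[OF s borel_measurable_integrable[OF that[unfolded set_integrable_def]], of X]
    unfolding set_lebesgue_integral_def by (simp add: indicator_def vimage_def)
  have D: "(\<phi>' has_derivative frechet_derivative \<phi>' (at Z)) (at Z)" for Z
    by (rule Ck_on_Suc_has_derivative[OF test_functionsD(1)[OF \<phi>', of "Suc 0"] UNIV_I])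
  have fd: "frechet_derivative \<phi> (at Y) b = c * frechet_derivative \<phi>' (at (par_map X s Y)) b" for Y
  proof -
    have "((\<lambda>Y. \<phi>' (par_map X s Y)) has_derivative
        (\<lambda>h. frechet_derivative \<phi>' (at (par_map X s Y)) (s *\<^sub>R fst h, s\<^sup>2 * snd h))) (at Y)"
      by (rule has_derivative_compose[OF par_map_has_derivative D])
    moreover have "(\<lambda>Y. \<phi>' (par_map X s Y)) = \<phi>"
      by (rule ext) (rule eq[symmetric])
    ultimately have "(\<phi> has_derivative
        (\<lambda>h. frechet_derivative \<phi>' (at (par_map X s Y)) (s *\<^sub>R fst h, s\<^sup>2 * snd h))) (at Y)"
      by simp
    from fun_cong[OF frechet_derivative_at[OF this], of b, symmetric]
    have "frechet_derivative \<phi> (at Y) b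
        = frechet_derivative \<phi>' (at (par_map X s Y)) (s *\<^sub>R fst b, s\<^sup>2 * snd b)" .
    then show ?thesis
      unfolding c using linear_cmul[OF has_derivative_linear[OF D]] by simp
  qed
  have "continuous_on UNIV (\<lambda>Z. frechet_derivative \<phi>' (at Z) b)"
    using test_functionsD(1)[OF \<phi>', of "Suc 0"] b by simp
  from set_integrable_test_mult[OF this T(2,3) frechet_derivative_eq_0_outside_support loc(1)]
  have i1: "set_integrable lebesgue U (\<lambda>Z. frechet_derivative \<phi>' (at Z) b *\<^sub>R u Z)" .
  from set_integrable_test_mult[OF T loc(2)]
  have i2: "set_integrable lebesgue U (\<lambda>Z. \<phi>' Z *\<^sub>R g Z)" .
  have "(LINT Z:U|lebesgue. frechet_derivative \<phi>' (at Z) b *\<^sub>R u Z) = - (LINT Z:U|lebesgue. \<phi>' Z *\<^sub>R g Z)"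
    using g \<phi>' by (simp add: has_weak_deriv_def)
  then have main: "(LINT Y:par_map X s -` U|lebesgue. frechet_derivative \<phi>' (at (par_map X s Y)) b *\<^sub>R u (par_map X s Y))
      = - (LINT Y:par_map X s -` U|lebesgue. \<phi>' (par_map X s Y) *\<^sub>R g (par_map X s Y))" (is "?l = - ?r")
    unfolding sub[OF i1] sub[OF i2] using s
    by (simp flip: scaleR_minus_right del: power_add_numeral2)
  have "(LINT Y:par_map X s -` U|lebesgue. frechet_derivative \<phi> (at Y) b *\<^sub>R u (par_map X s Y)) = c *\<^sub>R ?l"
    unfolding fd by (simp flip: scaleR_scaleR)
  moreover have "(LINT Y:par_map X s -` U|lebesgue. \<phi> Y *\<^sub>R c *\<^sub>R g (par_map X s Y)) = c *\<^sub>R ?r"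
    unfolding eq by (simp only: scaleR_left_commute[of _ c] set_integral_scaleR_right)
  ultimately show "(LINT Y:par_map X s -` U|lebesgue. frechet_derivative \<phi> (at Y) b *\<^sub>R u (par_map X s Y))
      = - (LINT Y:par_map X s -` U|lebesgue. \<phi> Y *\<^sub>R c *\<^sub>R g (par_map X s Y))"
    using main by simp
qed

section \<open>The energy measure of a rescaled map\<close>

lemma dir_x_Basis: "dir_x i \<in> Basis" and dir_t_Basis: "dir_t \<in> Basis"
  by (auto simp: dir_x_def dir_t_def Basis_prod_def)

lemma open_par_cyl: "open (par_cyl r X)"
  by (simp add: par_cyl_def open_Times)

definition finite_energy :: "((real^'n) \<times> real) set \<Rightarrow> ((real^'n) \<times> real \<Rightarrow> real^'d) \<Rightarrow> bool" where
  "finite_energy U u \<longleftrightarrow>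
     (\<forall>i. has_weak_deriv U u (dir_x i) (weak_dx U u i) \<and> square_integrable U (weak_dx U u i))"

lemma grad_sq_nonneg: "0 \<le> grad_sq U u X"
  by (simp add: grad_sq_def sum_nonneg)

lemma grad_sq_integrable:
  assumes "finite_energy U u"
  shows "set_integrable lebesgue U (grad_sq U u)"
proof -
  have "integrable lebesgue (\<lambda>X. \<Sum>i\<in>UNIV. indicat_real U X *\<^sub>R (norm (weak_dx U u i X))\<^sup>2)"
    using assms by (intro Bochner_Integration.integrable_sum) (auto simp: finite_energy_def square_integrable_def set_integrable_def)
  then show ?thesis
    by (simp add: set_integrable_def grad_sq_def[abs_def] sum_distrib_left)
qed

text \<open>The second claim concerns the representative selected on the dilated domain, because the
  density of \<open>energy_measure\<close> is built from that one.\<close>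

lemma grad_sq_par_map:
  fixes X :: "(real^'n) \<times> real"
  assumes s: "s > 0" and U: "open U" and u: "finite_energy U u"
  defines "W \<equiv> par_map X s -` U"
  shows "AE Y in lebesgue. Y \<in> W \<longrightarrow> grad_sq W (T_map X s u) Y = s\<^sup>2 * grad_sq U u (par_map X s Y)"
    and "(\<lambda>Y. indicat_real W Y * grad_sq W (T_map X s u) Y) \<in> borel_measurable lebesgue"
proof -
  have W: "open W"
    unfolding W_def by (rule open_vimage[OF U continuous_on_par_map])
  have w: "has_weak_deriv W (T_map X s u) (dir_x i) (\<lambda>Y. s *\<^sub>R weak_dx U u i (par_map X s Y))" for i
    unfolding W_def T_map_def
    by (rule has_weak_deriv_par_map[OF s dir_x_Basis])
       (use u in \<open>auto simp: dir_x_def finite_energy_def\<close>)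
  \<comment> \<open>The selection is meaningful once some weak derivative exists, and
    \<open>w\<close> provides one.\<close>
  have w': "has_weak_deriv W (T_map X s u) (dir_x i) (weak_dx W (T_map X s u) i)" for i
    using someI[of "has_weak_deriv W (T_map X s u) (dir_x i)", OF w] by (simp only: weak_dx_def weak_deriv_def)
  have "AE Y in lebesgue. Y \<in> W \<longrightarrow> weak_dx W (T_map X s u) i Y = s *\<^sub>R weak_dx U u i (par_map X s Y)" for i
    by (rule has_weak_deriv_unique[OF W w' w])
  then have "AE Y in lebesgue. \<forall>i. Y \<in> W \<longrightarrow> weak_dx W (T_map X s u) i Y = s *\<^sub>R weak_dx U u i (par_map X s Y)"
    by (subst AE_all_countable) auto
  then show "AE Y in lebesgue. Y \<in> W \<longrightarrow> grad_sq W (T_map X s u) Y = s\<^sup>2 * grad_sq U u (par_map X s Y)"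
    by eventually_elim (auto simp: grad_sq_def sum_distrib_left power_mult_distrib)
  have "(\<lambda>Y. \<Sum>i\<in>UNIV. (norm (indicat_real W Y *\<^sub>R weak_dx W (T_map X s u) i Y))\<^sup>2) \<in> borel_measurable lebesgue"
  proof (rule borel_measurable_sum)
    fix i
    have "(\<lambda>Y. indicat_real W Y *\<^sub>R weak_dx W (T_map X s u) i Y) \<in> borel_measurable lebesgue"
      using locally_integrable_measurable[OF W, of "weak_dx W (T_map X s u) i"] w'[of i]
      by (simp add: has_weak_deriv_def set_borel_measurable_def)
    then show "(\<lambda>Y. (norm (indicat_real W Y *\<^sub>R weak_dx W (T_map X s u) i Y))\<^sup>2) \<in> borel_measurable lebesgue"
      by (intro borel_measurable_power measurable_compose[OF _ borel_measurable_norm])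
  qed
  also have "(\<lambda>Y. \<Sum>i\<in>UNIV. (norm (indicat_real W Y *\<^sub>R weak_dx W (T_map X s u) i Y))\<^sup>2)
      = (\<lambda>Y. indicat_real W Y * grad_sq W (T_map X s u) Y)"
    by (auto simp: grad_sq_def sum_distrib_left split: split_indicator)
  finally show "(\<lambda>Y. indicat_real W Y * grad_sq W (T_map X s u) Y) \<in> borel_measurable lebesgue" .
qed

text \<open>The squared gradient contributes \<open>s\<^sup>2\<close> and the change of variables
  divides by \<open>s ^ (n + 2)\<close>, which leaves the normalisation \<open>s ^ n\<close> of the
  rescaled measure. The third bound is generous: it discards the factor 1/2 of the energy
  density.\<close>

lemma energy_measure_integral:
  fixes X :: "(real^'n) \<times> real" and h :: "(real^'n) \<times> real \<Rightarrow> real"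
  assumes s: "s > 0" and U: "open U" and u: "finite_energy U u" and sub: "par_cyl s X \<subseteq> U"
    and h: "h \<in> borel_measurable borel" and B: "\<And>Y. \<bar>h Y\<bar> \<le> B"
  defines "\<nu> \<equiv> energy_measure (par_map X s -` U) (T_map X s u)"
  shows "set_integrable \<nu> (par_cyl 1 0) h"
    and "(LINT Y:par_cyl 1 0|\<nu>. h Y) = (1 / s ^ CARD('n)) *
      (LINT Z:par_cyl s X|lebesgue. 1/2 * (h (par_map (- fst X /\<^sub>R s, - snd X / s\<^sup>2) (1/s) Z) * grad_sq U u Z))"
    and "\<bar>LINT Y:par_cyl 1 0|\<nu>. h Y\<bar>
      \<le> B * ((1 / s ^ CARD('n)) * (LINT Z:par_cyl s X|lebesgue. grad_sq U u Z))"
proof -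
  define W where "W = par_map X s -` U"
  define q where "q = par_map (- fst X /\<^sub>R s, - snd X / s\<^sup>2) (1/s)"
  define D where "D = (\<lambda>Y. indicat_real W Y * (1/2 * grad_sq W (T_map X s u) Y))"
  define G where "G = (\<lambda>Z. indicat_real (par_cyl s X) Z *\<^sub>R (1/2 * (h (q Z) * grad_sq U u Z)))"
  have D: "D \<in> borel_measurable lebesgue"
    using borel_measurable_times[OF borel_measurable_const[of "1/2"] grad_sq_par_map(2)[OF s U u, of X]]
    by (simp add: D_def W_def mult.left_commute)
  have Dnn: "0 \<le> D Y" for Y
    by (simp add: D_def grad_sq_nonneg)
  have \<nu>: "\<nu> = density lebesgue (\<lambda>Y. ennreal (D Y))"
    by (simp add: \<nu>_def energy_measure_def D_def W_def)
  have eP: "set_integrable lebesgue (par_cyl s X) (grad_sq U u)"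
    by (rule set_integrable_subset[OF grad_sq_integrable[OF u] _ sub]) (simp add: open_par_cyl)
  then have eP': "integrable lebesgue (\<lambda>Z. indicat_real (par_cyl s X) Z * grad_sq U u Z)"
    by (simp add: set_integrable_def)
  have hm: "h \<in> borel_measurable lebesgue"
    using h by (intro measurable_completion) simp
  have hq: "(\<lambda>Z. h (q Z)) \<in> borel_measurable lebesgue"
    unfolding q_def
    by (rule measurable_compose[OF par_map_measurable hm]) (use s in simp)
  have Gm: "G \<in> borel_measurable lebesgue"
  proof -
    have "(\<lambda>Z. 1/2 * (h (q Z) * (indicat_real (par_cyl s X) Z * grad_sq U u Z))) \<in> borel_measurable lebesgue"
      by (rule borel_measurable_times[OF borel_measurable_const
            borel_measurable_times[OF hq borel_measurable_integrable[OF eP']]])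
    then show ?thesis by (simp add: G_def mult_ac)
  qed
  have B0: "0 \<le> B" using B[of 0] by simp
  have Gb: "\<bar>G Z\<bar> \<le> B * (indicat_real (par_cyl s X) Z * grad_sq U u Z)" for Z
  proof -
    have "\<bar>1/2 * (h (q Z) * grad_sq U u Z)\<bar> \<le> 1 * (B * grad_sq U u Z)"
      unfolding abs_mult by (intro mult_mono) (use B B0 in \<open>auto simp: grad_sq_nonneg\<close>)
    then show ?thesis
      by (auto simp: G_def split: split_indicator)
  qed
  have Gi: "integrable lebesgue G"
    by (rule Bochner_Integration.integrable_bound[OF integrable_mult_right[OF eP', of B] Gm])
       (use Gb B0 in \<open>auto simp: grad_sq_nonneg abs_mult\<close>)
  have Phm: "(\<lambda>Y. indicat_real (par_cyl 1 0) Y *\<^sub>R h Y) \<in> borel_measurable lebesgue"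
    by (intro borel_measurable_scaleR borel_measurable_indicator hm) (simp add: open_par_cyl)
  have PW: "par_cyl 1 0 \<subseteq> W"
    using sub par_cyl_eq_vimage[OF s, of X] by (auto simp: W_def)
  have AE: "AE Y in lebesgue. D Y *\<^sub>R (indicat_real (par_cyl 1 0) Y *\<^sub>R h Y) = s\<^sup>2 * G (par_map X s Y)"
    using grad_sq_par_map(1)[OF s U u, of X]
  proof eventually_elim
    case (elim Y)
    have "indicat_real (par_cyl 1 0) Y = indicat_real (par_cyl s X) (par_map X s Y)"
      using par_cyl_eq_vimage[OF s, of X] by (auto simp: indicator_def)
    moreover have "q (par_map X s Y) = Y"
      by (simp only: q_def par_map_inverse(2)[OF s])
    ultimately show ?case
      using elim subsetD[OF PW, of Y] by (auto simp: D_def G_def W_def indicator_def)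
  qed
  have GY: "integrable lebesgue (\<lambda>Y. s\<^sup>2 * G (par_map X s Y))"
    by (rule integrable_mult_right) (use Gi integrable_par_map_iff[OF s Gm, of X] in simp)
  have "integrable lebesgue (\<lambda>Y. D Y *\<^sub>R (indicat_real (par_cyl 1 0) Y *\<^sub>R h Y))"
    using GY by (rule integrable_cong_AE_imp) (use AE D Phm in \<open>auto elim: eventually_mono\<close>)
  then show "set_integrable \<nu> (par_cyl 1 0) h"
    unfolding set_integrable_def \<nu> by (subst integrable_density[OF Phm D]) (auto simp: Dnn)
  have "(LINT Y:par_cyl 1 0|\<nu>. h Y) = (LINT Y|lebesgue. D Y *\<^sub>R (indicat_real (par_cyl 1 0) Y *\<^sub>R h Y))"
    unfolding set_lebesgue_integral_def \<nu> by (subst integral_density[OF Phm D]) (auto simp: Dnn)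
  also have "\<dots> = (LINT Y|lebesgue. s\<^sup>2 * G (par_map X s Y))"
    by (rule integral_cong_AE) (use AE D Phm GY in auto)
  also have "\<dots> = (1 / s ^ CARD('n)) * integral\<^sup>L lebesgue G"
    using integral_par_map[OF s Gm, of X] s by (simp add: power_add power2_eq_square field_simps)
  finally have eq: "(LINT Y:par_cyl 1 0|\<nu>. h Y) = (1 / s ^ CARD('n)) * integral\<^sup>L lebesgue G" .
  then show "(LINT Y:par_cyl 1 0|\<nu>. h Y) = (1 / s ^ CARD('n)) *
      (LINT Z:par_cyl s X|lebesgue. 1/2 * (h (par_map (- fst X /\<^sub>R s, - snd X / s\<^sup>2) (1/s) Z) * grad_sq U u Z))"
    by (simp add: G_def set_lebesgue_integral_def q_def)
  have "\<bar>integral\<^sup>L lebesgue G\<bar> \<le> integral\<^sup>L lebesgue (\<lambda>Z. \<bar>G Z\<bar>)"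
    by (rule integral_abs_bound)
  also have "\<dots> \<le> (LINT Z|lebesgue. B * (indicat_real (par_cyl s X) Z * grad_sq U u Z))"
    by (rule integral_mono[OF integrable_abs[OF Gi] integrable_mult_right[OF eP'] Gb])
  also have "\<dots> = B * (LINT Z:par_cyl s X|lebesgue. grad_sq U u Z)"
    by (simp add: set_lebesgue_integral_def)
  finally show "\<bar>LINT Y:par_cyl 1 0|\<nu>. h Y\<bar>
      \<le> B * ((1 / s ^ CARD('n)) * (LINT Z:par_cyl s X|lebesgue. grad_sq U u Z))"
    unfolding eq using s by (simp add: abs_mult divide_right_mono)
qed

section \<open>Smoothness of the ingredients of the heat kernel\<close>

lemma Ck_on_Un:
  assumes "open S" "open T" "Ck_on k S f" "Ck_on k T f"
  shows "Ck_on k (S \<union> T) f"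
  using assms(3,4)
proof (induction k arbitrary: f)
  case 0
  then show ?case using assms(1,2) by (simp add: continuous_on_open_Un)
next
  case (Suc k)
  then show ?case by auto
qed

lemma Ck_on_exp: "Ck_on k UNIV (exp :: real \<Rightarrow> real)"
proof (induction k)
  case (Suc k)
  show ?case
  proof (rule Ck_on_SucI[OF open_UNIV])
    show "(exp has_derivative (\<lambda>h. exp x * h)) (at x)" for x :: real
      by (auto intro!: derivative_eq_intros)
    show "Ck_on k UNIV (\<lambda>x::real. exp x * b)" for b
      by (rule Ck_on_mult[OF open_UNIV Suc Ck_on_const[OF open_UNIV]])
  qed
qed (simp add: continuous_on_exp)

lemma Ck_on_inverse: "Ck_on k {0<..} (inverse :: real \<Rightarrow> real)"
proof (induction k)
  case (Suc k)
  show ?case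
  proof (rule Ck_on_SucI[OF open_greaterThan])
    show "(inverse has_derivative (\<lambda>h. (- 1 * (inverse x * inverse x)) * h)) (at x)" if "x \<in> {0<..}" for x :: real
      using that by (auto intro!: derivative_eq_intros)
    show "Ck_on k {0<..} (\<lambda>x::real. (- 1 * (inverse x * inverse x)) * b)" for b
      by (intro Ck_on_mult[OF open_greaterThan _ Ck_on_const[OF open_greaterThan]]
          Ck_on_mult[OF open_greaterThan Ck_on_const[OF open_greaterThan]]
          Ck_on_mult[OF open_greaterThan Suc Suc])
  qed
qed (auto intro!: continuous_intros)

lemma Ck_on_ln: "Ck_on k {0<..} (ln :: real \<Rightarrow> real)"
proof (cases k)
  case 0
  then show ?thesis by (auto intro!: continuous_intros)
next
  case (Suc j)
  show ?thesis
    unfolding Suc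
  proof (rule Ck_on_SucI[OF open_greaterThan])
    show "(ln has_derivative (\<lambda>h. inverse x * h)) (at x)" if "x \<in> {0<..}" for x :: real
      using that by (auto intro!: derivative_eq_intros simp: divide_inverse mult.commute)
    show "Ck_on j {0<..} (\<lambda>x::real. inverse x * b)" for b
      by (rule Ck_on_mult[OF open_greaterThan Ck_on_inverse Ck_on_const[OF open_greaterThan]])
  qed
qed

section \<open>A localized monotonicity formula\<close>

locale heat_weight =
  fixes x0 :: "real^'n" and t0 s :: real
  assumes x0: "norm x0 < 2" and t0: "\<bar>t0\<bar> < 4" and s: "0 < s" "s \<le> 1"
begin

text \<open>The pole \<open>(x0, t0 + 3 s\<^sup>2)\<close> of \<open>gauss\<close> is outside the support of \<open>zeta\<close>, which ends at \<open>t0 + 2 s\<^sup>2\<close>.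
  On \<open>P\<^sub>s(x0, t0)\<close> the factor \<open>zeta\<close> decreases at rate \<open>1 / s\<^sup>2\<close>, which makes the monotonicity
  formula control the energy there, while it increases only for \<open>-7 < t < -6\<close>, far from the pole.\<close>

definition tau :: "(real^'n) \<times> real \<Rightarrow> real" where
  "tau X = t0 + 3 * s\<^sup>2 - snd X"

text \<open>Constant for \<open>|x|\<^sup>2 \<le> 13\<close>, hence on the ball of radius 3 that
  contains every \<open>B_s(x0)\<close>, and zero for \<open>|x|\<^sup>2 \<ge> 14\<close>, hence
  before the boundary of the ball of radius 4. Where it varies, \<open>|x| > 3\<close>, so
  \<open>x\<close> has distance at least 1 from \<open>x0\<close> and the kernel stays bounded up to
  the time of the pole.\<close>

definition chi :: "(real^'n) \<times> real \<Rightarrow> real" where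
  "chi X = smooth_step (14 - fst X \<bullet> fst X)"

definition zeta :: "(real^'n) \<times> real \<Rightarrow> real" where
  "zeta X = bump 0 ((t0 + 2 * s\<^sup>2 - snd X) / s\<^sup>2) * smooth_step (snd X + 7)"

text \<open>The backward heat kernel without the power of \<open>4 \<pi>\<close>. The power
  \<open>\<tau> ^ (-n/2)\<close> is put into the exponent, so that the kernel is one exponential.
  Its values for \<open>tau X \<le> 0\<close> carry no meaning; they are always multiplied by a
  vanishing \<open>zeta\<close>.\<close>

definition gauss :: "(real^'n) \<times> real \<Rightarrow> real" where
  "gauss X = exp (- (CARD('n) / 2 * ln (tau X)) - ((fst X - x0) \<bullet> (fst X - x0)) / (4 * tau X))"

definition weight :: "(real^'n) \<times> real \<Rightarrow> real" where
  "weight X = zeta X * (chi X)\<^sup>2 * gauss X"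

definition grad_chi :: "(real^'n) \<times> real \<Rightarrow> real^'n" where
  "grad_chi X = (- 2 * smooth_step' (14 - fst X \<bullet> fst X)) *\<^sub>R fst X"

definition zeta' :: "(real^'n) \<times> real \<Rightarrow> real" where
  "zeta' X = - (bump 2 ((t0 + 2 * s\<^sup>2 - snd X) / s\<^sup>2) * smooth_step (snd X + 7) / s\<^sup>2)
     + bump 0 ((t0 + 2 * s\<^sup>2 - snd X) / s\<^sup>2) * smooth_step' (snd X + 7)"

text \<open>The bracket is the time derivative of the logarithm of \<open>gauss\<close>; the spatial
  counterpart in \<open>weight_x\<close> is \<open>-(x - x0) / (2 \<tau>)\<close>.\<close>

definition weight_t :: "(real^'n) \<times> real \<Rightarrow> real" where
  "weight_t X = zeta' X * (chi X)\<^sup>2 * gauss X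
     + weight X * (CARD('n) / (2 * tau X) - ((fst X - x0) \<bullet> (fst X - x0)) / (4 * (tau X)\<^sup>2))"

definition weight_x :: "(real^'n) \<times> real \<Rightarrow> real^'n" where
  "weight_x X = (2 * zeta X * chi X * gauss X) *\<^sub>R grad_chi X - (weight X / (2 * tau X)) *\<^sub>R (fst X - x0)"

text \<open>Together with \<open>xi\<close> this is \<open>- weight / 2\<close> times the vector
  field \<open>(x - x0, -2 \<tau>)\<close>, which generates the parabolic dilations about the
  pole.\<close>

definition theta :: "(real^'n) \<times> real \<Rightarrow> real" where
  "theta X = tau X * weight X"

definition xi :: "(real^'n) \<times> real \<Rightarrow> real^'n" where
  "xi X = (- (weight X / 2)) *\<^sub>R (fst X - x0)"

text \<open>Everything is switched off while \<open>tau\<close> is still at least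
  \<open>s\<^sup>2\<close>, so the conventions for division and logarithm at
  \<open>tau X \<le> 0\<close> never enter.\<close>

lemma weight_late:
  assumes "t0 + 2 * s\<^sup>2 \<le> snd X"
  shows "zeta X = 0" "zeta' X = 0" "weight X = 0" "weight_t X = 0" "weight_x X = 0"
proof -
  have "(t0 + 2 * s\<^sup>2 - snd X) / s\<^sup>2 \<le> 0"
    using assms by (simp add: divide_le_0_iff)
  then show "zeta X = 0" "zeta' X = 0"
    by (simp_all add: zeta_def zeta'_def bump_def)
  then show "weight X = 0" "weight_t X = 0" "weight_x X = 0"
    by (simp_all add: weight_def weight_t_def weight_x_def)
qed

text \<open>Two overlapping open half-spaces: on the first \<open>tau\<close> is positive and the
  formulas apply, on the second \<open>weight\<close> is zero. Differentiability and smoothness are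
  checked on each and glued.\<close>

lemma open_early: "open {X :: (real^'n) \<times> real. snd X < t0 + 3 * s\<^sup>2}"
  and open_late: "open {X :: (real^'n) \<times> real. t0 + 2 * s\<^sup>2 < snd X}"
  by (intro open_Collect_less continuous_intros)+

lemma early_or_late: "{X :: (real^'n) \<times> real. snd X < t0 + 3 * s\<^sup>2} \<union> {X. t0 + 2 * s\<^sup>2 < snd X} = UNIV"
  using s by (auto simp: not_less intro: less_le_trans[rotated])

lemma has_derivative_weight:
  "(weight has_derivative (\<lambda>h. weight_t X * snd h + weight_x X \<bullet> fst h)) (at X)"
proof -
  consider "snd X < t0 + 3 * s\<^sup>2" | "t0 + 2 * s\<^sup>2 < snd X"
    using early_or_late by blast
  then show ?thesis
  proof cases
    case 1
    then have tp: "tau X > 0" by (simp add: tau_def)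
    have ss: "(smooth_step has_derivative (*) (smooth_step' y)) (at y)" for y
      using smooth_step_deriv by (simp add: has_field_derivative_def)
    have bb: "(bump 0 has_derivative (*) (bump 2 y)) (at y)" for y
      using bump_deriv[of 0 y] by (simp add: has_field_derivative_def numeral_2_eq_2)
    have tau: "(tau has_derivative (\<lambda>h. - snd h)) (at X)"
      unfolding tau_def[abs_def] by (auto intro!: derivative_eq_intros)
    have y2: "((\<lambda>X. (fst X - x0) \<bullet> (fst X - x0)) has_derivative (\<lambda>h. 2 * ((fst X - x0) \<bullet> fst h))) (at X)"
      by (auto intro!: derivative_eq_intros simp: inner_commute)
    have chi: "(chi has_derivative (\<lambda>h. grad_chi X \<bullet> fst h)) (at X)"
    proof -
      have "((\<lambda>X. 14 - fst X \<bullet> fst X) has_derivative (\<lambda>h. - (2 * (fst X \<bullet> fst h)))) (at X)"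
        by (auto intro!: derivative_eq_intros simp: inner_commute)
      from has_derivative_compose[OF this ss] show ?thesis
        unfolding chi_def[abs_def] grad_chi_def by (simp add: mult_ac)
    qed
    have zeta: "(zeta has_derivative (\<lambda>h. zeta' X * snd h)) (at X)"
    proof -
      have "((\<lambda>X. (t0 + 2 * s\<^sup>2 - snd X) / s\<^sup>2) has_derivative (\<lambda>h. - (snd h / s\<^sup>2))) (at X)"
        using s by (auto intro!: derivative_eq_intros simp: fun_eq_iff field_simps power2_eq_square)
      note a = has_derivative_compose[OF this bb]
      have "((\<lambda>X. snd X + 7) has_derivative (\<lambda>h. snd h)) (at X)"
        by (auto intro!: derivative_eq_intros)
      note b = has_derivative_compose[OF this ss]
      show ?thesis
        unfolding zeta_def[abs_def] zeta'_def using has_derivative_mult[OF a b]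
        by (rule has_derivative_eq_rhs) (auto simp: fun_eq_iff algebra_simps)
    qed
    have gauss: "(gauss has_derivative (\<lambda>h. gauss X *
        ((CARD('n) / (2 * tau X) - ((fst X - x0) \<bullet> (fst X - x0)) / (4 * (tau X)\<^sup>2)) * snd h
          - ((fst X - x0) \<bullet> fst h) / (2 * tau X)))) (at X)"
    proof -
      let ?Q = "\<lambda>X. (fst X - x0) \<bullet> (fst X - x0)"
      have 1: "((\<lambda>X. - (CARD('n) / 2 * ln (tau X))) has_derivative (\<lambda>h. CARD('n) / (2 * tau X) * snd h)) (at X)"
      proof -
        have "(ln has_derivative (*) (1 / tau X)) (at (tau X))"
          using DERIV_ln_divide[OF tp] by (simp add: has_field_derivative_def)
        from has_derivative_minus[OF has_derivative_mult_right[OF has_derivative_compose[OF tau this], of "CARD('n) / 2"]]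
        show ?thesis by (rule has_derivative_eq_rhs) (simp add: fun_eq_iff)
      qed
      have 2: "((\<lambda>X. ?Q X / (4 * tau X)) has_derivative
          (\<lambda>h. ((fst X - x0) \<bullet> fst h) / (2 * tau X) + ?Q X / (4 * (tau X)\<^sup>2) * snd h)) (at X)"
      proof -
        have "(inverse has_derivative (*) (- (inverse (tau X) ^ 2))) (at (tau X))"
          using DERIV_inverse[of "tau X"] tp
          by (simp add: has_field_derivative_def numeral_2_eq_2)
        from has_derivative_mult[OF y2 has_derivative_mult_right[OF has_derivative_compose[OF tau this], of "1/4"]]
        have "((\<lambda>X. ?Q X * (1/4 * inverse (tau X))) has_derivative
          (\<lambda>h. ((fst X - x0) \<bullet> fst h) / (2 * tau X) + ?Q X / (4 * (tau X)\<^sup>2) * snd h)) (at X)"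
          by (rule has_derivative_eq_rhs)
             (use tp in \<open>simp add: fun_eq_iff field_simps power2_eq_square\<close>)
        moreover have "(\<lambda>X. ?Q X * (1/4 * inverse (tau X))) = (\<lambda>X. ?Q X / (4 * tau X))"
          by (simp add: fun_eq_iff inverse_eq_divide)
        ultimately show ?thesis by simp
      qed
      from has_derivative_exp[OF has_derivative_diff[OF 1 2]] show ?thesis
        unfolding gauss_def[abs_def]
        by (rule has_derivative_eq_rhs) (simp add: fun_eq_iff algebra_simps)
    qed
    have chi2: "((\<lambda>X. (chi X)\<^sup>2) has_derivative (\<lambda>h. 2 * chi X * (grad_chi X \<bullet> fst h))) (at X)"
      by (auto intro!: derivative_eq_intros chi)
    show ?thesis
      unfolding weight_def[abs_def]
    proof (rule has_derivative_eq_rhs[OF has_derivative_mult[OF has_derivative_mult[OF zeta chi2] gauss]], rule ext)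
      fix h :: "(real^'n) \<times> real"
      have wx: "weight_x X \<bullet> fst h = 2 * zeta X * chi X * gauss X * (grad_chi X \<bullet> fst h)
          - weight X * (((fst X - x0) \<bullet> fst h) / (2 * tau X))"
        by (simp add: weight_x_def inner_diff_left)
      show "zeta X * (chi X)\<^sup>2 * (gauss X *
          ((CARD('n) / (2 * tau X) - ((fst X - x0) \<bullet> (fst X - x0)) / (4 * (tau X)\<^sup>2)) * snd h
            - ((fst X - x0) \<bullet> fst h) / (2 * tau X)))
        + (zeta X * (2 * chi X * (grad_chi X \<bullet> fst h)) + zeta' X * snd h * (chi X)\<^sup>2) * gauss X
        = weight_t X * snd h + weight_x X \<bullet> fst h"
        unfolding wx weight_t_def weight_def by algebra
    qed
  next
    case 2
    show ?thesis
    proof (rule has_derivative_transform_within_open[OF _ open_late])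
      show "((\<lambda>X. 0) has_derivative (\<lambda>h. weight_t X * snd h + weight_x X \<bullet> fst h)) (at X)"
        using 2 by (simp add: weight_late)
    qed (use 2 weight_late(3) in auto)
  qed
qed

lemma Ck_on_weight: "Ck_on k UNIV weight"
proof -
  let ?A = "{X :: (real^'n) \<times> real. snd X < t0 + 3 * s\<^sup>2}"
  let ?B = "{X :: (real^'n) \<times> real. t0 + 2 * s\<^sup>2 < snd X}"
  note A = open_early
  have fst: "Ck_on k ?A fst" and snd: "Ck_on k ?A snd"
    by (rule Ck_on_linear[OF A]; simp add: bounded_linear_fst bounded_linear_snd)+
  note c = Ck_on_const[OF A]
  have tau: "Ck_on k ?A tau"
    unfolding tau_def[abs_def] by (intro Ck_on_diff A c snd)
  have chi: "Ck_on k ?A chi"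
    unfolding chi_def[abs_def]
    by (rule Ck_on_compose_real[OF A Ck_on_smooth_step Ck_on_diff[OF A c Ck_on_inner[OF A fst fst]]]) simp
  have "Ck_on k ?A (\<lambda>X. (t0 + 2 * s\<^sup>2 - snd X) * (1 / s\<^sup>2))"
    by (intro Ck_on_mult[OF A _ c] Ck_on_diff A c snd)
  then have z1: "Ck_on k ?A (\<lambda>X. bump 0 ((t0 + 2 * s\<^sup>2 - snd X) / s\<^sup>2))"
    by (intro Ck_on_compose_real[OF A Ck_on_bump]) auto
  have z2: "Ck_on k ?A (\<lambda>X. smooth_step (snd X + 7))"
    by (rule Ck_on_compose_real[OF A Ck_on_smooth_step Ck_on_add[OF A snd c]]) simp
  have zeta: "Ck_on k ?A zeta"
    unfolding zeta_def[abs_def] by (rule Ck_on_mult[OF A z1 z2])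
  have tpos: "tau ` ?A \<subseteq> {0<..}" by (auto simp: tau_def)
  have y: "Ck_on k ?A (\<lambda>X. fst X - x0)" by (rule Ck_on_diff[OF A fst c])
  have lt: "Ck_on k ?A (\<lambda>X. ln (tau X))" by (rule Ck_on_compose_real[OF A Ck_on_ln tau tpos])
  have it: "Ck_on k ?A (\<lambda>X. inverse (tau X))" by (rule Ck_on_compose_real[OF A Ck_on_inverse tau tpos])
  have "Ck_on k ?A (\<lambda>X. - (CARD('n) / 2 * ln (tau X)) - (1/4 * ((fst X - x0) \<bullet> (fst X - x0))) * inverse (tau X))"
    by (rule Ck_on_diff[OF A Ck_on_minus[OF A Ck_on_mult[OF A c lt]]
          Ck_on_mult[OF A Ck_on_mult[OF A c Ck_on_inner[OF A y y]] it]])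
  from Ck_on_compose_real[OF A Ck_on_exp this subset_UNIV]
  have gauss: "Ck_on k ?A gauss"
    by (rule Ck_on_cong[OF A, rotated]) (simp add: gauss_def inverse_eq_divide)
  have "Ck_on k ?A weight"
    by (rule Ck_on_cong[OF A _ Ck_on_mult[OF A Ck_on_mult[OF A zeta Ck_on_mult[OF A chi chi]] gauss]])
       (simp add: weight_def power2_eq_square)
  moreover have "Ck_on k ?B weight"
    by (rule Ck_on_cong[OF open_late _ Ck_on_const[OF open_late, of k 0]]) (simp add: weight_late)
  ultimately show ?thesis
    using Ck_on_Un[OF open_early open_late, of k weight] unfolding early_or_late by blast
qed

lemma weight_support:
  assumes "weight X \<noteq> 0"
  shows "X \<in> cball 0 (sqrt 14) \<times> {-7..6}"
proof -
  have "fst X \<bullet> fst X \<le> 14"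
    using assms smooth_step_eq_0[of "14 - fst X \<bullet> fst X"] by (force simp: weight_def chi_def)
  moreover have "- 7 \<le> snd X"
    using assms smooth_step_eq_0[of "snd X + 7"] by (force simp: weight_def zeta_def)
  moreover have "s\<^sup>2 \<le> 1"
    using s by (simp add: power_le_one)
  \<comment> \<open>The weight vanishes from time \<open>t0 + 2 * s\<^sup>2\<close> on, which is
    less than 4 + 2.\<close>
  then have "snd X \<le> 6"
    using assms t0 weight_late(3)[of X] by force
  ultimately show ?thesis
    by (cases X) (auto simp: norm_eq_sqrt_inner)
qed

lemma cylinder_sub: "cball 0 (sqrt 14) \<times> {-7..6} \<subseteq> (par_cyl 4 0 :: ((real^'n) \<times> real) set)"
proof -
  have "sqrt 14 < sqrt (4\<^sup>2)" by (rule real_sqrt_less_mono) simp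
  then show ?thesis by (auto simp: par_cyl_def)
qed

lemma compact_support_weight:
  fixes v :: "(real^'n) \<times> real \<Rightarrow> 'b::zero"
  assumes "\<And>X. weight X = 0 \<Longrightarrow> v X = 0"
  shows "compact_support_in (par_cyl 4 0) v"
proof -
  have "closure {X. v X \<noteq> 0} \<subseteq> cball 0 (sqrt 14) \<times> {-7..6}"
    by (rule closure_minimal) (use assms weight_support in \<open>blast intro: closed_Times closed_cball closed_atLeastAtMost\<close>)+
  moreover from this have "compact (closure {X. v X \<noteq> 0})"
    using bounded_subset[OF compact_imp_bounded[OF compact_Times[OF compact_cball compact_Icc]]]
    by (simp add: compact_eq_bounded_closed)
  ultimately show ?thesis
    using cylinder_sub by (auto simp: compact_support_in_def)
qed

lemma Ck_on_theta: "Ck_on k UNIV theta"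
  unfolding theta_def[abs_def] tau_def
  by (intro Ck_on_mult[OF open_UNIV _ Ck_on_weight] Ck_on_diff[OF open_UNIV Ck_on_const[OF open_UNIV]]
      Ck_on_linear[OF open_UNIV bounded_linear_snd])

lemma Ck_on_xi: "Ck_on k UNIV xi"
proof -
  have "Ck_on k UNIV (\<lambda>X. (- 1/2 * weight X) *\<^sub>R (fst X - x0))"
    by (intro Ck_on_scaleR[OF open_UNIV Ck_on_mult[OF open_UNIV Ck_on_const[OF open_UNIV] Ck_on_weight]]
        Ck_on_diff[OF open_UNIV _ Ck_on_const[OF open_UNIV]] Ck_on_linear[OF open_UNIV bounded_linear_fst])
  then show ?thesis
    by (simp add: xi_def[abs_def])
qed

lemma theta_test: "theta \<in> test_functions (par_cyl 4 0)"
  and xi_test: "xi \<in> test_functions (par_cyl 4 0)"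
  using Ck_on_theta Ck_on_xi
  by (auto simp: test_functions_def smooth_on_def theta_def xi_def intro!: compact_support_weight)

lemma classical_dt_theta: "classical_dt theta X = tau X * weight_t X - weight X"
  and classical_dx_theta: "classical_dx i theta X = tau X * weight_x X $ i"
proof -
  have tau: "(tau has_derivative (\<lambda>h. - snd h)) (at X)"
    unfolding tau_def[abs_def] by (auto intro!: derivative_eq_intros)
  have "(theta has_derivative (\<lambda>h. tau X * (weight_t X * snd h + weight_x X \<bullet> fst h) + - snd h * weight X)) (at X)"
    unfolding theta_def[abs_def] by (rule has_derivative_mult[OF tau has_derivative_weight])
  from frechet_derivative_at[OF this, symmetric]
  show "classical_dt theta X = tau X * weight_t X - weight X"
    "classical_dx i theta X = tau X * weight_x X $ i"
    by (simp_all add: classical_dt_def classical_dx_def dir_t_def dir_x_def inner_axis)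
qed

lemma classical_dx_xi:
  "classical_dx i xi X $ j = - 1/2 * (weight_x X $ i * (fst X - x0) $ j + (if i = j then weight X else 0))"
proof -
  have "((\<lambda>X. fst X - x0) has_derivative fst) (at X)"
    by (auto intro!: derivative_eq_intros)
  moreover have "((\<lambda>X. - (weight X / 2)) has_derivative (\<lambda>h. - ((weight_t X * snd h + weight_x X \<bullet> fst h) / 2))) (at X)"
    by (auto intro!: derivative_eq_intros has_derivative_weight)
  ultimately have "(xi has_derivative (\<lambda>h. (- (weight X / 2)) *\<^sub>R fst h
      + (- ((weight_t X * snd h + weight_x X \<bullet> fst h) / 2)) *\<^sub>R (fst X - x0))) (at X)"
    unfolding xi_def[abs_def] by (intro has_derivative_scaleR)
  from frechet_derivative_at[OF this, symmetric]
  have "classical_dx i xi X $ j = (- (weight X / 2)) * axis i 1 $ j + (- (weight_x X $ i / 2)) * (fst X - x0) $ j"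
    by (simp add: classical_dx_def dir_x_def inner_axis)
  then show ?thesis
    by (cases "i = j") (simp_all add: axis_def field_simps)
qed

end

section \<open>Pointwise algebra of the monotonicity formula\<close>

lemma norm_sum_scaleR_le:
  fixes g :: "real^'n" and q :: "'n \<Rightarrow> 'b::real_inner"
  shows "(norm (\<Sum>i\<in>UNIV. g $ i *\<^sub>R q i))\<^sup>2 \<le> (norm g)\<^sup>2 * (\<Sum>i\<in>UNIV. (norm (q i))\<^sup>2)"
proof -
  have "norm (\<Sum>i\<in>UNIV. g $ i *\<^sub>R q i) \<le> (\<Sum>i\<in>UNIV. \<bar>g $ i\<bar> * \<bar>norm (q i)\<bar>)"
    by (rule order_trans[OF norm_sum]) simp
  also have "\<dots> \<le> L2_set (\<lambda>i. g $ i) UNIV * L2_set (\<lambda>i. norm (q i)) UNIV"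
    by (rule L2_set_mult_ineq)
  finally have "(norm (\<Sum>i\<in>UNIV. g $ i *\<^sub>R q i))\<^sup>2
      \<le> (L2_set (\<lambda>i. g $ i) UNIV * L2_set (\<lambda>i. norm (q i)) UNIV)\<^sup>2"
    by (rule power_mono) simp
  also have "\<dots> = (norm g)\<^sup>2 * (\<Sum>i\<in>UNIV. (norm (q i))\<^sup>2)"
    by (simp add: power_mult_distrib norm_vec_def L2_set_def sum_nonneg)
  finally show ?thesis .
qed

text \<open>All inner products are replaced by scalars: \<open>DY\<close> stands for
  \<open>D \<bullet> Y\<close>, \<open>yy\<close> for \<open>y \<bullet> y\<close>, and so on, while
  \<open>r\<close> stands for \<open>1 / (2 \<tau>)\<close>. Without division the two sides are
  polynomials whose difference is a multiple of \<open>2 * \<tau> * r - 1\<close>.\<close>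

lemma square_completion_identity:
  fixes \<tau> r z z' c n e yy gy DD DY YY DV VY VV :: real
  assumes "2 * \<tau> * r = 1"
  shows "(e * (\<tau> * (z' + z * c\<^sup>2 * (n * r - yy * r\<^sup>2)) - z * c\<^sup>2)
      - 2 * (DD + 2 * (DY * r) + YY * r\<^sup>2) * (\<tau> * (z * c\<^sup>2))
      - 2 * (\<tau> * (2 * z * c * (DV + VY * r) - z * c\<^sup>2 * r * (DY + YY * r))))
    + (e * (- 1/2 * (2 * z * c * gy - z * c\<^sup>2 * r * yy + n * (z * c\<^sup>2)))
      - 2 * (- 1/2 * (2 * z * c * VY - z * c\<^sup>2 * r * YY + z * c\<^sup>2 * e))
      - 2 * (- (z * c\<^sup>2 / 2) * (DY + YY * r)))
    = (\<tau> * z' - z * c * gy) * e + 2 * \<tau> * z * VV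
      - 2 * \<tau> * z * (c\<^sup>2 * DD + 2 * c * DV + VV)"
    (is "?l = ?r")
proof -
  have "?l - ?r = (2 * \<tau> * r - 1) * (e * n * (z * c\<^sup>2) / 2 - e * (z * c\<^sup>2) * yy * r / 2
      - z * c\<^sup>2 * DY - 2 * z * c * VY)"
    by (simp add: field_simps power2_eq_square)
  then show ?thesis using assms by simp
qed

text \<open>Completing the square in the sum of the two integrands. Here \<open>p\<close> and \<open>q\<close> stand for
  \<open>\<partial>\<^sub>t u\<close> and \<open>\<nabla>u\<close>, and \<open>wt\<close>, \<open>wx\<close> for the derivatives of a weight \<open>z c\<^sup>2\<close>, where \<open>z\<close>
  is a multiple of the backward heat kernel and \<open>g = \<nabla>c\<close>.\<close>

lemma monotonicity_integrand:
  fixes p :: "'b::real_inner" and q :: "'n::finite \<Rightarrow> 'b" and y g :: "real^'n"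
    and \<tau> z' z c :: real
  assumes \<tau>: "\<tau> > 0" and z: "z \<ge> 0"
  defines "w \<equiv> z * c\<^sup>2" and "e \<equiv> (\<Sum>i\<in>UNIV. (norm (q i))\<^sup>2)"
  defines "wt \<equiv> z' + w * (CARD('n) / (2 * \<tau>) - (y \<bullet> y) / (4 * \<tau>\<^sup>2))"
    and "wx \<equiv> (2 * z * c) *\<^sub>R g - (w / (2 * \<tau>)) *\<^sub>R y"
  shows "(e * (\<tau> * wt - w) - 2 * (norm p)\<^sup>2 * (\<tau> * w) - 2 * (\<Sum>i\<in>UNIV. (p \<bullet> q i) * (\<tau> * wx $ i)))
    + (e * (\<Sum>i\<in>UNIV. - 1/2 * (wx $ i * y $ i + w))
      - 2 * (\<Sum>i\<in>UNIV. \<Sum>j\<in>UNIV. - 1/2 * (wx $ i * y $ j + (if i = j then w else 0)) * (q i \<bullet> q j))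
      - 2 * (\<Sum>i\<in>UNIV. (p \<bullet> q i) * (- (w / 2) * y $ i)))
    \<le> (\<tau> * z' - z * c * (g \<bullet> y) + 2 * \<tau> * z * (norm g)\<^sup>2) * e"
proof -
  define Y where "Y = (\<Sum>i\<in>UNIV. y $ i *\<^sub>R q i)"
  define V where "V = (\<Sum>i\<in>UNIV. g $ i *\<^sub>R q i)"
  define M where "M = (\<Sum>i\<in>UNIV. wx $ i *\<^sub>R q i)"
  have M: "M = (2 * z * c) *\<^sub>R V - (w / (2 * \<tau>)) *\<^sub>R Y"
    by (simp add: M_def V_def Y_def wx_def scaleR_diff_left sum_subtractf scaleR_sum_right)
  have wxy: "(\<Sum>i\<in>UNIV. wx $ i * y $ i) = 2 * z * c * (g \<bullet> y) - w / (2 * \<tau>) * (y \<bullet> y)"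
  proof -
    have "(\<Sum>i\<in>UNIV. wx $ i * y $ i) = wx \<bullet> y"
      by (simp add: inner_vec_def)
    then show ?thesis by (simp add: wx_def inner_diff_left)
  qed
  have s1: "(\<Sum>i\<in>UNIV. (p \<bullet> q i) * (\<tau> * wx $ i)) = \<tau> * (p \<bullet> M)"
    by (simp add: M_def inner_sum_right sum_distrib_left mult_ac)
  have s2: "(\<Sum>i\<in>UNIV. - 1/2 * (wx $ i * y $ i + w))
      = - 1/2 * (2 * z * c * (g \<bullet> y) - w / (2 * \<tau>) * (y \<bullet> y) + CARD('n) * w)"
    unfolding wxy[symmetric] by (simp only: sum_distrib_left[symmetric] sum.distrib sum_constant)
  have s3: "(\<Sum>i\<in>UNIV. \<Sum>j\<in>UNIV. - 1/2 * (wx $ i * y $ j + (if i = j then w else 0)) * (q i \<bullet> q j))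
      = - 1/2 * (M \<bullet> Y + w * e)"
  proof -
    have "M \<bullet> Y = (\<Sum>i\<in>UNIV. \<Sum>j\<in>UNIV. wx $ i * y $ j * (q i \<bullet> q j))"
      unfolding M_def Y_def inner_sum_right inner_sum_left
      by (subst sum.swap) (simp add: mult_ac)
    moreover have "w * e = (\<Sum>i\<in>UNIV. \<Sum>j\<in>UNIV. (if i = j then w else 0) * (q i \<bullet> q j))"
      by (simp add: e_def sum_distrib_left power2_norm_eq_inner if_distrib[of "\<lambda>x. x * _"] sum.delta cong: if_cong)
    ultimately have "M \<bullet> Y + w * e
        = (\<Sum>i\<in>UNIV. \<Sum>j\<in>UNIV. (wx $ i * y $ j + (if i = j then w else 0)) * (q i \<bullet> q j))"
      by (simp add: sum.distrib[symmetric] distrib_right)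
    then show ?thesis by (simp add: sum_distrib_left mult.assoc)
  qed
  have s4: "(\<Sum>i\<in>UNIV. (p \<bullet> q i) * (- (w / 2) * y $ i)) = - (w / 2) * (p \<bullet> Y)"
    by (simp add: Y_def inner_sum_right sum_distrib_left mult_ac)
  \<comment> \<open>\<open>D\<close> is, up to a factor, the derivative of the map along the
    dilations about the pole; it vanishes for maps that are self-similar about that point.\<close>
  define D where "D = p - (1 / (2 * \<tau>)) *\<^sub>R Y"
  have p: "p = D + (1 / (2 * \<tau>)) *\<^sub>R Y" by (simp add: D_def)
  have norm_p: "(norm p)\<^sup>2 = (norm D)\<^sup>2 + (D \<bullet> Y) / \<tau> + (Y \<bullet> Y) / (4 * \<tau>\<^sup>2)"
    unfolding p power2_norm_eq_inner
    by (simp add: inner_add_left inner_add_right inner_commute power2_eq_square)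
  have pY: "p \<bullet> Y = D \<bullet> Y + (Y \<bullet> Y) / (2 * \<tau>)" and pV: "p \<bullet> V = D \<bullet> V + (V \<bullet> Y) / (2 * \<tau>)"
    unfolding p by (simp_all add: inner_add_left inner_commute[of Y V])
  have V: "(norm V)\<^sup>2 \<le> (norm g)\<^sup>2 * e"
    unfolding V_def e_def by (rule norm_sum_scaleR_le)
  have sq: "(norm (c *\<^sub>R D + V))\<^sup>2 = c\<^sup>2 * (norm D)\<^sup>2 + 2 * c * (D \<bullet> V) + (norm V)\<^sup>2"
    unfolding power2_norm_eq_inner
    by (simp add: inner_add_left inner_add_right inner_commute power2_eq_square algebra_simps)
  have eq: "(e * (\<tau> * wt - w) - 2 * (norm p)\<^sup>2 * (\<tau> * w) - 2 * (\<tau> * (p \<bullet> M)))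
    + (e * (- 1/2 * (2 * z * c * (g \<bullet> y) - w / (2 * \<tau>) * (y \<bullet> y) + CARD('n) * w))
      - 2 * (- 1/2 * (M \<bullet> Y + w * e)) - 2 * (- (w / 2) * (p \<bullet> Y)))
    = (\<tau> * z' - z * c * (g \<bullet> y)) * e + 2 * \<tau> * z * (norm V)\<^sup>2 - 2 * \<tau> * z * (norm (c *\<^sub>R D + V))\<^sup>2"
  proof -
    define r where "r = 1 / (2 * \<tau>)"
    have r: "2 * \<tau> * r = 1" using \<tau> by (simp add: r_def)
    have r': "x / (2 * \<tau>) = x * r" "x / \<tau> = 2 * (x * r)" "x / (4 * \<tau>\<^sup>2) = x * r\<^sup>2" for x
      using \<tau> by (simp_all add: r_def power_divide)
    have "p \<bullet> M = 2 * z * c * (p \<bullet> V) - w / (2 * \<tau>) * (p \<bullet> Y)"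
      "M \<bullet> Y = 2 * z * c * (V \<bullet> Y) - w / (2 * \<tau>) * (Y \<bullet> Y)"
      by (simp_all add: M inner_diff_left inner_diff_right)
    then show ?thesis
      unfolding wt_def norm_p pY pV sq w_def r' using square_completion_identity[OF r] by simp
  qed
  \<comment> \<open>The square contains the cutoff through \<open>c D + V\<close>, so the mixed term
    in \<open>D\<close> and \<open>V\<close> is absorbed as well. Dropping it leaves only
    \<open>V\<close>, the derivative along \<open>g\<close>, which is controlled by the energy
    density.\<close>
  have "0 \<le> 2 * \<tau> * z * (norm (c *\<^sub>R D + V))\<^sup>2"
    using \<tau> z by simp
  moreover have "2 * \<tau> * z * (norm V)\<^sup>2 \<le> 2 * \<tau> * z * ((norm g)\<^sup>2 * e)"
    using \<tau> z V by (intro mult_left_mono) auto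
  ultimately show ?thesis
    unfolding s1 s2 s3 s4 eq by (simp add: algebra_simps)
qed

text \<open>For \<open>\<tau> \<ge> 1\<close> the exponent is at most 0. Otherwise put
  \<open>b = 1 / (4 \<tau>)\<close>: after enlarging the power from \<open>n/2\<close> to
  \<open>n\<close>, the claim is \<open>b ^ n \<le> n! exp b\<close>, a single term of the
  exponential series.\<close>

lemma exp_over_power_bound:
  fixes \<tau> :: real
  assumes "0 < \<tau>"
  shows "exp (- (real n / 2 * ln \<tau>) - 1 / (4 * \<tau>)) \<le> 4 ^ n * fact n"
proof -
  have f1: "1 \<le> (4::real) ^ n * fact n"
    using mult_mono[of 1 "4 ^ n" 1 "fact n :: real"] by simp
  show ?thesis
  proof (cases "1 \<le> \<tau>")
    case True
    then have "0 \<le> real n / 2 * ln \<tau>" "0 \<le> 1 / (4 * \<tau>)" by simp_all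
    then have "exp (- (real n / 2 * ln \<tau>) - 1 / (4 * \<tau>)) \<le> exp 0"
      by (intro exp_le_cancel_iff[THEN iffD2]) linarith
    then show ?thesis using f1 unfolding exp_zero by (rule order_trans)
  next
    case False
    let ?z = "1 / \<tau>"
    have z: "1 \<le> ?z" using False assms by simp
    have "- ln \<tau> = ln ?z" using assms by (simp add: ln_div)
    moreover have "real n / 2 * ln ?z \<le> real n * ln ?z"
      using z by (intro mult_right_mono) auto
    ultimately have "- (real n / 2 * ln \<tau>) \<le> real n * ln ?z"
      by (metis mult_minus_right)
    then have "exp (- (real n / 2 * ln \<tau>) - 1 / (4 * \<tau>)) \<le> exp (real n * ln ?z - ?z / 4)"
      by simp
    also have "\<dots> = ?z ^ n * exp (- (?z / 4))"
    proof -
      have "exp (real n * ln ?z) = ?z ^ n"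
        using assms by (subst exp_of_nat_mult) simp
      then show ?thesis
        unfolding diff_conv_add_uminus exp_add by simp
    qed
    also have "\<dots> \<le> 4 ^ n * fact n"
    proof -
      define b where "b = ?z / 4"
      have b: "0 \<le> b" "?z = 4 * b" using assms by (simp_all add: b_def)
      have "(\<Sum>k\<in>{n}. b ^ k /\<^sub>R fact k) \<le> (\<Sum>k. b ^ k /\<^sub>R fact k)"
        by (rule sum_le_suminf[OF summable_exp_generic]) (use b in auto)
      moreover have "(\<Sum>k\<in>{n}. b ^ k /\<^sub>R fact k) = b ^ n / fact n"
        by (simp add: inverse_eq_divide)
      ultimately have "b ^ n / fact n \<le> exp b" unfolding exp_def by linarith
      then have "b ^ n \<le> fact n * exp b" by (simp add: divide_le_eq mult.commute)
      then have "4 ^ n * b ^ n * exp (- b) \<le> 4 ^ n * (fact n * exp b) * exp (- b)"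
        by (intro mult_right_mono mult_left_mono) auto
      also have "\<dots> = 4 ^ n * fact n"
        by (simp add: exp_minus)
      finally show ?thesis
        unfolding b_def[symmetric] b(2) by (simp add: power_mult_distrib)
    qed
    finally show ?thesis .
  qed
qed

section \<open>Integrability of the terms in the stationarity identities\<close>

lemma set_integrable_continuous_mult:
  fixes p q :: "'a::euclidean_space \<Rightarrow> real"
  assumes p: "continuous_on UNIV p" and q: "set_integrable lebesgue U q" and U: "bounded U"
  shows "set_integrable lebesgue U (\<lambda>x. p x * q x)"
proof -
  have "bounded (p ` closure U)"
    using U p by (intro compact_imp_bounded compact_continuous_image)
      (auto intro: continuous_on_subset simp: compact_closure)
  then obtain B where "\<And>x. x \<in> closure U \<Longrightarrow> \<bar>p x\<bar> \<le> B"
    by (auto simp: bounded_iff)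
  then have B: "\<And>x. x \<in> U \<Longrightarrow> \<bar>p x\<bar> \<le> B"
    using closure_subset by blast
  have qi: "integrable lebesgue (\<lambda>x. indicat_real U x * q x)"
    using q by (simp add: set_integrable_def)
  have pm: "p \<in> borel_measurable lebesgue"
    using p by (intro measurable_completion) (simp add: borel_measurable_continuous_onI)
  have "integrable lebesgue (\<lambda>x. p x * (indicat_real U x * q x))"
    by (rule Bochner_Integration.integrable_bound[OF integrable_mult_right[OF qi, of B]
          borel_measurable_times[OF pm borel_measurable_integrable[OF qi]]])
       (use B in \<open>force intro!: AE_I2 mult_right_mono simp: abs_mult split: split_indicator\<close>)
  then show ?thesis
    by (simp add: set_integrable_def mult_ac)
qed

lemma set_integrable_sum:
  fixes f :: "'i \<Rightarrow> 'a \<Rightarrow> real"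
  assumes "\<And>i. i \<in> I \<Longrightarrow> set_integrable M A (f i)"
  shows "set_integrable M A (\<lambda>x. \<Sum>i\<in>I. f i x)"
proof -
  have "integrable M (\<lambda>x. \<Sum>i\<in>I. indicat_real A x *\<^sub>R f i x)"
    using assms unfolding set_integrable_def by (intro Bochner_Integration.integrable_sum)
  then show ?thesis by (simp add: set_integrable_def sum_distrib_left)
qed

lemma square_integrable_inner:
  fixes f g :: "'a::euclidean_space \<Rightarrow> 'b::euclidean_space"
  assumes f: "square_integrable U f" and g: "square_integrable U g"
  shows "set_integrable lebesgue U (\<lambda>x. f x \<bullet> g x)"
proof -
  let ?f = "\<lambda>x. indicat_real U x *\<^sub>R f x" and ?g = "\<lambda>x. indicat_real U x *\<^sub>R g x"
  have m: "?f \<in> borel_measurable lebesgue" "?g \<in> borel_measurable lebesgue"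
    using f g by (auto simp: square_integrable_def set_borel_measurable_def)
  have i: "integrable lebesgue (\<lambda>x. indicat_real U x * (norm (f x))\<^sup>2 + indicat_real U x * (norm (g x))\<^sup>2)"
    using f g by (intro Bochner_Integration.integrable_add) (auto simp: square_integrable_def set_integrable_def)
  have b: "\<bar>a \<bullet> b\<bar> \<le> (norm a)\<^sup>2 + (norm b)\<^sup>2" for a b :: 'b
  proof -
    have "2 * (norm a * norm b) \<le> (norm a)\<^sup>2 + (norm b)\<^sup>2"
      using sum_squares_bound[of "norm a" "norm b"] by simp
    then show ?thesis
      using Cauchy_Schwarz_ineq2[of a b] mult_nonneg_nonneg[OF norm_ge_zero norm_ge_zero, of a b] by linarith
  qed
  have "integrable lebesgue (\<lambda>x. ?f x \<bullet> ?g x)"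
    by (rule Bochner_Integration.integrable_bound[OF i borel_measurable_inner[OF m]])
       (use b in \<open>auto intro!: AE_I2 split: split_indicator\<close>)
  moreover have "?f x \<bullet> ?g x = indicat_real U x *\<^sub>R (f x \<bullet> g x)" for x
    by (auto split: split_indicator)
  ultimately show ?thesis
    by (simp only: set_integrable_def)
qed

section \<open>Bounds for the weight and the resulting energy estimate\<close>

context heat_weight
begin

lemma gauss_pos: "0 < gauss X"
  by (simp add: gauss_def)

lemma gauss_le_1:
  assumes "1 \<le> tau X"
  shows "gauss X \<le> 1"
proof -
  have "0 \<le> CARD('n) / 2 * ln (tau X)" "0 \<le> ((fst X - x0) \<bullet> (fst X - x0)) / (4 * tau X)"
    using assms by auto
  then show ?thesis
    unfolding gauss_def exp_le_one_iff by linarith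
qed

text \<open>Uniform in \<open>tau\<close>, hence up to the pole. It is applied where
  \<open>chi\<close> varies, which is at distance at least 1 from \<open>x0\<close>.\<close>

lemma gauss_le:
  assumes "0 < tau X" "1 \<le> norm (fst X - x0)"
  shows "gauss X \<le> 4 ^ CARD('n) * fact CARD('n)"
proof -
  have "1 \<le> (fst X - x0) \<bullet> (fst X - x0)"
    using assms(2) by (simp add: dot_square_norm)
  then have "1 / (4 * tau X) \<le> ((fst X - x0) \<bullet> (fst X - x0)) / (4 * tau X)"
    using assms(1) by (intro divide_right_mono) auto
  then have "gauss X \<le> exp (- (real CARD('n) / 2 * ln (tau X)) - 1 / (4 * tau X))"
    by (simp add: gauss_def)
  also have "\<dots> \<le> 4 ^ CARD('n) * fact CARD('n)"
    by (rule exp_over_power_bound[OF assms(1)])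
  finally show ?thesis .
qed

text \<open>On the cylinder \<open>tau\<close> lies between \<open>2 * s\<^sup>2\<close> and
  \<open>4 * s\<^sup>2\<close> and the spatial distance is below \<open>s\<close>. So the power of
  \<open>tau\<close> is at least \<open>(2 * s) ^ (-n)\<close> and the quadratic exponent at least
  \<open>-1/8\<close>.\<close>

lemma gauss_ge:
  assumes X: "X \<in> par_cyl s (x0, t0)"
  shows "(1/2) ^ CARD('n) * exp (- 1/8) / s ^ CARD('n) \<le> gauss X"
proof -
  have y: "norm (fst X - x0) < s" and t: "t0 - s\<^sup>2 < snd X" "snd X < t0 + s\<^sup>2"
    using X by (auto simp: par_cyl_def dist_norm norm_minus_commute)
  have tau: "2 * s\<^sup>2 < tau X" "tau X < 4 * s\<^sup>2"
    using t by (auto simp: tau_def)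
  have s2: "0 < s\<^sup>2" using s by simp
  have tp: "0 < tau X" using tau s2 by linarith
  have "(fst X - x0) \<bullet> (fst X - x0) \<le> s\<^sup>2"
    using y s by (simp add: dot_square_norm power_mono)
  then have "((fst X - x0) \<bullet> (fst X - x0)) / (4 * tau X) \<le> s\<^sup>2 / (4 * tau X)"
    using tp by (intro divide_right_mono) auto
  also have "\<dots> \<le> 1/8"
    using tau tp by (simp add: field_simps)
  finally have 1: "((fst X - x0) \<bullet> (fst X - x0)) / (4 * tau X) \<le> 1/8" .
  have "ln (tau X) \<le> ln ((2 * s)\<^sup>2)"
    using tau tp s2 by (simp add: power_mult_distrib)
  also have "\<dots> = 2 * ln (2 * s)"
    using s by (subst ln_realpow) auto
  finally have "CARD('n) / 2 * ln (tau X) \<le> CARD('n) / 2 * (2 * ln (2 * s))"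
    by (intro mult_left_mono) auto
  then have 2: "CARD('n) / 2 * ln (tau X) \<le> CARD('n) * ln (2 * s)" by simp
  have "exp (- (CARD('n) * ln (2 * s)) - 1/8) \<le> gauss X"
    unfolding gauss_def exp_le_cancel_iff using 1 2 by linarith
  moreover have "exp (- (CARD('n) * ln (2 * s)) - 1/8) = inverse ((2 * s) ^ CARD('n)) * exp (- 1/8)"
  proof -
    have "exp (CARD('n) * ln (2 * s)) = (2 * s) ^ CARD('n)"
      using s by (subst exp_of_nat_mult) simp
    then show ?thesis
      unfolding diff_conv_add_uminus exp_add by (simp add: exp_minus[of "real CARD('n) * ln (2 * s)"])
  qed
  ultimately show ?thesis
    by (simp add: power_mult_distrib power_one_over field_simps)
qed

text \<open>On the support \<open>tau \<le> 4 + 3 + 7 = 14\<close>, which bounds the growth of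
  \<open>zeta\<close> before time -6 by \<open>14 * B\<close>. Where \<open>chi\<close> varies, its
  gradient is at most \<open>2 * 4 * B\<close> and the distance to \<open>x0\<close> at most 6,
  which gives 48 and \<open>2 * 14 * 64 = 1792\<close>. The gain on the cylinder has a factor 2 from
  \<open>tau / s\<^sup>2\<close> and \<open>exp (- 1) / 9\<close> from the slope of
  \<open>bump 0\<close>; the cube comes from \<open>chi\<close> squared and the constant value of
  the early step in \<open>zeta\<close>.\<close>

lemma coefficient_bound:
  assumes B: "\<And>x. smooth_step' x \<le> B" and X: "X \<in> par_cyl 4 0" and early: "snd X < t0 + 2 * s\<^sup>2"
  shows "tau X * (zeta' X * (chi X)\<^sup>2 * gauss X)
      - zeta X * gauss X * chi X * (grad_chi X \<bullet> (fst X - x0))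
      + 2 * tau X * (zeta X * gauss X) * (norm (grad_chi X))\<^sup>2
    \<le> (14 * B + 48 * B * (4 ^ CARD('n) * fact CARD('n)) + 1792 * B\<^sup>2 * (4 ^ CARD('n) * fact CARD('n)))
      - (2/9 * exp (- 1) * bump 0 (exp (- 1)) ^ 3 * ((1/2) ^ CARD('n) * exp (- 1/8)) / s ^ CARD('n))
        * indicator (par_cyl s (x0, t0)) X"
proof -
  define z where "z = (t0 + 2 * s\<^sup>2 - snd X) / s\<^sup>2"
  define K where "K = (4::real) ^ CARD('n) * fact CARD('n)"
  define c1 where "c1 = bump 0 (exp (- 1))"
  have s2: "0 < s\<^sup>2" "s\<^sup>2 \<le> 1" using s by (auto simp: power_le_one)
  have tau_gt: "s\<^sup>2 < tau X" using early by (simp add: tau_def)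
  then have tp: "0 < tau X" using s2 by linarith
  have B0: "0 \<le> B" using B[of 0] smooth_step'_nonneg[of 0] by linarith
  have K0: "0 \<le> K" by (simp add: K_def)
  have chi: "0 \<le> chi X" "chi X \<le> 1" "(chi X)\<^sup>2 \<le> 1"
    by (simp_all add: chi_def smooth_step_nonneg smooth_step_le_1 power_le_one)
  have zeta: "0 \<le> zeta X" "zeta X \<le> 1"
    by (simp_all add: zeta_def smooth_step_nonneg smooth_step_le_1 bump_nonneg bump_le_1 mult_le_one)
  define T1 where "T1 = tau X * (bump 2 z * smooth_step (snd X + 7) / s\<^sup>2 * (chi X)\<^sup>2 * gauss X)"
  define T2 where "T2 = tau X * (bump 0 z * smooth_step' (snd X + 7) * (chi X)\<^sup>2 * gauss X)"
  have split: "tau X * (zeta' X * (chi X)\<^sup>2 * gauss X) = T2 - T1"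
    by (simp add: zeta'_def T1_def T2_def z_def algebra_simps)
  have T2: "T2 \<le> 14 * B"
  proof (cases "snd X + 7 \<le> 0 \<or> 1 \<le> snd X + 7")
    case True
    then show ?thesis using B0 by (simp add: T2_def smooth_step'_eq_0)
  next
    case False
    then have "1 \<le> tau X" "tau X \<le> 14"
      unfolding tau_def using False t0 s2 by linarith+
    then have "bump 0 z * smooth_step' (snd X + 7) * (chi X)\<^sup>2 * gauss X \<le> 1 * B * 1 * 1"
      using chi B B0 gauss_le_1[of X] gauss_pos[of X]
      by (intro mult_mono) (auto simp: bump_nonneg bump_le_1 smooth_step'_nonneg intro!: mult_nonneg_nonneg)
    then have "T2 \<le> 14 * (1 * B * 1 * 1)"
      unfolding T2_def using \<open>tau X \<le> 14\<close> tp B0 gauss_pos[of X]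
      by (intro mult_mono[of "tau X" 14]) (auto simp: bump_nonneg smooth_step'_nonneg intro!: mult_nonneg_nonneg)
    then show ?thesis by simp
  qed
  have T1: "(2/9 * exp (- 1) * c1 ^ 3 * ((1/2) ^ CARD('n) * exp (- 1/8)) / s ^ CARD('n))
        * indicator (par_cyl s (x0, t0)) X \<le> T1"
  proof (cases "X \<in> par_cyl s (x0, t0)")
    case False
    then show ?thesis
      using tp gauss_pos[of X]
      by (simp add: T1_def bump_nonneg smooth_step_nonneg)
  next
    case True
    then have y: "norm (fst X - x0) < s" and t: "t0 - s\<^sup>2 < snd X" "snd X < t0 + s\<^sup>2"
      by (auto simp: par_cyl_def dist_norm norm_minus_commute)
    have z: "1 < z" "z < 3"
      using t s2 by (auto simp: z_def field_simps)
    have "norm (fst X) < 3"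
      using y x0 s norm_triangle_ineq[of "fst X - x0" x0] by simp
    then have "(norm (fst X))\<^sup>2 \<le> 3\<^sup>2" by (intro power_mono) auto
    then have chi1: "chi X = c1"
      unfolding chi_def c1_def by (intro smooth_step_eq_const) (simp add: dot_square_norm)
    have S1: "smooth_step (snd X + 7) = c1"
      unfolding c1_def by (intro smooth_step_eq_const) (use t t0 s2 in auto)
    have c10: "0 \<le> c1" by (simp add: c1_def bump_nonneg)
    have b2: "1/9 * exp (- 1) \<le> bump 2 z"
    proof -
      \<comment> \<open>Since \<open>1 < z < 3\<close>, the argument avoids the flat end of the bump
        at 0, and the slope has a bound from below that does not depend on \<open>s\<close>.\<close>
      have "(1/3)\<^sup>2 \<le> (1 / z)\<^sup>2" using z by (intro power_mono) (auto simp: field_simps)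
      moreover have "exp (- 1) \<le> exp (- (1 / z))" using z by (simp add: field_simps)
      ultimately have "(1/3)\<^sup>2 * exp (- 1) \<le> (1 / z)\<^sup>2 * exp (- (1 / z))"
        by (intro mult_mono) auto
      then show ?thesis using z by (simp add: bump_def power2_eq_square)
    qed
    have "2 \<le> tau X / s\<^sup>2"
      using t s2 by (simp add: tau_def field_simps)
    then have "2 * (1/9 * exp (- 1) * c1 * c1\<^sup>2 * ((1/2) ^ CARD('n) * exp (- 1/8) / s ^ CARD('n)))
        \<le> (tau X / s\<^sup>2) * (bump 2 z * c1 * c1\<^sup>2 * gauss X)"
      using b2 c10 gauss_ge[OF True] s gauss_pos[of X]
      by (intro mult_mono) (auto simp: bump_nonneg intro!: mult_nonneg_nonneg)
    then show ?thesis
      using True unfolding T1_def S1 chi1 by (simp add: power3_eq_cube power2_eq_square mult_ac)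
  qed
  have T34: "- (zeta X * gauss X * chi X * (grad_chi X \<bullet> (fst X - x0)))
      + 2 * tau X * (zeta X * gauss X) * (norm (grad_chi X))\<^sup>2 \<le> 48 * B * K + 1792 * B\<^sup>2 * K"
  proof (cases "zeta X = 0 \<or> smooth_step' (14 - fst X \<bullet> fst X) = 0")
    case True
    then show ?thesis using B0 K0 by (auto simp: grad_chi_def)
  next
    case False
    then have z0: "zeta X \<noteq> 0" and nz: "\<not> (14 - fst X \<bullet> fst X \<le> 0 \<or> 1 \<le> 14 - fst X \<bullet> fst X)"
      using smooth_step'_eq_0 by auto
    have "- 7 < snd X"
      using z0 smooth_step_eq_0[of "snd X + 7"] by (force simp: zeta_def)
    then have t14: "tau X \<le> 14"
      unfolding tau_def using t0 s2 by linarith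
    have "3\<^sup>2 < (norm (fst X))\<^sup>2" using nz by (simp add: dot_square_norm)
    then have n3: "3 < norm (fst X)" by (rule power2_less_imp_less) simp
    have n4: "norm (fst X) < 4" using X by (simp add: par_cyl_def mem_Times_iff)
    have y1: "1 \<le> norm (fst X - x0)" and y6: "norm (fst X - x0) \<le> 6"
      using n3 n4 x0 norm_triangle_ineq2[of "fst X" x0] norm_triangle_ineq4[of "fst X" x0] by linarith+
    have gK: "gauss X \<le> K" unfolding K_def by (rule gauss_le[OF tp y1])
    have ng: "norm (grad_chi X) \<le> 8 * B"
    proof -
      have "norm (grad_chi X) = 2 * (smooth_step' (14 - fst X \<bullet> fst X) * norm (fst X))"
        by (simp add: grad_chi_def smooth_step'_nonneg)
      also have "\<dots> \<le> 2 * (B * 4)"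
        using B n4 B0 by (intro mult_left_mono mult_mono) auto
      finally show ?thesis by simp
    qed
    have zg: "0 \<le> zeta X * gauss X" "zeta X * gauss X \<le> K"
      using zeta gK gauss_pos[of X] mult_mono[of "zeta X" 1 "gauss X" K] by auto
    have "- (grad_chi X \<bullet> (fst X - x0)) \<le> norm (grad_chi X) * norm (fst X - x0)"
      using Cauchy_Schwarz_ineq2[of "grad_chi X" "fst X - x0"] by linarith
    also have "\<dots> \<le> 8 * B * 6"
      using ng y6 B0 by (intro mult_mono) auto
    finally have "(zeta X * gauss X) * chi X * (- (grad_chi X \<bullet> (fst X - x0))) \<le> (zeta X * gauss X) * chi X * (8 * B * 6)"
      using zg chi by (intro mult_left_mono) auto
    also have "\<dots> \<le> K * 1 * (8 * B * 6)"
      using zg chi B0 K0 by (intro mult_right_mono mult_mono) auto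
    finally have 3: "- (zeta X * gauss X * chi X * (grad_chi X \<bullet> (fst X - x0))) \<le> 48 * B * K"
      by (simp add: mult_ac)
    have "(norm (grad_chi X))\<^sup>2 \<le> (8 * B)\<^sup>2"
      using ng by (intro power_mono) auto
    then have "2 * tau X * (zeta X * gauss X) * (norm (grad_chi X))\<^sup>2 \<le> 2 * 14 * K * (8 * B)\<^sup>2"
      using t14 tp zg K0 by (intro mult_mono) auto
    moreover have "2 * 14 * K * (8 * B)\<^sup>2 = 1792 * B\<^sup>2 * K"
      by (simp add: power_mult_distrib)
    ultimately show ?thesis
      using 3 by linarith
  qed
  show ?thesis
    using T1 T2 T34 unfolding split K_def[symmetric] c1_def[symmetric] by linarith
qed

text \<open>Both stationarity integrals vanish, while the sum of their integrands is at most a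
  constant times the energy density minus a multiple of order \<open>s ^ (-n)\<close> of that
  density on the small cylinder. Integration and rearrangement give the claim.\<close>

lemma energy_estimate:
  assumes B: "\<And>x. smooth_step' x \<le> B" and u: "suitable_solution N (par_cyl 4 0) u"
  shows "(2/9 * exp (- 1) * bump 0 (exp (- 1)) ^ 3 * ((1/2) ^ CARD('n) * exp (- 1/8)) / s ^ CARD('n))
      * (LINT X:par_cyl s (x0, t0)|lebesgue. grad_sq (par_cyl 4 0) u X)
    \<le> (14 * B + 48 * B * (4 ^ CARD('n) * fact CARD('n)) + 1792 * B\<^sup>2 * (4 ^ CARD('n) * fact CARD('n)))
      * (LINT X:par_cyl 4 0|lebesgue. grad_sq (par_cyl 4 0) u X)"
proof -
  define U :: "((real^'n) \<times> real) set" where "U = par_cyl 4 0"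
  define p where "p = weak_dt U u"
  define q where "q = weak_dx U u"
  define e where "e = grad_sq U u"
  define C where "C = 14 * B + 48 * B * (4 ^ CARD('n) * fact CARD('n)) + 1792 * B\<^sup>2 * (4 ^ CARD('n) * fact CARD('n))"
  define c where "c = 2/9 * exp (- 1) * bump 0 (exp (- 1)) ^ 3 * ((1/2) ^ CARD('n) * exp (- 1/8)) / s ^ CARD('n)"
  note u = u[folded U_def]
  have bU: "bounded U"
    by (simp add: U_def par_cyl_def bounded_Times)
  have p: "square_integrable U p" and q: "square_integrable U (q i)" for i
    using u by (auto simp: suitable_solution_def p_def q_def)
  have fe: "finite_energy U u"
    using u by (auto simp: suitable_solution_def finite_energy_def)
  have ei: "set_integrable lebesgue U e"
    unfolding e_def by (rule grad_sq_integrable[OF fe])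
  have e0: "0 \<le> e X" for X by (simp add: e_def grad_sq_nonneg)
  have eq: "e X = (\<Sum>i\<in>UNIV. (norm (q i X))\<^sup>2)" for X
    by (simp add: e_def q_def grad_sq_def)
  define I2 where "I2 = (\<lambda>X. e X * classical_dt theta X - 2 * (norm (p X))\<^sup>2 * theta X
      - 2 * (\<Sum>i\<in>UNIV. (p X \<bullet> q i X) * classical_dx i theta X))"
  define I3 where "I3 = (\<lambda>X. e X * (\<Sum>i\<in>UNIV. classical_dx i xi X $ i)
      - 2 * (\<Sum>i\<in>UNIV. \<Sum>j\<in>UNIV. classical_dx i xi X $ j * (q i X \<bullet> q j X))
      - 2 * (\<Sum>i\<in>UNIV. (p X \<bullet> q i X) * xi X $ i))"
  have 2: "(LINT X:U|lebesgue. I2 X) = 0" and 3: "(LINT X:U|lebesgue. I3 X) = 0"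
    using u theta_test xi_test unfolding suitable_solution_def I2_def I3_def e_def p_def q_def U_def by blast+
  have cont: "continuous_on UNIV (classical_dt theta)" "continuous_on UNIV (classical_dx i theta)"
    "continuous_on UNIV (classical_dx i xi)" "continuous_on UNIV theta" "continuous_on UNIV xi" for i
    using Ck_on_theta[of "Suc 0"] Ck_on_xi[of "Suc 0"] Ck_on_theta[of 0] Ck_on_xi[of 0]
    by (auto simp: dir_x_Basis dir_t_Basis classical_dt_def[abs_def] classical_dx_def[abs_def])
  have comp: "continuous_on UNIV (\<lambda>X. v X $ j)" if "continuous_on UNIV v"
    for v :: "(real^'n) \<times> real \<Rightarrow> real^'n" and j
    using that by (intro continuous_intros)
  note im = set_integrable_continuous_mult[OF _ _ bU]
  have i2: "set_integrable lebesgue U I2"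
  proof -
    have "set_integrable lebesgue U (\<lambda>X. classical_dt theta X * e X)"
      "set_integrable lebesgue U (\<lambda>X. theta X * (p X \<bullet> p X))"
      "set_integrable lebesgue U (\<lambda>X. classical_dx i theta X * (p X \<bullet> q i X))" for i
      by (intro im cont ei square_integrable_inner p q)+
    then have "set_integrable lebesgue U (\<lambda>X. classical_dt theta X * e X - 2 * (theta X * (p X \<bullet> p X))
        - 2 * (\<Sum>i\<in>UNIV. classical_dx i theta X * (p X \<bullet> q i X)))"
      by (intro set_integral_diff set_integrable_mult_right set_integrable_sum) auto
    then show ?thesis
      by (simp add: I2_def power2_norm_eq_inner mult_ac)
  qed
  have i3: "set_integrable lebesgue U I3"
  proof -
    have "set_integrable lebesgue U (\<lambda>X. (\<Sum>i\<in>UNIV. classical_dx i xi X $ i) * e X)"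
      by (intro im continuous_on_sum comp cont ei)
    moreover have "set_integrable lebesgue U (\<lambda>X. classical_dx i xi X $ j * (q i X \<bullet> q j X))"
      "set_integrable lebesgue U (\<lambda>X. xi X $ i * (p X \<bullet> q i X))" for i j
      by (intro im cont comp square_integrable_inner p q)+
    ultimately have "set_integrable lebesgue U (\<lambda>X. (\<Sum>i\<in>UNIV. classical_dx i xi X $ i) * e X
        - 2 * (\<Sum>i\<in>UNIV. \<Sum>j\<in>UNIV. classical_dx i xi X $ j * (q i X \<bullet> q j X))
        - 2 * (\<Sum>i\<in>UNIV. xi X $ i * (p X \<bullet> q i X)))"
      by (intro set_integral_diff set_integrable_mult_right set_integrable_sum) auto
    then show ?thesis
      by (simp add: I3_def mult_ac)
  qed
  have sub: "par_cyl s (x0, t0) \<subseteq> U"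
  proof
    fix X :: "(real^'n) \<times> real" assume X: "X \<in> par_cyl s (x0, t0)"
    then have "norm (fst X - x0) < s" "t0 - s\<^sup>2 < snd X" "snd X < t0 + s\<^sup>2"
      by (auto simp: par_cyl_def dist_norm norm_minus_commute)
    moreover have "s\<^sup>2 \<le> 1" using s by (simp add: power_le_one)
    moreover have "norm (fst X) \<le> norm (fst X - x0) + norm x0"
      using norm_triangle_ineq[of "fst X - x0" x0] by simp
    ultimately have "norm (fst X) < 4" "- 16 < snd X" "snd X < 16"
      using x0 t0 s by linarith+
    then show "X \<in> U" by (simp add: U_def par_cyl_def mem_Times_iff)
  qed
  \<comment> \<open>After time \<open>t0 + 2 * s\<^sup>2\<close> both integrands are zero and the
    point is outside the small cylinder, so the inequality only says that \<open>C * e X\<close> is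
    nonnegative. Earlier, \<open>tau\<close> is positive and the square can be completed.\<close>
  have le: "I2 X + I3 X \<le> C * e X - c * (indicator (par_cyl s (x0, t0)) X * e X)" if X: "X \<in> U" for X
  proof (cases "snd X < t0 + 2 * s\<^sup>2")
    case False
    then have z: "weight X = 0" "weight_t X = 0" "weight_x X = 0"
      using weight_late[of X] by auto
    then have "classical_dx i xi X $ j = 0" for i j
      by (simp add: classical_dx_xi)
    then have "I2 X + I3 X = 0"
      by (simp add: I2_def I3_def classical_dt_theta classical_dx_theta z theta_def xi_def)
    moreover have "X \<notin> par_cyl s (x0, t0)"
    proof
      assume "X \<in> par_cyl s (x0, t0)"
      then have "snd X < t0 + s\<^sup>2" by (auto simp: par_cyl_def)
      then show False using False zero_le_power2[of s] by linarith
    qed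
    moreover have "0 \<le> C"
      using B[of 0] smooth_step'_nonneg[of 0] by (auto simp: C_def intro!: add_nonneg_nonneg)
    ultimately show ?thesis using e0[of X] by simp
  next
    case True
    then have tp: "0 < tau X" using zero_le_power2[of s] unfolding tau_def by linarith
    have z0: "0 \<le> zeta X * gauss X"
      using gauss_pos[of X] by (simp add: zeta_def bump_nonneg smooth_step_nonneg)
    \<comment> \<open>The pointwise inequality is used with \<open>z = zeta * gauss\<close> and
      \<open>c = chi\<close>. Its \<open>z'\<close> is the part of \<open>weight_t\<close> that
      comes from the time cutoff and not from the kernel.\<close>
    have w: "weight X = zeta X * gauss X * (chi X)\<^sup>2"
      by (simp add: weight_def)
    have "I2 X + I3 X \<le> (tau X * (zeta' X * (chi X)\<^sup>2 * gauss X)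
        - (zeta X * gauss X) * chi X * (grad_chi X \<bullet> (fst X - x0))
        + 2 * tau X * (zeta X * gauss X) * (norm (grad_chi X))\<^sup>2) * e X"
    proof -
      have wt: "weight_t X = zeta' X * (chi X)\<^sup>2 * gauss X
          + weight X * (CARD('n) / (2 * tau X) - ((fst X - x0) \<bullet> (fst X - x0)) / (4 * (tau X)\<^sup>2))"
        by (rule weight_t_def)
      have wx: "weight_x X = (2 * (zeta X * gauss X) * chi X) *\<^sub>R grad_chi X - (weight X / (2 * tau X)) *\<^sub>R (fst X - x0)"
        by (simp add: weight_x_def mult_ac)
      have xi: "xi X $ i = - (weight X / 2) * (fst X - x0) $ i" for i
        unfolding xi_def by simp
      have "I2 X + I3 X = (e X * (tau X * weight_t X - weight X) - 2 * (norm (p X))\<^sup>2 * (tau X * weight X)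
          - 2 * (\<Sum>i\<in>UNIV. (p X \<bullet> q i X) * (tau X * weight_x X $ i)))
        + (e X * (\<Sum>i\<in>UNIV. - 1/2 * (weight_x X $ i * (fst X - x0) $ i + weight X))
          - 2 * (\<Sum>i\<in>UNIV. \<Sum>j\<in>UNIV. - 1/2 * (weight_x X $ i * (fst X - x0) $ j
              + (if i = j then weight X else 0)) * (q i X \<bullet> q j X))
          - 2 * (\<Sum>i\<in>UNIV. (p X \<bullet> q i X) * (- (weight X / 2) * (fst X - x0) $ i)))"
        unfolding I2_def I3_def classical_dt_theta classical_dx_theta xi classical_dx_xi theta_def
        by (simp only: refl if_True)
      then show ?thesis
        using monotonicity_integrand[OF tp z0, where q = "\<lambda>i. q i X" and p = "p X" and y = "fst X - x0"
            and g = "grad_chi X" and c = "chi X" and z' = "zeta' X * (chi X)\<^sup>2 * gauss X",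
            folded w eq, folded wt wx]
        by (simp only: mult.assoc)
    qed
    also have "\<dots> \<le> (C - c * indicator (par_cyl s (x0, t0)) X) * e X"
      using coefficient_bound[OF B, of X] X True e0[of X]
      unfolding U_def C_def c_def by (intro mult_right_mono) auto
    finally show ?thesis by (simp add: left_diff_distrib mult.assoc)
  qed
  have ePi: "set_integrable lebesgue U (\<lambda>X. indicator (par_cyl s (x0, t0)) X * e X)"
    and ePe: "(LINT X:U|lebesgue. indicator (par_cyl s (x0, t0)) X * e X) = (LINT X:par_cyl s (x0, t0)|lebesgue. e X)"
  proof -
    have "indicat_real U X *\<^sub>R (indicator (par_cyl s (x0, t0)) X * e X) = indicator (par_cyl s (x0, t0)) X *\<^sub>R e X" for X
      using sub by (auto split: split_indicator)
    moreover have "set_integrable lebesgue (par_cyl s (x0, t0)) e"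
      by (rule set_integrable_subset[OF ei _ sub]) (simp add: open_par_cyl)
    ultimately show "set_integrable lebesgue U (\<lambda>X. indicator (par_cyl s (x0, t0)) X * e X)"
      "(LINT X:U|lebesgue. indicator (par_cyl s (x0, t0)) X * e X) = (LINT X:par_cyl s (x0, t0)|lebesgue. e X)"
      by (simp_all only: set_integrable_def set_lebesgue_integral_def)
  qed
  have "0 = (LINT X:U|lebesgue. I2 X + I3 X)"
    using set_integral_add(2)[OF i2 i3] 2 3 by simp
  also have "\<dots> \<le> (LINT X:U|lebesgue. C * e X - c * (indicator (par_cyl s (x0, t0)) X * e X))"
    by (rule set_integral_mono[OF set_integral_add(1)[OF i2 i3]])
       (use le ei ePi in \<open>auto intro!: set_integral_diff set_integrable_mult_right\<close>)
  also have "\<dots> = C * (LINT X:U|lebesgue. e X) - c * (LINT X:par_cyl s (x0, t0)|lebesgue. e X)"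
    using ei ePi by (subst set_integral_diff(2)) (auto simp: ePe)
  finally show ?thesis
    unfolding C_def c_def e_def U_def by simp
qed

end

lemma scaled_energy_bound:
  obtains C :: real where "0 < C"
    "\<And>(N :: (real^'d) set) (u :: (real^'n) \<times> real \<Rightarrow> real^'d) x t s. suitable_solution N (par_cyl 4 0) u \<Longrightarrow>
       (LINT X:par_cyl 4 0|lebesgue. grad_sq (par_cyl 4 0) u X) \<le> \<Lambda> \<Longrightarrow>
       norm x < 2 \<Longrightarrow> \<bar>t\<bar> < 4 \<Longrightarrow> 0 < s \<Longrightarrow> s \<le> 1 \<Longrightarrow>
       (1 / s ^ CARD('n)) * (LINT X:par_cyl s (x, t)|lebesgue. grad_sq (par_cyl 4 0) u X) \<le> C"
proof -
  obtain B where B: "B > 0" "\<And>x. smooth_step' x \<le> B"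
    using smooth_step'_bounded by metis
  define K where "K = 14 * B + 48 * B * (4 ^ CARD('n) * fact CARD('n)) + 1792 * B\<^sup>2 * (4 ^ CARD('n) * fact CARD('n))"
  define c where "c = 2/9 * exp (- 1) * bump 0 (exp (- 1)) ^ 3 * ((1/2) ^ CARD('n) * exp (- 1/8))"
  have c: "0 < c" by (simp add: c_def bump_def)
  have K: "0 \<le> K" using B(1) by (simp add: K_def)
  \<comment> \<open>Here \<open>c\<close> no longer contains \<open>s ^ n\<close>, so the constant
    is the same for all scales and centres. The absolute value and the summand 1 make it positive
    whatever the sign of \<open>\<Lambda>\<close>.\<close>
  show ?thesis
  proof (rule that[of "K * \<bar>\<Lambda>\<bar> / c + 1"])
    show "0 < K * \<bar>\<Lambda>\<bar> / c + 1"
      using c K by (intro add_nonneg_pos divide_nonneg_pos mult_nonneg_nonneg) auto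
    fix N :: "(real^'d) set" and u :: "(real^'n) \<times> real \<Rightarrow> real^'d" and x :: "real^'n" and t s :: real
    assume u: "suitable_solution N (par_cyl 4 0) u"
      and L: "(LINT X:par_cyl 4 0|lebesgue. grad_sq (par_cyl 4 0) u X) \<le> \<Lambda>"
      and x: "norm x < 2" "\<bar>t\<bar> < 4" "0 < s" "s \<le> 1"
    interpret heat_weight x t s by unfold_locales (use x in auto)
    have "c / s ^ CARD('n) * (LINT X:par_cyl s (x, t)|lebesgue. grad_sq (par_cyl 4 0) u X)
        \<le> K * (LINT X:par_cyl 4 0|lebesgue. grad_sq (par_cyl 4 0) u X)"
      using energy_estimate[OF B(2) u] unfolding K_def c_def .
    also have "\<dots> \<le> K * \<bar>\<Lambda>\<bar>"
      using L K by (intro mult_left_mono) auto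
    finally have "c * ((1 / s ^ CARD('n)) * (LINT X:par_cyl s (x, t)|lebesgue. grad_sq (par_cyl 4 0) u X)) \<le> K * \<bar>\<Lambda>\<bar>"
      by simp
    then have "(1 / s ^ CARD('n)) * (LINT X:par_cyl s (x, t)|lebesgue. grad_sq (par_cyl 4 0) u X) \<le> K * \<bar>\<Lambda>\<bar> / c"
      using c by (simp add: pos_le_divide_eq mult.commute)
    then show "(1 / s ^ CARD('n)) * (LINT X:par_cyl s (x, t)|lebesgue. grad_sq (par_cyl 4 0) u X) \<le> K * \<bar>\<Lambda>\<bar> / c + 1"
      by linarith
  qed
qed

section \<open>The distance between measures\<close>

definition test_gap ::
    "((real^'n) \<times> real) measure \<Rightarrow> ((real^'n) \<times> real) measure \<Rightarrow> ((real^'n) \<times> real \<Rightarrow> real) \<Rightarrow> real" where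
  "test_gap \<nu> \<mu> h = \<bar>(LINT X:par_cyl 1 0|\<nu>. h X) - (LINT X:par_cyl 1 0|\<mu>. h X)\<bar>"

lemma test_gap_nonneg: "0 \<le> test_gap \<nu> \<mu> h"
  by (simp add: test_gap_def)

lemma meas_dist_eq:
  "meas_dist f \<nu> \<mu> = (\<Sum>i. (1/2) ^ i * (test_gap \<nu> \<mu> (f i) / (1 + test_gap \<nu> \<mu> (f i))))"
  by (simp add: meas_dist_def test_gap_def Let_def)

lemma meas_dist_term_bounds:
  "0 \<le> (1/2) ^ i * (test_gap \<nu> \<mu> h / (1 + test_gap \<nu> \<mu> h))"
  "(1/2) ^ i * (test_gap \<nu> \<mu> h / (1 + test_gap \<nu> \<mu> h)) \<le> (1/2) ^ i"
  using test_gap_nonneg[of \<nu> \<mu> h] mult_left_mono[of "test_gap \<nu> \<mu> h / (1 + test_gap \<nu> \<mu> h)" 1 "(1/2) ^ i"]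
  by (auto intro!: mult_nonneg_nonneg)

lemma meas_dist_summable:
  "summable (\<lambda>i. (1/2) ^ i * (test_gap \<nu> \<mu> (f i) / (1 + test_gap \<nu> \<mu> (f i))))"
proof (rule summable_comparison_test'[where g = "\<lambda>i. (1/2) ^ i" and N = 0])
  show "norm ((1/2) ^ i * (test_gap \<nu> \<mu> (f i) / (1 + test_gap \<nu> \<mu> (f i)))) \<le> (1/2) ^ i" for i
    using meas_dist_term_bounds[of i \<nu> \<mu> "f i"] by (simp only: real_norm_def abs_of_nonneg)
qed (simp add: summable_geometric_iff)

text \<open>A single term is bounded by the whole series, and \<open>a / (1 + a)\<close> is
  increasing in \<open>a\<close>.\<close>

lemma test_gap_less:
  assumes "0 < x" "meas_dist f \<nu> \<mu> < (1/2) ^ i * (x / (1 + x))"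
  shows "test_gap \<nu> \<mu> (f i) < x"
proof -
  define a where "a = test_gap \<nu> \<mu> (f i)"
  have a: "0 \<le> a" by (simp add: a_def test_gap_nonneg)
  have "(\<Sum>j\<in>{i}. (1/2) ^ j * (test_gap \<nu> \<mu> (f j) / (1 + test_gap \<nu> \<mu> (f j)))) \<le> meas_dist f \<nu> \<mu>"
    unfolding meas_dist_eq
    by (rule sum_le_suminf[OF meas_dist_summable]) (use meas_dist_term_bounds(1) in auto)
  then have "(1/2) ^ i * (a / (1 + a)) < (1/2) ^ i * (x / (1 + x))"
    using assms(2) by (simp add: a_def)
  then have "a / (1 + a) < x / (1 + x)"
    by (rule mult_left_less_imp_less) simp
  then have "a < x"
    using a assms(1) by (simp add: divide_simps algebra_simps)
  then show ?thesis by (simp add: a_def)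
qed

text \<open>The converse direction: finitely many gaps decide smallness, since every term is at most
  \<open>(1/2) ^ i\<close>. The number \<open>M\<close> and the threshold depend on
  \<open>\<epsilon>\<close> alone, neither on the measures nor on the sequence.\<close>

lemma meas_dist_less:
  assumes "0 < \<epsilon>"
  obtains M and x :: real where "0 < x"
    "\<And>f \<nu> \<mu>. (\<And>i. i < M \<Longrightarrow> test_gap \<nu> \<mu> (f i) < x) \<Longrightarrow> meas_dist f \<nu> \<mu> < \<epsilon>"
proof -
  \<comment> \<open>The tail is at most \<open>2 * (1/2) ^ M < \<epsilon> / 2\<close>, and the
    weights of the first \<open>M\<close> terms sum to at most 2.\<close>
  obtain M where M: "(1/2 :: real) ^ M < \<epsilon> / 4"
    using real_arch_pow_inv[of "\<epsilon> / 4" "1/2 :: real"] assms by auto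
  show ?thesis
  proof (rule that[of "\<epsilon> / 4" M])
    fix f and \<nu> \<mu> :: "((real^'n) \<times> real) measure"
    assume small: "\<And>i. i < M \<Longrightarrow> test_gap \<nu> \<mu> (f i) < \<epsilon> / 4"
    let ?t = "\<lambda>i. (1/2) ^ i * (test_gap \<nu> \<mu> (f i) / (1 + test_gap \<nu> \<mu> (f i)))"
    have geo: "summable (\<lambda>i. (1/2 :: real) ^ i)" "(\<Sum>i. (1/2 :: real) ^ i) = 2"
      using suminf_geometric[of "1/2 :: real"] by (auto simp: summable_geometric_iff)
    have "(\<Sum>i. ?t (i + M)) \<le> (\<Sum>i. (1/2) ^ M * (1/2) ^ i)"
    proof (rule suminf_le)
      show "?t (i + M) \<le> (1/2) ^ M * (1/2) ^ i" for i
        using meas_dist_term_bounds(2)[of "i + M" \<nu> \<mu> "f (i + M)"]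
        by (simp only: power_add mult.commute[of "(1/2) ^ i"])
      show "summable (\<lambda>i. ?t (i + M))"
        by (rule summable_ignore_initial_segment[OF meas_dist_summable])
      show "summable (\<lambda>i. (1/2 :: real) ^ M * (1/2) ^ i)"
        by (rule summable_mult[OF geo(1)])
    qed
    also have "\<dots> = (1/2) ^ M * 2"
      using geo by (simp add: suminf_mult)
    finally have tail: "(\<Sum>i. ?t (i + M)) < \<epsilon> / 2" using M by simp
    have "?t i \<le> (1/2) ^ i * (\<epsilon> / 4)" if "i < M" for i
    proof -
      have "test_gap \<nu> \<mu> (f i) / (1 + test_gap \<nu> \<mu> (f i)) \<le> test_gap \<nu> \<mu> (f i) / 1"
        using test_gap_nonneg[of \<nu> \<mu> "f i"] by (intro divide_left_mono) auto
      then have "test_gap \<nu> \<mu> (f i) / (1 + test_gap \<nu> \<mu> (f i)) \<le> \<epsilon> / 4"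
        using small[OF that] by linarith
      then show ?thesis
        by (rule mult_left_mono) simp
    qed
    then have "(\<Sum>i<M. ?t i) \<le> (\<Sum>i<M. (1/2) ^ i * (\<epsilon> / 4))"
      by (intro sum_mono) auto
    also have "\<dots> = (\<Sum>i<M. (1/2) ^ i) * (\<epsilon> / 4)"
      by (simp add: sum_distrib_right)
    also have "\<dots> \<le> 2 * (\<epsilon> / 4)"
      using sum_le_suminf[OF geo(1), of "{..<M}"] geo(2) assms by (intro mult_right_mono) auto
    finally have "(\<Sum>i<M. ?t i) \<le> \<epsilon> / 2" by simp
    with tail show "meas_dist f \<nu> \<mu> < \<epsilon>"
      unfolding meas_dist_eq using suminf_split_initial_segment[OF meas_dist_summable[of \<nu> \<mu> f], of M] by linarith
  qed (use assms in simp)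
qed

text \<open>The cylinder is the set \<open>m X < 1\<close> for a continuous \<open>m\<close> that
  attains its maximum \<open>\<rho> < 1\<close> on \<open>K\<close>. The cutoff falls linearly in
  \<open>m\<close> from \<open>\<rho>\<close> to the midpoint between \<open>\<rho>\<close> and
  1.\<close>

lemma cylinder_bump:
  fixes K :: "((real^'n) \<times> real) set"
  assumes "compact K" "K \<subseteq> par_cyl 1 0"
  obtains \<chi>' where "\<chi>' \<in> C0 (par_cyl 1 0)" "compact_support_in (par_cyl 1 0) \<chi>'"
    "\<And>X. 0 \<le> \<chi>' X" "\<And>X. \<chi>' X \<le> 1" "\<And>X. X \<in> K \<Longrightarrow> \<chi>' X = 1"
proof -
  define m where "m = (\<lambda>X :: (real^'n) \<times> real. max (norm (fst X)) \<bar>snd X\<bar>)"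
  have m: "continuous_on S m" for S
    unfolding m_def by (intro continuous_intros)
  have P: "X \<in> par_cyl 1 0 \<longleftrightarrow> m X < 1" for X
    by (auto simp: par_cyl_def m_def mem_Times_iff abs_less_iff)
  obtain \<rho> where \<rho>: "\<rho> < 1" "\<And>X. X \<in> K \<Longrightarrow> m X \<le> \<rho>"
  proof (cases "K = {}")
    case False
    obtain Z where "Z \<in> K" "\<forall>X\<in>K. m X \<le> m Z"
      using continuous_attains_sup[OF assms(1) False m] by blast
    then show ?thesis using that[of "m Z"] assms(2) P by blast
  qed (use that[of 0] in auto)
  define \<sigma> where "\<sigma> = (1 + \<rho>) / 2"
  have \<sigma>: "\<rho> < \<sigma>" "\<sigma> < 1" using \<rho>(1) by (auto simp: \<sigma>_def)
  define g where "g = (\<lambda>X. max 0 (min 1 ((\<sigma> - m X) / (\<sigma> - \<rho>))))"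
  have supp: "m X < \<sigma>" if "g X \<noteq> 0" for X
  proof (rule ccontr)
    assume "\<not> m X < \<sigma>"
    then have "(\<sigma> - m X) / (\<sigma> - \<rho>) \<le> 0" using \<sigma> by (simp add: divide_le_0_iff)
    then show False using that by (simp add: g_def)
  qed
  have "closure {X. g X \<noteq> 0} \<subseteq> cball 0 \<sigma> \<times> {-\<sigma>..\<sigma>}"
  proof (rule closure_minimal)
    show "{X. g X \<noteq> 0} \<subseteq> cball 0 \<sigma> \<times> {-\<sigma>..\<sigma>}"
      using supp by (fastforce simp: m_def mem_Times_iff)
  qed (intro closed_Times closed_cball closed_atLeastAtMost)
  moreover from this have "compact (closure {X. g X \<noteq> 0})"
    using bounded_subset[OF compact_imp_bounded[OF compact_Times[OF compact_cball compact_Icc]]]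
    by (simp add: compact_eq_bounded_closed)
  moreover have "cball 0 \<sigma> \<times> {-\<sigma>..\<sigma>} \<subseteq> (par_cyl 1 0 :: ((real^'n) \<times> real) set)"
    using \<sigma> by (auto simp: par_cyl_def)
  ultimately have 1: "compact_support_in (par_cyl 1 0) g"
    by (auto simp: compact_support_in_def)
  have "continuous_on UNIV g"
    unfolding g_def using \<sigma> by (intro continuous_intros m) auto
  then have 2: "g \<in> C0 (par_cyl 1 0)"
    using supp \<sigma> P by (force simp: C0_def)
  have 3: "g X = 1" if "X \<in> K" for X
    using \<rho>(2)[OF that] \<sigma> by (simp add: g_def)
  show ?thesis
    by (rule that[OF 2 1 _ _ 3]) (auto simp: g_def)
qed

text \<open>Formulated by bounded Borel functions because \<open>\<nu>\<close> lives on the Lebesgue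
  sets and the comparison measures on the Borel sets. The constant function 1 recovers the mass of
  the cylinder.\<close>

definition cylinder_mass_le :: "((real^'n) \<times> real) measure \<Rightarrow> real \<Rightarrow> bool" where
  "cylinder_mass_le \<nu> C \<longleftrightarrow> (\<forall>h B. h \<in> borel_measurable borel \<and> (\<forall>X. \<bar>h X\<bar> \<le> B) \<longrightarrow>
     set_integrable \<nu> (par_cyl 1 0) h \<and> \<bar>LINT X:par_cyl 1 0|\<nu>. h X\<bar> \<le> B * C)"

lemma compact_support_subset:
  fixes K :: "'a::euclidean_space set"
  assumes "K \<subseteq> U" "compact K" "\<And>X. X \<notin> K \<Longrightarrow> h X = 0"
  shows "compact_support_in U h"
proof -
  have "closure {X. h X \<noteq> 0} \<subseteq> K"
    by (rule closure_minimal) (use assms compact_imp_closed in auto)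
  then show ?thesis
    using assms(1,2) bounded_subset[OF compact_imp_bounded[OF assms(2)]]
    by (auto simp: compact_support_in_def compact_eq_bounded_closed)
qed

text \<open>The compact closed cylinder has finite measure, hence so has the open one. This gives
  integrability without any bound common to different \<open>\<mu>\<close>.\<close>

lemma radon_set_integrable:
  fixes h :: "(real^'n) \<times> real \<Rightarrow> real"
  assumes "radon_measure \<mu>" and h: "h \<in> borel_measurable borel" "\<And>X. \<bar>h X\<bar> \<le> B"
  shows "set_integrable \<mu> (par_cyl 1 0) h"
proof -
  have sets: "sets \<mu> = sets borel" using assms(1) by (simp add: radon_measure_def)
  have "emeasure \<mu> (cball 0 1 \<times> {-1..1}) < \<infinity>"
    using assms(1) compact_Times[OF compact_cball compact_Icc] unfolding radon_measure_def by blast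
  moreover have sub: "par_cyl 1 0 \<subseteq> cball (0 :: real^'n) 1 \<times> {-1..1 :: real}"
    by (auto simp: par_cyl_def)
  moreover have "cball (0 :: real^'n) 1 \<times> {-1..1 :: real} \<in> sets \<mu>"
    unfolding sets by (intro borel_closed closed_Times) auto
  ultimately have fin: "emeasure \<mu> (par_cyl 1 0) < \<infinity>"
    using emeasure_mono[of "par_cyl 1 0" "cball 0 1 \<times> {-1..1}" \<mu>] by (meson le_less_trans)
  show "set_integrable \<mu> (par_cyl 1 0) h"
    unfolding set_integrable_def
    by (rule integrableI_bounded_set_indicator[where B = B])
       (use h sets fin borel_open[OF open_par_cyl[of 1 0]] in \<open>auto cong: measurable_cong_sets simp del: split_paired_All\<close>)
qed

text \<open>A nonnegative test function that is uniformly close to 1 on \<open>K\<close> bounds the mass of \<open>K\<close>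
  under the comparison measure. This makes uniform approximation on \<open>K\<close> effective although
  the comparison measures have no common mass bound.\<close>

lemma test_gap_small_nonneg:
  fixes \<phi> :: "(real^'n) \<times> real \<Rightarrow> real"
  assumes f: "detects_vague_convergence (par_cyl 1 0) f" and f0: "dense_seq_C0 (par_cyl 1 0) f"
    and \<phi>: "\<phi> \<in> C0 (par_cyl 1 0)" "compact_support_in (par_cyl 1 0) \<phi>" "\<And>X. 0 \<le> \<phi> X"
    and C: "0 \<le> C" and \<eta>: "0 < \<eta>"
  shows "\<exists>\<delta>>0. \<forall>\<nu> \<mu>. cylinder_mass_le \<nu> C \<and> radon_measure \<mu> \<and> meas_dist f \<nu> \<mu> < \<delta> \<longrightarrow> test_gap \<nu> \<mu> \<phi> < \<eta>"
proof -
  let ?P = "par_cyl 1 0 :: ((real^'n) \<times> real) set"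
  obtain K where K: "compact K" "K \<subseteq> ?P" and
    app: "\<And>\<eta>. \<eta> > 0 \<Longrightarrow> \<exists>i. (\<forall>X. X \<notin> K \<longrightarrow> f i X = 0) \<and> (\<forall>X. 0 \<le> f i X) \<and> (\<forall>X. \<bar>f i X - \<phi> X\<bar> < \<eta>)"
    using f \<phi> unfolding detects_vague_convergence_def by metis
  obtain \<chi>' where \<chi>': "\<chi>' \<in> C0 ?P" "compact_support_in ?P \<chi>'"
    "\<And>X. 0 \<le> \<chi>' X" "\<And>X. \<chi>' X \<le> 1" "\<And>X. X \<in> K \<Longrightarrow> \<chi>' X = 1"
    using cylinder_bump[OF K] by metis
  then obtain K' where "compact K'" "K' \<subseteq> ?P" and
    app': "\<And>\<eta>. \<eta> > 0 \<Longrightarrow> \<exists>i. (\<forall>X. X \<notin> K' \<longrightarrow> f i X = 0) \<and> (\<forall>X. 0 \<le> f i X) \<and> (\<forall>X. \<bar>f i X - \<chi>' X\<bar> < \<eta>)"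
    using f unfolding detects_vague_convergence_def by metis
  \<comment> \<open>The function \<open>f i'\<close> is at least 1/2 on \<open>K\<close> and at most
    3/2 everywhere.\<close>
  obtain i' where i': "\<And>X. 0 \<le> f i' X" "\<And>X. \<bar>f i' X - \<chi>' X\<bar> < 1/2"
    using app'[of "1/2"] by auto
  \<comment> \<open>From a gap below 1 for \<open>f i'\<close> follows
    \<open>1/2 * \<mu>(K) \<le> 3/2 * C + 1\<close>.\<close>
  define C' where "C' = 3 * C + 2"
  \<comment> \<open>Replacing \<open>\<phi>\<close> by \<open>f i\<close> costs at most
    \<open>\<eta>' * (C + C')\<close> in the two integrals together, thus at most half of
    \<open>\<eta>\<close>; the other half is left for the gap of \<open>f i\<close>.\<close>
  define \<eta>' where "\<eta>' = \<eta> / (2 * (C + C' + 1))"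
  have den: "0 < C + C' + 1" using C by (simp add: C'_def)
  have \<eta>': "0 < \<eta>'" using den \<eta> by (simp add: \<eta>'_def)
  obtain i where i: "\<And>X. X \<notin> K \<Longrightarrow> f i X = 0" "\<And>X. \<bar>f i X - \<phi> X\<bar> < \<eta>'"
    using app[OF \<eta>'] by auto
  \<comment> \<open>All approximants vanish off \<open>K\<close>, so their uniform limit does, and
    the error \<open>f i - \<phi>\<close> is integrated over \<open>K\<close> alone.\<close>
  have \<phi>K: "\<phi> X = 0" if "X \<notin> K" for X
  proof (rule ccontr)
    assume "\<phi> X \<noteq> 0"
    then obtain j where "f j X = 0" "\<bar>f j X - \<phi> X\<bar> < \<bar>\<phi> X\<bar>"
      using app[of "\<bar>\<phi> X\<bar>"] \<open>X \<notin> K\<close> by (metis zero_less_abs_iff)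
    then show False by simp
  qed
  have fc: "f j \<in> borel_measurable borel" for j
    using f0 by (auto simp: dense_seq_C0_def C0_def intro!: borel_measurable_continuous_onI)
  have \<phi>m: "\<phi> \<in> borel_measurable borel"
    using \<phi>(1) by (auto simp: C0_def intro!: borel_measurable_continuous_onI)
  define \<delta> where "\<delta> = min ((1/2) ^ i' * (1 / (1 + 1))) ((1/2) ^ i * ((\<eta>/2) / (1 + \<eta>/2)))"
  have "0 < \<delta>" using \<eta> by (simp add: \<delta>_def)
  moreover have "test_gap \<nu> \<mu> \<phi> < \<eta>"
    if \<nu>: "cylinder_mass_le \<nu> C" and \<mu>: "radon_measure \<mu>" and d: "meas_dist f \<nu> \<mu> < \<delta>" for \<nu> \<mu>
  proof -
    have sets: "sets \<mu> = sets borel" using \<mu> by (simp add: radon_measure_def)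
    have gap: "test_gap \<nu> \<mu> (f i') < 1" "test_gap \<nu> \<mu> (f i) < \<eta> / 2"
      using d \<eta> test_gap_less[of 1 f \<nu> \<mu> i'] test_gap_less[of "\<eta> / 2" f \<nu> \<mu> i]
      unfolding \<delta>_def min_less_iff_conj by auto
    have f': "f i' X \<le> 3/2" for X using i'(2)[of X] \<chi>'(4)[of X] by linarith
    then have f'b: "\<bar>f i' X\<bar> \<le> 3/2" for X using i'(1)[of X] by simp
    have "\<bar>LINT X:?P|\<nu>. f i' X\<bar> \<le> 3/2 * C"
      using \<nu> fc f'b unfolding cylinder_mass_le_def by blast
    then have i'\<mu>: "(LINT X:?P|\<mu>. f i' X) \<le> 3/2 * C + 1"
      using gap(1) unfolding test_gap_def by linarith
    have KB: "K \<in> sets \<mu>" using K(1) sets by (simp add: borel_compact)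
    have finK: "emeasure \<mu> K < \<infinity>"
      using \<mu> K(1) by (auto simp: radon_measure_def)
    then have intK: "integrable \<mu> (indicat_real K)"
      using KB by (intro integrable_real_indicator) auto
    have "1/2 * measure \<mu> K = (LINT X|\<mu>. 1/2 * indicat_real K X)"
      using KB sets_eq_imp_space_eq[OF sets] by simp
    also have "\<dots> \<le> (LINT X:?P|\<mu>. f i' X)"
      unfolding set_lebesgue_integral_def
    proof (rule integral_mono)
      show "integrable \<mu> (\<lambda>X. 1/2 * indicat_real K X)" using intK by simp
      show "integrable \<mu> (\<lambda>X. indicat_real ?P X *\<^sub>R f i' X)"
        using radon_set_integrable[OF \<mu> fc f'b] by (simp add: set_integrable_def)
      show "1/2 * indicat_real K X \<le> indicat_real ?P X *\<^sub>R f i' X" for X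
      proof (cases "X \<in> K")
        case True
        then have "1/2 \<le> f i' X" using i'(2)[of X] \<chi>'(5)[of X] by linarith
        then show ?thesis using True K(2) by auto
      qed (use i'(1)[of X] in simp)
    qed
    finally have mK: "measure \<mu> K \<le> C'" using i'\<mu> by (simp add: C'_def)
    define h where "h = (\<lambda>X. f i X - \<phi> X)"
    have hm: "h \<in> borel_measurable borel" unfolding h_def using fc \<phi>m by simp
    have hb: "\<bar>h X\<bar> \<le> \<eta>'" for X using i(2)[of X] by (simp add: h_def)
    have "bounded (range \<phi>)"
    proof -
      have "compact (\<phi> ` K)"
        using \<phi>(1) K(1) by (intro compact_continuous_image) (auto simp: C0_def intro: continuous_on_subset)
      then have "bounded (insert 0 (\<phi> ` K))" by (simp add: compact_imp_bounded)
      then show ?thesis by (rule bounded_subset) (use \<phi>K in auto)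
    qed
    then obtain B where B: "\<And>X. \<bar>\<phi> X\<bar> \<le> B" by (auto simp: bounded_iff)
    have Bf: "\<bar>f i X\<bar> \<le> B + \<eta>'" for X using B[of X] i(2)[of X] by linarith
    have \<nu>int: "set_integrable \<nu> ?P (f i)" "set_integrable \<nu> ?P \<phi>"
      and \<nu>h: "\<bar>LINT X:?P|\<nu>. h X\<bar> \<le> \<eta>' * C"
      using \<nu> fc Bf \<phi>m B hm hb unfolding cylinder_mass_le_def by blast+
    have \<mu>int: "set_integrable \<mu> ?P (f i)" "set_integrable \<mu> ?P \<phi>" "set_integrable \<mu> ?P h"
      using radon_set_integrable[OF \<mu> fc Bf] radon_set_integrable[OF \<mu> \<phi>m B]
        radon_set_integrable[OF \<mu> hm hb] by auto
    have "\<bar>LINT X:?P|\<mu>. h X\<bar> \<le> (LINT X|\<mu>. \<bar>indicat_real ?P X *\<^sub>R h X\<bar>)"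
      unfolding set_lebesgue_integral_def by (rule integral_abs_bound)
    also have "\<dots> \<le> (LINT X|\<mu>. \<eta>' * indicat_real K X)"
    proof (rule integral_mono)
      show "integrable \<mu> (\<lambda>X. \<bar>indicat_real ?P X *\<^sub>R h X\<bar>)"
        using \<mu>int(3) by (intro integrable_abs) (simp add: set_integrable_def)
      show "integrable \<mu> (\<lambda>X. \<eta>' * indicat_real K X)" using intK by simp
      show "\<bar>indicat_real ?P X *\<^sub>R h X\<bar> \<le> \<eta>' * indicat_real K X" for X
        using hb[of X] K(2) i(1)[of X] \<phi>K[of X] by (auto split: split_indicator simp: h_def)
    qed
    also have "\<dots> = \<eta>' * measure \<mu> K"
      using KB sets_eq_imp_space_eq[OF sets] by simp
    also have "\<dots> \<le> \<eta>' * C'"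
      using mK \<eta>' by (intro mult_left_mono) auto
    finally have \<mu>h: "\<bar>LINT X:?P|\<mu>. h X\<bar> \<le> \<eta>' * C'" .
    have "(LINT X:?P|\<nu>. h X) = (LINT X:?P|\<nu>. f i X) - (LINT X:?P|\<nu>. \<phi> X)"
      "(LINT X:?P|\<mu>. h X) = (LINT X:?P|\<mu>. f i X) - (LINT X:?P|\<mu>. \<phi> X)"
      unfolding h_def using \<nu>int \<mu>int by (auto intro!: set_integral_diff)
    then have "test_gap \<nu> \<mu> \<phi> \<le> test_gap \<nu> \<mu> (f i) + \<eta>' * C + \<eta>' * C'"
      using \<nu>h \<mu>h unfolding test_gap_def by linarith
    moreover have "\<eta>' * C + \<eta>' * C' \<le> \<eta> / 2"
    proof -
      have "\<eta>' * C + \<eta>' * C' \<le> \<eta>' * (C + C' + 1)" using \<eta>' by (simp add: algebra_simps)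
      also have "\<dots> = \<eta> / 2" using den by (simp add: \<eta>'_def field_simps)
      finally show ?thesis .
    qed
    ultimately show ?thesis using gap(2) by linarith
  qed
  ultimately show ?thesis by blast
qed

text \<open>Detection is granted for nonnegative functions, so \<open>\<phi>\<close> is split into
  its positive and negative parts, which inherit the compact support.\<close>

lemma test_gap_small:
  fixes \<phi> :: "(real^'n) \<times> real \<Rightarrow> real"
  assumes f: "detects_vague_convergence (par_cyl 1 0) f" and f0: "dense_seq_C0 (par_cyl 1 0) f"
    and \<phi>: "\<phi> \<in> C0 (par_cyl 1 0)" and K: "compact K" "K \<subseteq> par_cyl 1 0" "\<And>X. X \<notin> K \<Longrightarrow> \<phi> X = 0"
    and C: "0 \<le> C" and \<eta>: "0 < \<eta>"
  shows "\<exists>\<delta>>0. \<forall>\<nu> \<mu>. cylinder_mass_le \<nu> C \<and> radon_measure \<mu> \<and> meas_dist f \<nu> \<mu> < \<delta> \<longrightarrow> test_gap \<nu> \<mu> \<phi> < \<eta>"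
proof -
  let ?P = "par_cyl 1 0 :: ((real^'n) \<times> real) set"
  define p where "p = (\<lambda>X. max 0 (\<phi> X))"
  define q where "q = (\<lambda>X. max 0 (- \<phi> X))"
  have pq: "p \<in> C0 ?P" "q \<in> C0 ?P"
    using \<phi> by (auto simp: C0_def p_def q_def intro!: continuous_intros)
  have supp: "compact_support_in ?P p" "compact_support_in ?P q"
    by (rule compact_support_subset[OF K(2,1)]; simp add: p_def q_def K(3))+
  have nn: "0 \<le> p X" "0 \<le> q X" for X by (simp_all add: p_def q_def)
  obtain \<delta>1 \<delta>2 where \<delta>: "\<delta>1 > 0" "\<delta>2 > 0"
    and 1: "\<And>\<nu> \<mu>. cylinder_mass_le \<nu> C \<Longrightarrow> radon_measure \<mu> \<Longrightarrow> meas_dist f \<nu> \<mu> < \<delta>1 \<Longrightarrow> test_gap \<nu> \<mu> p < \<eta> / 2"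
    and 2: "\<And>\<nu> \<mu>. cylinder_mass_le \<nu> C \<Longrightarrow> radon_measure \<mu> \<Longrightarrow> meas_dist f \<nu> \<mu> < \<delta>2 \<Longrightarrow> test_gap \<nu> \<mu> q < \<eta> / 2"
    using test_gap_small_nonneg[OF f f0 pq(1) supp(1) nn(1) C, of "\<eta> / 2"]
      test_gap_small_nonneg[OF f f0 pq(2) supp(2) nn(2) C, of "\<eta> / 2"] \<eta> by (metis half_gt_zero)
  have "test_gap \<nu> \<mu> \<phi> < \<eta>"
    if \<nu>: "cylinder_mass_le \<nu> C" and \<mu>: "radon_measure \<mu>" and d: "meas_dist f \<nu> \<mu> < min \<delta>1 \<delta>2" for \<nu> \<mu>
  proof -
    have m: "p \<in> borel_measurable borel" "q \<in> borel_measurable borel"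
      using pq by (auto simp: C0_def intro!: borel_measurable_continuous_onI)
    have "compact (\<phi> ` K)"
      using \<phi> K(1) by (intro compact_continuous_image) (auto simp: C0_def intro: continuous_on_subset)
    then have "bounded (insert 0 (\<phi> ` K))" by (simp add: compact_imp_bounded)
    then have "bounded (range \<phi>)" by (rule bounded_subset) (use K(3) in auto)
    then obtain B where B: "\<And>X. \<bar>\<phi> X\<bar> \<le> B" by (auto simp: bounded_iff)
    have b: "\<bar>p X\<bar> \<le> B" "\<bar>q X\<bar> \<le> B" for X
      using B[of X] by (auto simp: p_def q_def max_def)
    have i\<nu>: "set_integrable \<nu> ?P p" "set_integrable \<nu> ?P q"
      using \<nu> m b unfolding cylinder_mass_le_def by blast+
    have i\<mu>: "set_integrable \<mu> ?P p" "set_integrable \<mu> ?P q"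
      using radon_set_integrable[OF \<mu>] m b by blast+
    have "\<phi> = (\<lambda>X. p X - q X)" by (auto simp: p_def q_def max_def)
    then have "(LINT X:?P|\<nu>. \<phi> X) = (LINT X:?P|\<nu>. p X) - (LINT X:?P|\<nu>. q X)"
      "(LINT X:?P|\<mu>. \<phi> X) = (LINT X:?P|\<mu>. p X) - (LINT X:?P|\<mu>. q X)"
      using i\<nu> i\<mu> by (auto intro!: set_integral_diff)
    then show ?thesis
      using 1[OF \<nu> \<mu>] 2[OF \<nu> \<mu>] d unfolding test_gap_def by linarith
  qed
  then show ?thesis
    using \<delta> by (intro exI[of _ "min \<delta>1 \<delta>2"]) auto
qed

section \<open>Comparing consecutive dyadic scales\<close>

lemma C0_continuous: "h \<in> C0 U \<Longrightarrow> continuous_on UNIV h"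
  and C0_eq_0: "h \<in> C0 U \<Longrightarrow> X \<notin> U \<Longrightarrow> h X = 0"
  by (simp_all add: C0_def del: split_paired_All)

lemma C0_borel: "h \<in> C0 U \<Longrightarrow> h \<in> borel_measurable borel"
  by (rule borel_measurable_continuous_onI[OF C0_continuous])

lemma par_map_0_vimage:
  assumes "s > 0"
  shows "par_map 0 s -` S = par_map 0 (1/s) ` S"
proof -
  have "par_map 0 s (par_map 0 (1/s) Y) = Y" "par_map 0 (1/s) (par_map 0 s Y) = Y" for Y
    using assms by (simp_all add: par_map_def power_one_over)
  note inv = this
  show ?thesis
  proof (intro equalityI subsetI)
    fix Y assume "Y \<in> par_map 0 s -` S"
    then have "par_map 0 (1/s) (par_map 0 s Y) \<in> par_map 0 (1/s) ` S" by (intro imageI) (rule vimageD)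
    then show "Y \<in> par_map 0 (1/s) ` S" unfolding inv(2) .
  next
    fix Y assume "Y \<in> par_map 0 (1/s) ` S"
    then obtain Z where "Z \<in> S" "Y = par_map 0 (1/s) Z" by (rule imageE)
    then show "Y \<in> par_map 0 s -` S" by (simp only: vimage_eq inv(1))
  qed
qed

lemma par_map_0_commute: "par_map 0 r (par_map 0 s Y) = par_map 0 s (par_map 0 r Y)"
  by (simp add: par_map_def scaleR_left_commute mult.left_commute)

lemma par_map_borel: "par_map X s \<in> borel_measurable borel"
  by (rule borel_measurable_continuous_onI[OF continuous_on_par_map])

lemma par_map_image_borel: "s > 0 \<Longrightarrow> S \<in> sets borel \<Longrightarrow> par_map 0 s ` S \<in> sets borel"
  using measurable_sets_borel[OF par_map_borel, of S 0 "1/s"] par_map_0_vimage[of "1/s" S]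
  by (simp only: zero_less_divide_1_iff divide_divide_eq_right mult_1 div_by_1)

text \<open>The measure \<open>T\<^bsub>0,1/2\<^esub> \<mu>\<close>.\<close>

definition half_scale :: "((real^'n) \<times> real) measure \<Rightarrow> ((real^'n) \<times> real) measure" where
  "half_scale \<mu> = density (distr \<mu> borel (par_map 0 2)) (\<lambda>_. ennreal (2 ^ CARD('n)))"

lemma sets_half_scale: "sets (half_scale \<mu>) = sets borel"
  by (simp add: half_scale_def)

lemma emeasure_half_scale:
  fixes \<mu> :: "((real^'n) \<times> real) measure"
  assumes "sets \<mu> = sets borel" "S \<in> sets borel"
  shows "emeasure (half_scale \<mu>) S = ennreal (2 ^ CARD('n)) * emeasure \<mu> (par_map 0 2 -` S)"
proof -
  have "par_map 0 2 \<in> \<mu> \<rightarrow>\<^sub>M borel"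
    using par_map_borel assms(1) by (simp cong: measurable_cong_sets)
  moreover have "space \<mu> = UNIV" using sets_eq_imp_space_eq[OF assms(1)] by simp
  ultimately show ?thesis
    using assms(2) by (simp add: half_scale_def emeasure_density_const emeasure_distr)
qed

lemma radon_half_scale:
  fixes \<mu> :: "((real^'n) \<times> real) measure"
  assumes "radon_measure \<mu>"
  shows "radon_measure (half_scale \<mu>)"
  unfolding radon_measure_def
proof (intro conjI allI impI sets_half_scale)
  have sets: "sets \<mu> = sets borel" using assms by (simp add: radon_measure_def)
  fix K :: "((real^'n) \<times> real) set" assume K: "compact K"
  have "compact (par_map 0 (1/2) ` K)"
    by (rule compact_continuous_image[OF continuous_on_par_map K])
  then have "emeasure \<mu> (par_map 0 2 -` K) < \<infinity>"
    using assms by (simp add: radon_measure_def par_map_0_vimage)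
  then show "emeasure (half_scale \<mu>) K < \<infinity>"
    using K sets by (simp add: emeasure_half_scale borel_compact ennreal_mult_less_top)
qed

text \<open>Dilations about the origin commute and preserve negative times, which keeps backward
  self-similarity. A translation by \<open>v\<close> turns into one by \<open>v / 2\<close>, which
  stays in the subspace, so the same \<open>V\<close> works.\<close>

lemma symmetric_half_scale:
  fixes \<mu> :: "((real^'n) \<times> real) measure"
  assumes sets: "sets \<mu> = sets borel" and sym: "spatially_symmetric k \<mu>"
  shows "spatially_symmetric k (half_scale \<mu>)"
proof -
  let ?h = "par_map (0 :: (real^'n) \<times> real) 2"
  have vb: "?h -` S \<in> sets borel" if "S \<in> sets borel" for S
    using measurable_sets_borel[OF par_map_borel that] .
  have past: "?h -` S \<subseteq> past" if "S \<subseteq> past" for S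
  proof
    fix X assume "X \<in> ?h -` S"
    then have "par_map 0 2 X \<in> past" using that by auto
    then show "X \<in> past" by (cases X) (simp add: past_def par_map_def)
  qed
  have ss: "backward_self_similar \<mu>" using sym by (simp add: spatially_symmetric_def)
  have "backward_self_similar (half_scale \<mu>)"
    unfolding backward_self_similar_def
  proof (intro allI impI ballI)
    fix l :: real and S assume l: "0 < l" and S: "S \<in> sets borel" "S \<subseteq> (past :: ((real^'n) \<times> real) set)"
    have eq: "?h -` (par_map 0 l ` S) = par_map 0 l ` (?h -` S)"
      by (simp add: par_map_0_vimage image_image par_map_0_commute[of "1/2" l])
    have "T_measure 0 l (half_scale \<mu>) S
        = ennreal (2 ^ CARD('n)) * T_measure 0 l \<mu> (?h -` S)"
      unfolding T_measure_def emeasure_half_scale[OF sets par_map_image_borel[OF l S(1)]] eq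
      by (simp add: mult.left_commute)
    also have "T_measure 0 l \<mu> (?h -` S) = emeasure \<mu> (?h -` S)"
      using ss l vb[OF S(1)] past[OF S(2)] by (simp add: backward_self_similar_def)
    finally show "T_measure 0 l (half_scale \<mu>) S = emeasure (half_scale \<mu>) S"
      by (simp add: emeasure_half_scale[OF sets S(1)])
  qed
  moreover obtain V where V: "subspace V" "k \<le> dim V" "backward_invariant \<mu> V"
    using sym by (auto simp: spatially_symmetric_def)
  have "backward_invariant (half_scale \<mu>) V"
    unfolding backward_invariant_def
  proof (intro ballI impI)
    fix v S assume v: "v \<in> V" and S: "S \<in> sets borel" "S \<subseteq> (past :: ((real^'n) \<times> real) set)"
    have tb: "(\<lambda>X. (v, 0) + X) ` S \<in> sets borel"
    proof -
      have "(\<lambda>X. (v, 0) + X) ` S = (\<lambda>X. X - (v, 0)) -` S"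
        by (force simp: image_iff)
      moreover have "(\<lambda>X. X - (v, 0 :: real)) \<in> borel_measurable borel"
        by simp
      ultimately show ?thesis using measurable_sets_borel[OF _ S(1)] by metis
    qed
    have eq: "?h -` ((\<lambda>X. (v, 0) + X) ` S) = (\<lambda>X. ((1/2) *\<^sub>R v, 0) + X) ` (?h -` S)"
      by (force simp: par_map_0_vimage image_image par_map_def scaleR_add_right)
    have "(1/2) *\<^sub>R v \<in> V" using v V(1) by (rule subspace_scale[rotated])
    then have "emeasure \<mu> ((\<lambda>X. ((1/2) *\<^sub>R v, 0) + X) ` (?h -` S)) = emeasure \<mu> (?h -` S)"
      using V(3) vb[OF S(1)] past[OF S(2)] unfolding backward_invariant_def by blast
    then show "emeasure (half_scale \<mu>) ((\<lambda>X. (v, 0) + X) ` S) = emeasure (half_scale \<mu>) S"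
      unfolding emeasure_half_scale[OF sets tb] emeasure_half_scale[OF sets S(1)] eq by simp
  qed
  ultimately show ?thesis
    using V by (auto simp: spatially_symmetric_def)
qed

lemma par_map_2_cyl: "par_map 0 2 Y \<in> par_cyl 1 0 \<Longrightarrow> Y \<in> par_cyl (1/2) 0"
proof -
  assume "par_map 0 2 Y \<in> par_cyl 1 0"
  then have "2 * norm (fst Y) < 1" "- 1 < 4 * snd Y" "4 * snd Y < 1"
    by (simp_all add: par_map_def par_cyl_def)
  then show ?thesis
    by (simp add: par_cyl_def mem_Times_iff power2_eq_square)
qed

lemma par_cyl_half_subset:
  assumes "0 \<le> s"
  shows "par_cyl (s/2) X \<subseteq> par_cyl s X"
proof
  fix Y assume Y: "Y \<in> par_cyl (s/2) X"
  have "(s/2)\<^sup>2 \<le> s\<^sup>2" using assms by (intro power_mono) auto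
  moreover have "dist (fst X) (fst Y) < s/2" "snd X - (s/2)\<^sup>2 < snd Y" "snd Y < snd X + (s/2)\<^sup>2"
    using Y by (simp_all add: par_cyl_def mem_Times_iff)
  ultimately have "dist (fst X) (fst Y) < s" "snd X - s\<^sup>2 < snd Y" "snd Y < snd X + s\<^sup>2"
    using assms by linarith+
  then show "Y \<in> par_cyl s X"
    by (simp add: par_cyl_def mem_Times_iff)
qed

lemma integral_half_scale:
  fixes \<mu> :: "((real^'n) \<times> real) measure"
  assumes sets: "sets \<mu> = sets borel" and h: "h \<in> C0 (par_cyl 1 0)"
  shows "(LINT X:par_cyl 1 0|half_scale \<mu>. h X) = 2 ^ CARD('n) * (LINT X:par_cyl 1 0|\<mu>. h (par_map 0 2 X))"
proof -
  have hm: "h \<in> borel_measurable borel"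
    by (rule C0_borel[OF h])
  have pm: "par_map 0 2 \<in> \<mu> \<rightarrow>\<^sub>M borel"
    using par_map_borel sets by (simp cong: measurable_cong_sets)
  have ind: "indicat_real (par_cyl 1 0) X *\<^sub>R h X = h X" for X
    using C0_eq_0[OF h, of X] by (auto split: split_indicator)
  have ind2: "indicat_real (par_cyl 1 0) X *\<^sub>R h (par_map 0 2 X) = h (par_map 0 2 X)" for X
    using C0_eq_0[OF h, of "par_map 0 2 X"] par_map_2_cyl[of X] par_cyl_half_subset[of 1 "0 :: (real^'n) \<times> real"]
    by (auto split: split_indicator)
  have "(LINT X:par_cyl 1 0|half_scale \<mu>. h X) = integral\<^sup>L (half_scale \<mu>) h"
    unfolding set_lebesgue_integral_def ind ..
  also have "\<dots> = integral\<^sup>L (distr \<mu> borel (par_map 0 2)) (\<lambda>X. 2 ^ CARD('n) *\<^sub>R h X)"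
    unfolding half_scale_def using hm by (intro integral_density) auto
  also have "\<dots> = 2 ^ CARD('n) * (LINT X|\<mu>. h (par_map 0 2 X))"
    using hm by (simp add: integral_distr[OF pm])
  finally show ?thesis
    unfolding set_lebesgue_integral_def ind2 .
qed

text \<open>Both sides are written in the original coordinates, where halving the scale composes the
  rescaled coordinates with \<open>par_map 0 2\<close>. The factor is the quotient of
  \<open>(s/2) ^ (-n)\<close> and \<open>s ^ (-n)\<close>; enlarging the domain of integration is
  harmless because \<open>h\<close> vanishes off the unit cylinder.\<close>

lemma energy_half_scale:
  fixes X :: "(real^'n) \<times> real" and u :: "(real^'n) \<times> real \<Rightarrow> real^'d"
  assumes s: "s > 0" and U: "open U" and u: "finite_energy U u" and sub: "par_cyl s X \<subseteq> U"
    and h: "h \<in> C0 (par_cyl 1 0)" and B: "\<And>Y. \<bar>h Y\<bar> \<le> B"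
  shows "(LINT Y:par_cyl 1 0|energy_measure (par_map X (s/2) -` U) (T_map X (s/2) u). h Y)
    = 2 ^ CARD('n) * (LINT Y:par_cyl 1 0|energy_measure (par_map X s -` U) (T_map X s u). h (par_map 0 2 Y))"
proof -
  have hm: "h \<in> borel_measurable borel"
    by (rule C0_borel[OF h])
  have hm2: "(\<lambda>Y. h (par_map 0 2 Y)) \<in> borel_measurable borel"
    by (rule measurable_compose[OF par_map_borel hm])
  have s2: "0 < s / 2" using s by simp
  define q where "q = par_map (- fst X /\<^sub>R s, - snd X / s\<^sup>2) (1/s)"
  define q2 where "q2 = par_map (- fst X /\<^sub>R (s/2), - snd X / (s/2)\<^sup>2) (1/(s/2))"
  have q2: "q2 Z = par_map 0 2 (q Z)" for Z
    using s by (simp add: q2_def q_def par_map_def scaleR_right_distrib power_divide field_simps)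
  have sub2: "par_cyl (s/2) X \<subseteq> par_cyl s X" using par_cyl_half_subset[of s X] s by simp
  have vanish: "h (q2 Z) = 0" if "Z \<notin> par_cyl (s/2) X" for Z
  proof -
    have "q2 Z \<notin> par_cyl 1 0"
      using that unfolding par_cyl_eq_vimage[OF s2, of X, symmetric] q2_def
      by (simp only: vimage_eq par_map_inverse(1)[OF s2] not_False_eq_True)
    then show ?thesis by (rule C0_eq_0[OF h])
  qed
  have "(LINT Z:par_cyl (s/2) X|lebesgue. 1/2 * (h (q2 Z) * grad_sq U u Z))
      = (LINT Z:par_cyl s X|lebesgue. 1/2 * (h (par_map 0 2 (q Z)) * grad_sq U u Z))"
    unfolding set_lebesgue_integral_def q2[symmetric]
    by (intro Bochner_Integration.integral_cong refl)
       (use sub2 vanish in \<open>auto split: split_indicator\<close>)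
  then show ?thesis
    using energy_measure_integral(2)[OF s2 U u order_trans[OF sub2 sub] hm B]
      energy_measure_integral(2)[OF s U u sub hm2 B] s
    unfolding q_def q2_def by (simp add: power_divide)
qed

lemma finite_energy_H_class:
  "u \<in> H_class \<Lambda> U N \<Longrightarrow> finite_energy U u"
  unfolding H_class_def suitable_solution_def finite_energy_def by blast

text \<open>Symmetry passes from a scale to its half because test functions of the smaller cylinder
  are visible on the larger one. The constant is fixed before the map, the order of symmetry, the
  scale and the point.\<close>

lemma eps_symmetric_half_scale:
  fixes f :: "nat \<Rightarrow> (real^'n) \<times> real \<Rightarrow> real"
  assumes f0: "dense_seq_C0 (par_cyl 1 0) f" and f: "detects_vague_convergence (par_cyl 1 0) f"
    and \<epsilon>: "\<epsilon> > 0"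
  obtains \<delta> where "\<delta> > 0"
    "\<And>(N :: (real^'d) set) (u :: (real^'n) \<times> real \<Rightarrow> real^'d) k s x t.
       u \<in> H_class \<Lambda> (par_cyl 4 0) N \<Longrightarrow> norm x < 2 \<Longrightarrow> \<bar>t\<bar> < 4 \<Longrightarrow> 0 < s \<Longrightarrow> s \<le> 1 \<Longrightarrow>
       spatially_eps_symmetric f (par_cyl 4 0) u k \<delta> s x t \<Longrightarrow>
       spatially_eps_symmetric f (par_cyl 4 0) u k \<epsilon> (s/2) x t"
proof -
  let ?U = "par_cyl 4 0 :: ((real^'n) \<times> real) set"
  obtain C :: real where C: "0 < C"
    "\<And>(N :: (real^'d) set) (u :: (real^'n) \<times> real \<Rightarrow> real^'d) x t s. suitable_solution N ?U u \<Longrightarrow>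
       (LINT X:?U|lebesgue. grad_sq ?U u X) \<le> \<Lambda> \<Longrightarrow> norm x < 2 \<Longrightarrow> \<bar>t\<bar> < 4 \<Longrightarrow> 0 < s \<Longrightarrow> s \<le> 1 \<Longrightarrow>
       (1 / s ^ CARD('n)) * (LINT X:par_cyl s (x, t)|lebesgue. grad_sq ?U u X) \<le> C"
    using scaled_energy_bound[where ?'n = 'n and ?'d = 'd and \<Lambda> = \<Lambda>] by blast
  obtain M and \<eta> :: real where \<eta>: "0 < \<eta>" and
    close: "\<And>f \<nu> (\<mu> :: ((real^'n) \<times> real) measure). (\<And>i. i < M \<Longrightarrow> test_gap \<nu> \<mu> (f i) < \<eta>) \<Longrightarrow> meas_dist f \<nu> \<mu> < \<epsilon>"
    using meas_dist_less[OF \<epsilon>] by metis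
  have fC: "f i \<in> C0 (par_cyl 1 0)" for i using f0 by (auto simp: dense_seq_C0_def)
  define \<phi> where "\<phi> = (\<lambda>i Y. f i (par_map 0 2 Y))"
  \<comment> \<open>\<open>\<phi> i\<close> is nonzero only where \<open>2 * norm y < 1\<close> and
    \<open>4 * \<bar>\<sigma>\<bar> < 1\<close>. So its support is compact inside the unit cylinder,
    although \<open>f i\<close> may be nonzero arbitrarily close to the boundary.\<close>
  let ?K = "cball (0 :: real^'n) (1/2) \<times> {-(1/4)..1/4 :: real}"
  have KP: "?K \<subseteq> par_cyl 1 0" by (auto simp: par_cyl_def)
  have \<phi>K: "\<phi> i Y = 0" if "Y \<notin> ?K" for i Y
  proof -
    have "Y \<notin> par_cyl (1/2) 0" using that by (cases Y) (auto simp: par_cyl_def power2_eq_square)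
    then show ?thesis
      unfolding \<phi>_def using par_map_2_cyl[of Y] by (intro C0_eq_0[OF fC]) blast
  qed
  have \<phi>C: "\<phi> i \<in> C0 (par_cyl 1 0)" for i
  proof -
    have "continuous_on UNIV (\<phi> i)"
      unfolding \<phi>_def
      by (rule continuous_on_compose2[OF C0_continuous[OF fC] continuous_on_par_map]) simp
    moreover have "\<phi> i Y = 0" if "Y \<notin> par_cyl 1 0" for Y
      using that KP by (intro \<phi>K) blast
    ultimately show ?thesis by (simp add: C0_def del: split_paired_All)
  qed
  \<comment> \<open>The smaller threshold makes up for the factor \<open>2 ^ CARD('n)\<close> gained
    in passing to half the scale.\<close>
  have "\<exists>\<delta>>0. \<forall>\<nu> \<mu>. cylinder_mass_le \<nu> C \<and> radon_measure \<mu> \<and> meas_dist f \<nu> \<mu> < \<delta>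
      \<longrightarrow> test_gap \<nu> \<mu> (\<phi> i) < \<eta> / 2 ^ CARD('n)" for i
    by (rule test_gap_small[OF f f0 \<phi>C compact_Times[OF compact_cball compact_Icc] KP \<phi>K])
       (use C(1) \<eta> in auto)
  then obtain d where d: "\<And>i. d i > 0" and gap: "\<And>i \<nu> \<mu>. cylinder_mass_le \<nu> C \<Longrightarrow> radon_measure \<mu>
      \<Longrightarrow> meas_dist f \<nu> \<mu> < d i \<Longrightarrow> test_gap \<nu> \<mu> (\<phi> i) < \<eta> / 2 ^ CARD('n)"
    by metis
  \<comment> \<open>Inserting 1 keeps the minimum defined when \<open>M\<close> is 0.\<close>
  define \<delta> where "\<delta> = Min (insert 1 (d ` {..<M}))"
  have "\<delta> > 0" using d by (simp add: \<delta>_def)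
  moreover have "spatially_eps_symmetric f ?U u k \<epsilon> (s/2) x t"
    if u: "u \<in> H_class \<Lambda> ?U N" and x: "norm x < 2" "\<bar>t\<bar> < 4" and s: "0 < s" "s \<le> 1"
      and sym: "spatially_eps_symmetric f ?U u k \<delta> s x t"
    for N :: "(real^'d) set" and u :: "(real^'n) \<times> real \<Rightarrow> real^'d" and k s x t
  proof -
    have fe: "finite_energy ?U u" by (rule finite_energy_H_class[OF u])
    have U: "open ?U" by (rule open_par_cyl)
    from sym obtain \<mu> where sub: "par_cyl s (x, t) \<subseteq> ?U" and \<mu>: "radon_measure \<mu>" "spatially_symmetric k \<mu>"
      and dist: "meas_dist f (energy_measure (par_map (x, t) s -` ?U) (T_map (x, t) s u)) \<mu> < \<delta>"
      by (auto simp: spatially_eps_symmetric_def)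
    have sets: "sets \<mu> = sets borel" using \<mu>(1) by (simp add: radon_measure_def)
    let ?\<nu> = "energy_measure (par_map (x, t) s -` ?U) (T_map (x, t) s u)"
    let ?\<nu>2 = "energy_measure (par_map (x, t) (s/2) -` ?U) (T_map (x, t) (s/2) u)"
    have E: "(1 / s ^ CARD('n)) * (LINT X:par_cyl s (x, t)|lebesgue. grad_sq ?U u X) \<le> C"
      using u x s by (intro C(2)[of N]) (auto simp: H_class_def)
    have mass: "cylinder_mass_le ?\<nu> C"
      unfolding cylinder_mass_le_def
    proof (intro allI impI)
      fix h :: "(real^'n) \<times> real \<Rightarrow> real" and B
      assume h: "h \<in> borel_measurable borel \<and> (\<forall>X. \<bar>h X\<bar> \<le> B)"
      then have "0 \<le> B" by (meson abs_ge_zero order_trans)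
      then have "B * ((1 / s ^ CARD('n)) * (LINT X:par_cyl s (x, t)|lebesgue. grad_sq ?U u X)) \<le> B * C"
        by (rule mult_left_mono[OF E])
      then show "set_integrable ?\<nu> (par_cyl 1 0) h \<and> \<bar>LINT X:par_cyl 1 0|?\<nu>. h X\<bar> \<le> B * C"
        using energy_measure_integral(1,3)[OF s(1) U fe sub, of h B] h by auto
    qed
    have "meas_dist f ?\<nu>2 (half_scale \<mu>) < \<epsilon>"
    proof (rule close)
      fix i assume i: "i < M"
      then have "\<delta> \<le> d i" by (simp add: \<delta>_def)
      then have g: "test_gap ?\<nu> \<mu> (\<phi> i) < \<eta> / 2 ^ CARD('n)"
        using gap[OF mass \<mu>(1), of i] dist by linarith
      obtain B where B: "\<And>Y. \<bar>f i Y\<bar> \<le> B"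
      proof -
        let ?L = "cball (0 :: real^'n) 1 \<times> {-1..1 :: real}"
        have "compact (f i ` ?L)"
          by (intro compact_continuous_image compact_Times compact_cball compact_Icc
              continuous_on_subset[OF C0_continuous[OF fC]] subset_UNIV)
        then have "bounded (insert 0 (f i ` ?L))" by (simp add: compact_imp_bounded)
        moreover have "range (f i) \<subseteq> insert 0 (f i ` ?L)"
        proof
          fix y assume "y \<in> range (f i)"
          then obtain Y where Y: "y = f i Y" by auto
          show "y \<in> insert 0 (f i ` ?L)"
          proof (cases "Y \<in> par_cyl 1 0")
            case True
            then have "Y \<in> ?L" by (auto simp: par_cyl_def)
            then show ?thesis using Y by blast
          next
            case False
            then show ?thesis using Y C0_eq_0[OF fC, of Y i] by simp
          qed
        qed
        ultimately have "bounded (range (f i))" by (rule bounded_subset)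
        then show ?thesis using that by (auto simp: bounded_iff)
      qed
      have "test_gap ?\<nu>2 (half_scale \<mu>) (f i) = 2 ^ CARD('n) * test_gap ?\<nu> \<mu> (\<phi> i)"
        unfolding test_gap_def energy_half_scale[OF s(1) U fe sub fC B] integral_half_scale[OF sets fC]
        by (simp add: \<phi>_def abs_mult right_diff_distrib[symmetric])
      also have "\<dots> < \<eta>"
        using g by (simp add: field_simps)
      finally show "test_gap ?\<nu>2 (half_scale \<mu>) (f i) < \<eta>" .
    qed
    then show ?thesis
      unfolding spatially_eps_symmetric_def
      using radon_half_scale[OF \<mu>(1)] symmetric_half_scale[OF sets \<mu>(2)]
        par_cyl_half_subset[of s "(x, t)"] sub s by auto
  qed
  ultimately show ?thesis using that by blast
qed

section \<open>Comparison of the strata\<close>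

lemma eps_symmetric_mono:
  assumes "spatially_eps_symmetric f U u k a s x t" and ab: "a \<le> b"
  shows "spatially_eps_symmetric f U u k b s x t"
proof -
  from assms(1) obtain \<mu> where "par_cyl s (x, t) \<subseteq> U" "radon_measure \<mu>" "spatially_symmetric k \<mu>"
    "meas_dist f (energy_measure (par_map (x, t) s -` U) (T_map (x, t) s u)) \<mu> < a"
    unfolding spatially_eps_symmetric_def by (elim conjE exE)
  then show ?thesis
    unfolding spatially_eps_symmetric_def using less_le_trans[OF _ ab] by (intro conjI exI[of _ \<mu>])
qed

lemma strat_pos_mono:
  "R \<le> R' \<Longrightarrow> strat_pos f k \<delta> r R' u t \<subseteq> strat_pos f k \<delta> r R u t"
  by (auto simp: strat_pos_def)

theorem lemma3p8:
  fixes N :: "(real^'d) set" and m :: nat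
    and f :: "nat \<Rightarrow> (real^'n) \<times> real \<Rightarrow> real"
    and \<Lambda> \<epsilon> :: real
  assumes "CARD('n) \<ge> 2" and "CARD('d) \<ge> 2"
    and "compact N" and "smooth_submanifold m N"
    and "dense_seq_C0 (par_cyl 1 0) f"
    and "detects_vague_convergence (par_cyl 1 0) f"
    and "\<Lambda> > 0" and "\<epsilon> > 0"
  shows "\<exists>\<delta>>0. \<forall>(k::nat) (R::real) (t::real) (u :: (real^'n) \<times> real \<Rightarrow> real^'d) (r::real).
           k \<le> CARD('n) \<and> 0 < R \<and> R \<le> 1/2 \<and> -4 < t \<and> t < 4 \<and>
           u \<in> H_class \<Lambda> (par_cyl 4 0) N \<and> 0 \<le> r \<and> r < R/2 \<longrightarrow>
             strat f k \<epsilon> r R u t \<subseteq> strat f k \<delta> r (2*R) u t \<and>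
             strat f k \<delta> r (2*R) u t \<subseteq> strat f k \<delta> r R u t"
proof -
  let ?U = "par_cyl 4 0 :: ((real^'n) \<times> real) set"
  obtain \<delta>0 where \<delta>0: "\<delta>0 > 0" and
    half: "\<And>(N :: (real^'d) set) (u :: (real^'n) \<times> real \<Rightarrow> real^'d) k s x t.
       u \<in> H_class \<Lambda> ?U N \<Longrightarrow> norm x < 2 \<Longrightarrow> \<bar>t\<bar> < 4 \<Longrightarrow> 0 < s \<Longrightarrow> s \<le> 1 \<Longrightarrow>
       spatially_eps_symmetric f ?U u k \<delta>0 s x t \<Longrightarrow> spatially_eps_symmetric f ?U u k \<epsilon> (s/2) x t"
    using eps_symmetric_half_scale[OF assms(5,6,8), where \<Lambda> = \<Lambda> and ?'d = 'd] by blast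
  \<comment> \<open>The bound by \<open>\<epsilon>\<close> serves scales up to \<open>R\<close>, the
    bound by \<open>\<delta>0\<close> those between \<open>R\<close> and
    \<open>2 * R\<close>.\<close>
  define \<delta> where "\<delta> = min \<delta>0 \<epsilon>"
  have \<delta>: "\<delta> > 0" "\<delta> \<le> \<delta>0" "\<delta> \<le> \<epsilon>" using \<delta>0 assms(8) by (auto simp: \<delta>_def)
  \<comment> \<open>The two lower radii are decoupled for the case \<open>r = 0\<close>, where the
    strata are intersections over positive radii.\<close>
  have pos: "strat_pos f k \<epsilon> r' R u t \<subseteq> strat_pos f k \<delta> r (2*R) u t"
    if u: "u \<in> H_class \<Lambda> ?U N" and R: "0 < R" "R \<le> 1/2" and t: "-4 < t" "t < 4"
      and r: "0 < r" "r' \<le> r" "r' \<le> R/2"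
    for k R t r r' and u :: "(real^'n) \<times> real \<Rightarrow> real^'d"
  proof
    fix x assume x: "x \<in> strat_pos f k \<epsilon> r' R u t"
    have "\<not> spatially_eps_symmetric f ?U u (k + 1) \<delta> s x t" if s: "s \<in> {r..2*R}" for s
    proof
      assume sym: "spatially_eps_symmetric f ?U u (k + 1) \<delta> s x t"
      show False
      proof (cases "s \<le> R")
        case True
        then show False
          using x s r eps_symmetric_mono[OF sym \<delta>(3)] by (auto simp: strat_pos_def)
      next
        case False
        \<comment> \<open>Here \<open>s \<le> 2 * R \<le> 1\<close>, so halving applies, and
          \<open>s/2\<close> lies between \<open>R/2\<close> and \<open>R\<close>, hence in the
          range of scales excluded for \<open>x\<close>.\<close>
        have "spatially_eps_symmetric f ?U u (k + 1) \<epsilon> (s/2) x t"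
          using x s r R t by (intro half[OF u _ _ _ _ eps_symmetric_mono[OF sym \<delta>(2)]]) (auto simp: strat_pos_def)
        then show False
          using x s r False by (auto simp: strat_pos_def)
      qed
    qed
    then show "x \<in> strat_pos f k \<delta> r (2*R) u t"
      using x by (simp add: strat_pos_def)
  qed
  show ?thesis
  proof (intro exI[of _ \<delta>] conjI allI impI \<delta>(1); elim conjE)
    fix k :: nat and R t :: real and u :: "(real^'n) \<times> real \<Rightarrow> real^'d" and r :: real
    assume h: "0 < R" "R \<le> 1/2" "-4 < t" "t < 4" "u \<in> H_class \<Lambda> ?U N" "0 \<le> r" "r < R/2"
    show "strat f k \<epsilon> r R u t \<subseteq> strat f k \<delta> r (2*R) u t"
    proof (cases "r = 0")
      case True
      have "(\<Inter>\<rho>\<in>{0<..<R}. strat_pos f k \<epsilon> \<rho> R u t) \<subseteq> (\<Inter>\<rho>\<in>{0<..<2*R}. strat_pos f k \<delta> \<rho> (2*R) u t)"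
      proof (rule INF_mono)
        \<comment> \<open>The radius \<open>\<rho>\<close> may exceed \<open>R\<close>; the minimum
          provides an index below both \<open>\<rho>\<close> and \<open>R\<close>, and at most
          \<open>R/2\<close> as \<open>pos\<close> demands.\<close>
        fix \<rho> assume \<rho>: "\<rho> \<in> {0<..<2*R}"
        then have "strat_pos f k \<epsilon> (min (\<rho>/2) (R/2)) R u t \<subseteq> strat_pos f k \<delta> \<rho> (2*R) u t"
          using h by (intro pos) auto
        moreover have "min (\<rho>/2) (R/2) \<in> {0<..<R}" using \<rho> h by auto
        ultimately show "\<exists>\<rho>'\<in>{0<..<R}. strat_pos f k \<epsilon> \<rho>' R u t \<subseteq> strat_pos f k \<delta> \<rho> (2*R) u t" ..
      qed
      then show ?thesis using True by (simp add: strat_def)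
    next
      case False
      then show ?thesis
        using pos[OF h(5,1-4), of r r k] h by (simp add: strat_def)
    qed
    show "strat f k \<delta> r (2*R) u t \<subseteq> strat f k \<delta> r R u t"
    proof (cases "r = 0")
      case True
      have "strat_pos f k \<delta> \<rho> (2*R) u t \<subseteq> strat_pos f k \<delta> \<rho> R u t" for \<rho>
        using h by (intro strat_pos_mono) auto
      then have "(\<Inter>\<rho>\<in>{0<..<2*R}. strat_pos f k \<delta> \<rho> (2*R) u t) \<subseteq> (\<Inter>\<rho>\<in>{0<..<R}. strat_pos f k \<delta> \<rho> R u t)"
        using h by (intro INF_mono) force
      then show ?thesis using True by (simp add: strat_def)
    next
      case False
      then show ?thesis using h strat_pos_mono[of R "2*R"] by (simp add: strat_def)
    qed
  qed
qed

end
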